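(* Let $G$ be a connected reductive algebraic group over $\mathbb{C}$ with Lie algebra $\mathfrak{g}$, let $\mathcal{O}$ be a nonzero nilpotent orbit of $\mathfrak{g}$, and fix $e\in\mathcal{O}$. Consider the morphism $$\eta_{\mathfrak{g},e}\colon G\times[e,\mathfrak{g}]\longrightarrow\mathfrak{g},\qquad (g,x)\longmapsto g(x),$$ where $g(x)$ denotes the adjoint action. Then $\mathcal{O}$ verifies $\mathrm{RC}_1$ if and only if the closure of the image of $\eta_{\mathfrak{g},e}$ is strictly contained in $\mathfrak{g}_{\mathcal{O}}$, where $\mathfrak{g}_{\mathcal{O}}$ is the smallest semisimple ideal of $\mathfrak{g}$ containing $\mathcal{O}$.
   Context: For a scheme $X$ of finite type over $\mathbb{C}$ and $m\in\mathbb{N}$, $\mathcal{J}_m(X)$ denotes the $m$-th jet scheme of $X$, i.e. the scheme with $\mathrm{Hom}(Z,\mathcal{J}_m(X))=\mathrm{Hom}(Z\times \mathrm{Spec}\,\mathbb{C}[t]/(t^{m+1}),X)$ for every scheme $Z$ over $\mathbb{C}$, and $\pi_{X,m}:\mathcal{J}_m(X)\to X$ is the canonical projection. Closures $\overline{\mathcal{O}}$ of nilpotent orbits are regarded as reduced affine schemes. Definition of $\mathrm{RC}_1$: a nilpotent orbit $\mathcal{O}$ verifies $\mathrm{RC}_1$ if $\pi_{\overline{\mathcal{O}},1}^{-1}(0)$ is not contained in the closure of $\pi_{\overline{\mathcal{O}},1}^{-1}(\mathcal{O})$. *)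

theory Defs
  imports "HOL-Analysis.Analysis" "HOL-Computational_Algebra.Polynomial"
begin

text \<open>
  Varieties and schemes of finite type over the complex numbers are handled through their
  complex points.  A closed subscheme of an affine space is given by its ideal in the algebra of
  polynomial functions; a reduced one by the full vanishing ideal of its point set.  Closures and
  inclusions of constructible subsets of a scheme of finite type over an algebraically closed field
  may be computed on closed points, so nothing is lost in topological assertions.
\<close>

section \<open>Polynomial functions and the Zariski topology\<close>

text \<open>The parameter \<open>C\<close> is the set of coordinate functions of the affine space \<open>'a\<close>.\<close>

inductive_set poly_funs :: "('a \<Rightarrow> complex) set \<Rightarrow> ('a \<Rightarrow> complex) set"
  for C :: "('a \<Rightarrow> complex) set"
  where
    const: "(\<lambda>_. c) \<in> poly_funs C"
  | coord: "f \<in> C \<Longrightarrow> f \<in> poly_funs C"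
  | add: "f \<in> poly_funs C \<Longrightarrow> g \<in> poly_funs C \<Longrightarrow> (\<lambda>x. f x + g x) \<in> poly_funs C"
  | mult: "f \<in> poly_funs C \<Longrightarrow> g \<in> poly_funs C \<Longrightarrow> (\<lambda>x. f x * g x) \<in> poly_funs C"

definition vanishing_ideal :: "('a \<Rightarrow> complex) set \<Rightarrow> 'a set \<Rightarrow> ('a \<Rightarrow> complex) set"
  where "vanishing_ideal C X = {f \<in> poly_funs C. \<forall>x\<in>X. f x = 0}"

definition zariski :: "('a \<Rightarrow> complex) set \<Rightarrow> 'a topology"
  where "zariski C = topology (\<lambda>U. \<exists>F \<subseteq> poly_funs C. U = {x. \<exists>f\<in>F. f x \<noteq> 0})"

lemma istopology_zariski:
  "istopology (\<lambda>U. \<exists>F \<subseteq> poly_funs C. U = {x. \<exists>f\<in>F. f x \<noteq> 0})" (is "istopology ?P")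
  unfolding istopology_def
proof (intro conjI allI impI)
  fix S T assume "?P S" "?P T"
  then obtain F F' where F: "F \<subseteq> poly_funs C" "S = {x. \<exists>f\<in>F. f x \<noteq> 0}"
    and F': "F' \<subseteq> poly_funs C" "T = {x. \<exists>f\<in>F'. f x \<noteq> 0}" by blast
  let ?H = "(\<lambda>(f, g). \<lambda>x. f x * g x) ` (F \<times> F')"
  have "?H \<subseteq> poly_funs C" using F F' by (auto intro: poly_funs.mult)
  moreover have "S \<inter> T = {x. \<exists>f\<in>?H. f x \<noteq> 0}" using F F' by fastforce
  ultimately show "?P (S \<inter> T)" by blast
next
  fix K assume K: "\<forall>U\<in>K. ?P U"
  let ?H = "{f \<in> poly_funs C. {x. f x \<noteq> 0} \<subseteq> \<Union>K}"
  have "\<Union>K \<subseteq> {x. \<exists>f\<in>?H. f x \<noteq> 0}"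
  proof
    fix x assume "x \<in> \<Union>K"
    then obtain U where U: "U \<in> K" "x \<in> U" by blast
    with K obtain F where F: "F \<subseteq> poly_funs C" "U = {x. \<exists>f\<in>F. f x \<noteq> 0}" by blast
    with U obtain f where "f \<in> F" "f x \<noteq> 0" by blast
    then show "x \<in> {x. \<exists>f\<in>?H. f x \<noteq> 0}" using F U by blast
  qed
  then have "\<Union>K = {x. \<exists>f\<in>?H. f x \<noteq> 0}" by blast
  then show "?P (\<Union>K)" by (intro exI[of _ ?H]) auto
qed

lemma openin_zariski:
  "openin (zariski C) U \<longleftrightarrow> (\<exists>F \<subseteq> poly_funs C. U = {x. \<exists>f\<in>F. f x \<noteq> 0})"
  by (simp add: zariski_def istopology_zariski)

lemma topspace_zariski [simp]: "topspace (zariski C) = UNIV"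
proof -
  have "openin (zariski C) UNIV"
    unfolding openin_zariski by (intro exI[of _ "{\<lambda>_. 1}"]) (auto intro: poly_funs.const)
  then show ?thesis using openin_subset by fastforce
qed

lemma closedin_zariski:
  "closedin (zariski C) S \<longleftrightarrow> (\<exists>F \<subseteq> poly_funs C. S = {x. \<forall>f\<in>F. f x = 0})"
proof -
  have "S = {x. \<forall>f\<in>F. f x = 0} \<longleftrightarrow> UNIV - S = {x. \<exists>f\<in>F. f x \<noteq> 0}" for F :: "('a \<Rightarrow> complex) set"
    by auto
  then show ?thesis by (simp add: closedin_def openin_zariski)
qed

lemma closure_of_zariski:
  "zariski C closure_of X = {x. \<forall>f\<in>vanishing_ideal C X. f x = 0}"
proof
  have "closedin (zariski C) {x. \<forall>f\<in>vanishing_ideal C X. f x = 0}"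
    unfolding closedin_zariski by (intro exI[of _ "vanishing_ideal C X"]) (auto simp: vanishing_ideal_def)
  then show "zariski C closure_of X \<subseteq> {x. \<forall>f\<in>vanishing_ideal C X. f x = 0}"
    by (intro closure_of_minimal) (auto simp: vanishing_ideal_def)
  obtain F where F: "F \<subseteq> poly_funs C" "zariski C closure_of X = {x. \<forall>f\<in>F. f x = 0}"
    using closedin_closure_of[of "zariski C" X] unfolding closedin_zariski by blast
  have "X \<subseteq> zariski C closure_of X" by (simp add: closure_of_subset)
  then have "F \<subseteq> vanishing_ideal C X" using F by (auto simp: vanishing_ideal_def)
  then show "{x. \<forall>f\<in>vanishing_ideal C X. f x = 0} \<subseteq> zariski C closure_of X" using F by auto
qed


section \<open>Matrices\<close>

text \<open>
  The library's scalar multiplication of vectors does not give complex scalar multiplication on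
  \<open>complex^'n^'n\<close>, and its ring-style product there would be componentwise.
\<close>

definition cscale :: "complex \<Rightarrow> complex^'n^'n \<Rightarrow> complex^'n^'n"
  where "cscale c A = (\<chi> i j. c * A $ i $ j)"

lemma vector_space_cscale: "vector_space cscale"
  by unfold_locales (simp_all add: cscale_def vec_eq_iff algebra_simps)

definition lie_bracket :: "complex^'n^'n \<Rightarrow> complex^'n^'n \<Rightarrow> complex^'n^'n"
  where "lie_bracket A B = A ** B - B ** A"

definition nilpotent_mat :: "complex^'n^'n \<Rightarrow> bool"
  where "nilpotent_mat A \<longleftrightarrow> (\<exists>k. (((**) A) ^^ k) (mat 1) = 0)"

definition unipotent_mat :: "complex^'n^'n \<Rightarrow> bool"
  where "unipotent_mat A \<longleftrightarrow> nilpotent_mat (A - mat 1)"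

definition mat_coords :: "(complex^'n^'n \<Rightarrow> complex) set"
  where "mat_coords = {\<lambda>A. A $ i $ j | i j. True}"

abbreviation zariski_mat :: "(complex^'n^'n) topology"
  where "zariski_mat \<equiv> zariski mat_coords"


section \<open>Jet schemes\<close>

text \<open>
  A point of the \<open>m\<close>-th jet scheme of \<open>X = V(I)\<close> is a morphism from
  \<open>Spec \<complex>[t]/(t^(m+1))\<close> to \<open>X\<close>, i.e. a truncated curve \<open>\<gamma>(t) = \<gamma> 0 + t \<gamma> 1 + \<dots> + t^m \<gamma> m\<close> with
  \<open>f(\<gamma>(t)) = 0\<close> modulo \<open>t^(m+1)\<close> for all \<open>f\<close> in \<open>I\<close>.  The coefficients \<open>\<gamma> k\<close> with \<open>k > m\<close> are
  normalised to 0, so that the jets of the affine space of matrices form an affine space with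
  coordinates the entries of the \<open>\<gamma> k\<close> with \<open>k \<le> m\<close>.
\<close>

definition jet_curve :: "nat \<Rightarrow> (nat \<Rightarrow> complex^'n^'n) \<Rightarrow> complex \<Rightarrow> complex^'n^'n"
  where "jet_curve m \<gamma> t = (\<Sum>k\<le>m. cscale (t ^ k) (\<gamma> k))"

definition jets :: "nat \<Rightarrow> (complex^'n^'n \<Rightarrow> complex) set \<Rightarrow> (nat \<Rightarrow> complex^'n^'n) set"
  where "jets m I = {\<gamma>. (\<forall>k>m. \<gamma> k = 0) \<and>
    (\<forall>f\<in>I. \<exists>p :: complex poly. (\<forall>t. poly p t = f (jet_curve m \<gamma> t)) \<and> [:0, 1:] ^ (m + 1) dvd p)}"

definition jet_coords :: "((nat \<Rightarrow> complex^'n^'n) \<Rightarrow> complex) set"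
  where "jet_coords = {\<lambda>\<gamma>. \<gamma> k $ i $ j | k i j. True}"

definition jet_space :: "nat \<Rightarrow> (complex^'n^'n \<Rightarrow> complex) set \<Rightarrow> (nat \<Rightarrow> complex^'n^'n) topology"
  where "jet_space m I = subtopology (zariski jet_coords) (jets m I)"

text \<open>The preimage of \<open>S\<close> under the canonical projection from the jet scheme to the scheme \<open>V(I)\<close>.\<close>

definition jets_over ::
  "nat \<Rightarrow> (complex^'n^'n \<Rightarrow> complex) set \<Rightarrow> (complex^'n^'n) set \<Rightarrow> (nat \<Rightarrow> complex^'n^'n) set"
  where "jets_over m I S = {\<gamma> \<in> jets m I. \<gamma> 0 \<in> S}"


section \<open>Reductive groups and their Lie algebras\<close>

text \<open>A linear algebraic group: a subgroup of the general linear group, Zariski closed in it.\<close>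

definition algebraic_group :: "(complex^'n^'n) set \<Rightarrow> bool"
  where "algebraic_group G \<longleftrightarrow>
    mat 1 \<in> G \<and> (\<forall>g\<in>G. \<forall>h\<in>G. g ** h \<in> G) \<and> (\<forall>g\<in>G. matrix_inv g \<in> G) \<and>
    closedin (subtopology zariski_mat {g. invertible g}) G"

definition Ad :: "complex^'n^'n \<Rightarrow> complex^'n^'n \<Rightarrow> complex^'n^'n"
  where "Ad g x = g ** x ** matrix_inv g"

text \<open>
  Reductive: the unipotent radical, i.e. the largest connected normal unipotent closed subgroup,
  is trivial.
\<close>

definition reductive_group :: "(complex^'n^'n) set \<Rightarrow> bool"
  where "reductive_group G \<longleftrightarrow> algebraic_group G \<and>
    (\<forall>U. algebraic_group U \<and> U \<subseteq> G \<and> (\<forall>g\<in>G. \<forall>u\<in>U. g ** u ** matrix_inv g \<in> U) \<and>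
      connected_space (subtopology zariski_mat U) \<and> (\<forall>u\<in>U. unipotent_mat u) \<longrightarrow> U = {mat 1})"

definition connected_reductive_group :: "(complex^'n^'n) set \<Rightarrow> bool"
  where "connected_reductive_group G \<longleftrightarrow>
    reductive_group G \<and> connected_space (subtopology zariski_mat G)"

text \<open>
  The tangent space at the identity: all \<open>X\<close> such that \<open>1 + \<epsilon> X\<close> is a point of \<open>G\<close> over the dual
  numbers.
\<close>

definition Lie :: "(complex^'n^'n) set \<Rightarrow> (complex^'n^'n) set"
  where "Lie G = {X. (\<lambda>_. 0)(0 := mat 1, 1 := X) \<in> jets 1 (vanishing_ideal mat_coords G)}"


section \<open>Semisimple ideals\<close>

definition lie_ideal :: "(complex^'n^'n) set \<Rightarrow> (complex^'n^'n) set \<Rightarrow> bool"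
  where "lie_ideal L I \<longleftrightarrow>
    module.subspace cscale I \<and> I \<subseteq> L \<and> (\<forall>x\<in>L. \<forall>y\<in>I. lie_bracket x y \<in> I)"

primrec derived_series :: "(complex^'n^'n) set \<Rightarrow> nat \<Rightarrow> (complex^'n^'n) set"
  where
    "derived_series L 0 = L"
  | "derived_series L (Suc k) =
      module.span cscale {lie_bracket x y | x y. x \<in> derived_series L k \<and> y \<in> derived_series L k}"

definition solvable_lie :: "(complex^'n^'n) set \<Rightarrow> bool"
  where "solvable_lie L \<longleftrightarrow> (\<exists>k. derived_series L k = {0})"

text \<open>Semisimple: the radical, i.e. the largest solvable ideal, is zero.\<close>

definition semisimple_lie :: "(complex^'n^'n) set \<Rightarrow> bool"
  where "semisimple_lie L \<longleftrightarrow> (\<forall>R. lie_ideal L R \<and> solvable_lie R \<longrightarrow> R = {0})"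

definition smallest_semisimple_ideal ::
  "(complex^'n^'n) set \<Rightarrow> (complex^'n^'n) set \<Rightarrow> (complex^'n^'n) set"
  where "smallest_semisimple_ideal L S = (LEAST I. lie_ideal L I \<and> semisimple_lie I \<and> S \<subseteq> I)"


section \<open>Nilpotent orbits\<close>

text \<open>
  An element of the Lie algebra of an algebraic group \<open>G\<close> is nilpotent if it is so as a matrix;
  this does not depend on the embedding of \<open>G\<close> into a general linear group.  In particular,
  nonzero central elements of a reductive Lie algebra are not nilpotent.
\<close>

definition nilpotent_orbit :: "(complex^'n^'n) set \<Rightarrow> (complex^'n^'n) set \<Rightarrow> bool"
  where "nilpotent_orbit G Orb \<longleftrightarrow>
    (\<exists>x\<in>Lie G. nilpotent_mat x \<and> Orb = {Ad g x | g. g \<in> G})"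

text \<open>
  The closure of the orbit may be taken in the space of all matrices, in which the Lie algebra is
  a linear subspace.  It carries the reduced structure, hence the full vanishing ideal.
\<close>

definition RC1 :: "(complex^'n^'n) set \<Rightarrow> bool"
  where "RC1 Orb \<longleftrightarrow>
    (let I = vanishing_ideal mat_coords (zariski_mat closure_of Orb)
     in \<not> jets_over 1 I {0} \<subseteq> jet_space 1 I closure_of jets_over 1 I Orb)"

definition eta :: "(complex^'n^'n) \<times> (complex^'n^'n) \<Rightarrow> complex^'n^'n"
  where "eta = (\<lambda>(g, x). Ad g x)"

end

theory Submission
  imports Defs "HOL-Complex_Analysis.Cauchy_Integral_Formula"
    "Jordan_Normal_Form.Jordan_Normal_Form_Existence"
begin

text \<open>
  A nilpotent orbit \<open>O\<close> is a cone: the trace form of a reductive group is nondegenerate on its Lie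
  algebra, hence \<open>[e, g]\<close> is the orthogonal of the centralizer of \<open>e\<close>; it contains \<open>e\<close>, and
  \<open>[h, e] = e\<close> gives \<open>Ad (exp (s h)) e = exp s e\<close>.  Therefore the tangent space of the closure of
  \<open>O\<close> at 0 is the linear span of \<open>O\<close>, which is the smallest semisimple ideal containing \<open>O\<close>.  The
  tangent space at \<open>e\<close> is \<open>[e, g]\<close>: the rank conditions on the powers of a matrix cut out the
  tangent space of a nilpotent conjugacy class of matrices, and its intersection with \<open>g\<close> is
  orthogonal to the centralizer of \<open>e\<close> in \<open>g\<close>.  Contracting the base point of a tangent vector
  along the cone, the closure of the tangent bundle of \<open>O\<close> meets the fibre over 0 exactly in the
  closure of the image of \<open>eta\<close>.

  Nondegeneracy rests on two facts.  By Chevalley's replicas the radical of the trace form consists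
  of nilpotent matrices, so by Engel's theorem its exponentials act trivially on the traces of
  the elements of \<open>G\<close>; and the elements doing so form a normal connected unipotent subgroup.
\<close>

text \<open>The Lie algebra is known only as the tangent space of an arbitrary matrix group, with no
  roots, Levi decomposition or sl2-triples at hand. All structure is drawn from one invariant
  pairing, the trace form of the given representation. The Killing form would not do: it degenerates
  on the centre, while \<open>[e, g]\<close> has to be exactly the orthogonal of the centralizer of
  \<open>e\<close> inside all of \<open>Lie G\<close>. Replicas enter because pairing
  \<open>X\<close> with itself gives the sum of the squares of its eigenvalues, which may cancel.
  Pairing \<open>X\<close> with a matrix \<open>D\<close> that has the conjugated eigenvalues gives
  a sum of squared moduli instead. This \<open>D\<close> stays in \<open>Lie G\<close> because
  conjugation is additive, so it respects every additive relation among the eigenvalues that the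
  equations of the group impose on \<open>exp (t X)\<close>. The ideal of the orbit closure is never
  described. Each tangent space is bounded from above by a few explicit equations (linear forms, and
  determinants for the surrounding conjugacy class of matrices) and from below by curves inside the
  orbit.\<close>

no_notation Matrix.vec_index (infixl "$" 100)
hide_const (open) Matrix.mat Matrix.row Matrix.col Matrix.vec Matrix.rows Matrix.transpose_mat
  Matrix.scalar_prod Determinant.det Matrix.unit_vec Matrix.diag_mat VectorSpace.subspace Matrix.orthogonal Module.module.smult
hide_type (open) Matrix.mat Matrix.vec
hide_fact (open) Matrix.vec_eq_iff Matrix.mat_def Congruence.set_eqI VectorSpace.subspace_def
  Matrix.orthogonal_def Determinant.det_def

section \<open>Matrix algebra and polynomial functions\<close>

interpretation cs: vector_space cscale
  by (rule vector_space_cscale)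

lemma cscale_nth [simp]: "cscale c A $ i $ j = c * A $ i $ j"
  by (simp add: cscale_def)

lemma matrix_mul_nth: "(A ** B) $ i $ j = (\<Sum>k\<in>UNIV. A $ i $ k * B $ k $ j)"
  by (simp add: matrix_matrix_mult_def)

lemma cscale_mult_left [simp]: "cscale c A ** B = cscale c (A ** B)"
  by (simp add: vec_eq_iff matrix_mul_nth sum_distrib_left mult.assoc)

lemma cscale_mult_right [simp]: "A ** cscale c B = cscale c (A ** B)"
  by (simp add: vec_eq_iff matrix_mul_nth sum_distrib_left mult_ac)

lemma matrix_zero_mult [simp]: "(0 :: complex^'n^'n) ** A = 0" "A ** (0 :: complex^'n^'n) = 0"
  by (simp_all add: vec_eq_iff matrix_mul_nth)

lemma matrix_diff_distrib:
  fixes A B C :: "complex^'n^'n"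
  shows "A ** (B - C) = A ** B - A ** C" "(B - C) ** A = B ** A - C ** A"
  by (simp_all add: vec_eq_iff matrix_mul_nth algebra_simps sum_subtractf)

lemma matrix_add_distrib:
  fixes A B C :: "complex^'n^'n"
  shows "A ** (B + C) = A ** B + A ** C" "(B + C) ** A = B ** A + C ** A"
  by (simp_all add: vec_eq_iff matrix_mul_nth algebra_simps sum.distrib)

lemma matrix_uminus_mult [simp]:
  fixes A B :: "complex^'n^'n"
  shows "A ** (- B) = - (A ** B)" "(- A) ** B = - (A ** B)"
  by (simp_all add: vec_eq_iff matrix_mul_nth sum_negf)

lemma matrix_sum_distrib:
  fixes A :: "complex^'n^'n"
  shows "A ** (\<Sum>x\<in>S. f x) = (\<Sum>x\<in>S. A ** f x)" "(\<Sum>x\<in>S. f x) ** A = (\<Sum>x\<in>S. f x ** A)"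
  by (induction S rule: infinite_finite_induct) (simp_all add: matrix_add_distrib)

lemmas mat_distrib = matrix_diff_distrib matrix_add_distrib cs.scale_right_distrib cs.scale_right_diff_distrib

lemma trace_cscale [simp]: "trace (cscale c A) = c * trace A"
  by (simp add: trace_def sum_distrib_left)

lemma trace_zero [simp]: "trace (0 :: complex^'n^'n) = 0"
  by (simp add: trace_def)

lemma trace_cyclic: "trace (A ** B ** C) = trace (B ** C ** (A :: complex^'n^'n))"
  by (metis matrix_mul_assoc trace_mul_sym)

lemma trace_bracket:
  "trace (lie_bracket x y ** z) = trace (x ** lie_bracket y (z :: complex^'n^'n))"
  using trace_cyclic[of y x z]
  by (simp add: lie_bracket_def mat_distrib trace_sub matrix_mul_assoc)

definition mpow :: "complex^'n^'n \<Rightarrow> nat \<Rightarrow> complex^'n^'n"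
  where "mpow A k = (((**) A) ^^ k) (mat 1)"

lemma mpow_0 [simp]: "mpow A 0 = mat 1"
  by (simp add: mpow_def)

lemma mpow_Suc: "mpow A (Suc k) = A ** mpow A k"
  by (simp add: mpow_def)

lemma mpow_commute: "A ** B = B ** A \<Longrightarrow> mpow A k ** B = B ** mpow A k"
  by (induction k) (simp_all add: mpow_Suc, metis matrix_mul_assoc)

lemma mpow_Suc2: "mpow A (Suc k) = mpow A k ** A"
  by (simp add: mpow_Suc mpow_commute)

lemma mpow_1 [simp]: "mpow A (Suc 0) = A"
  by (simp add: mpow_Suc)

lemma mpow_add: "mpow A (j + k) = mpow A j ** mpow A k"
  by (induction j) (simp_all add: mpow_Suc matrix_mul_assoc)

lemma mpow_mult_commuting:
  assumes "A ** B = B ** A"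
  shows "mpow (A ** B) k = mpow A k ** mpow B k"
proof (induction k)
  case (Suc k)
  have "mpow (A ** B) (Suc k) = A ** (B ** mpow A k) ** mpow B k"
    by (simp add: mpow_Suc Suc matrix_mul_assoc)
  also have "B ** mpow A k = mpow A k ** B" using mpow_commute[OF assms] by simp
  finally show ?case by (simp add: mpow_Suc matrix_mul_assoc)
qed simp

lemma mpow_conj:
  assumes "q' ** q = mat 1" "q ** q' = mat 1"
  shows "q ** mpow A k ** q' = mpow (q ** A ** q') k"
proof (induction k)
  case 0
  then show ?case using assms by simp
next
  case (Suc k)
  have "mpow (q ** A ** q') (Suc k) = q ** A ** (q' ** q) ** mpow A k ** q'"
    by (simp add: mpow_Suc Suc[symmetric] matrix_mul_assoc)
  then show ?case using assms by (simp add: mpow_Suc matrix_mul_assoc)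
qed

lemma nilpotent_mat_iff: "nilpotent_mat A \<longleftrightarrow> (\<exists>k. mpow A k = 0)"
  by (simp add: nilpotent_mat_def mpow_def)

lemma mpow_zero_mono: "mpow A k = 0 \<Longrightarrow> k \<le> m \<Longrightarrow> mpow A m = 0"
  using mpow_add[of A k "m - k"] by simp

lemma nilpotent_mult_commuting:
  assumes "nilpotent_mat A" "A ** B = B ** A"
  shows "nilpotent_mat (A ** B)"
proof -
  obtain k where "mpow A k = 0" using assms(1) by (auto simp: nilpotent_mat_iff)
  then have "mpow (A ** B) k = 0" using mpow_mult_commuting[OF assms(2), of k] by simp
  then show ?thesis by (auto simp: nilpotent_mat_iff)
qed

lemma nilpotent_conj:
  assumes "nilpotent_mat A" "q' ** q = mat 1" "q ** q' = mat 1"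
  shows "nilpotent_mat (q ** A ** q')"
proof -
  obtain k where "mpow A k = 0" using assms(1) by (auto simp: nilpotent_mat_iff)
  then have "mpow (q ** A ** q') k = 0" using mpow_conj[OF assms(2,3), of A k] by simp
  then show ?thesis by (auto simp: nilpotent_mat_iff)
qed

section \<open>The adjoint action and the Lie bracket\<close>

lemma Ad_0 [simp]: "Ad g 0 = 0"
  by (simp add: Ad_def)

lemma Ad_add: "Ad g (x + y) = Ad g x + Ad g y"
  by (simp add: Ad_def mat_distrib)

lemma Ad_diff: "Ad g (x - y) = Ad g x - Ad g y"
  by (simp add: Ad_def mat_distrib)

lemma Ad_cscale: "Ad g (cscale c x) = cscale c (Ad g x)"
  by (simp add: Ad_def)

lemma matrix_inv_mult:
  fixes g :: "complex^'n^'n"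
  assumes "invertible g"
  shows "g ** matrix_inv g = mat 1" "matrix_inv g ** g = mat 1"
proof -
  have "\<exists>g'. g ** g' = mat 1 \<and> g' ** g = mat 1" using assms by (simp add: invertible_def)
  then have "g ** matrix_inv g = mat 1 \<and> matrix_inv g ** g = mat 1"
    unfolding matrix_inv_def by (rule someI_ex)
  then show "g ** matrix_inv g = mat 1" "matrix_inv g ** g = mat 1" by auto
qed

lemma matrix_inv_eqI:
  fixes g h :: "complex^'n^'n"
  assumes "g ** h = mat 1"
  shows "matrix_inv g = h" "invertible g"
proof -
  have "h ** g = mat 1" using assms matrix_left_right_inverse by blast
  then show inv: "invertible g" using assms invertible_def by blast
  have "matrix_inv g = matrix_inv g ** (g ** h)" using assms by simp
  also have "\<dots> = h" using matrix_inv_mult[OF inv] by (simp add: matrix_mul_assoc)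
  finally show "matrix_inv g = h" .
qed

lemma Ad_mult:
  assumes "invertible g"
  shows "Ad g (x ** y) = Ad g x ** Ad g y"
proof -
  have "Ad g x ** Ad g y = g ** x ** (matrix_inv g ** g) ** y ** matrix_inv g"
    by (simp add: Ad_def matrix_mul_assoc)
  then show ?thesis by (simp add: matrix_inv_mult[OF assms] Ad_def matrix_mul_assoc)
qed

lemma Ad_bracket:
  assumes "invertible g"
  shows "Ad g (lie_bracket x y) = lie_bracket (Ad g x) (Ad g y)"
  by (simp add: lie_bracket_def Ad_diff Ad_mult[OF assms])

lemma trace_Ad: "invertible g \<Longrightarrow> trace (Ad g x) = trace (x :: complex^'n^'n)"
  using trace_cyclic[of g x "matrix_inv g"] trace_mul_sym[of "x ** matrix_inv g" g]
  by (simp add: Ad_def matrix_mul_assoc[symmetric] matrix_inv_mult)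

lemma Ad_Ad:
  assumes "invertible g" "invertible h"
  shows "Ad g (Ad h x) = Ad (g ** h) x"
proof -
  have "g ** h ** (matrix_inv h ** matrix_inv g) = g ** (h ** matrix_inv h) ** matrix_inv g"
    by (simp add: matrix_mul_assoc)
  then have "matrix_inv (g ** h) = matrix_inv h ** matrix_inv g"
    by (intro matrix_inv_eqI) (simp add: assms matrix_inv_mult)
  then show ?thesis by (simp add: Ad_def matrix_mul_assoc)
qed

lemma matrix_inv_mat1 [simp]: "matrix_inv (mat 1 :: complex^'n^'n) = mat 1"
  by (rule matrix_inv_eqI) simp

lemma Ad_1 [simp]: "Ad (mat 1) x = x"
  by (simp add: Ad_def)

lemma matrix_inv_inv: "invertible g \<Longrightarrow> matrix_inv (matrix_inv g) = (g :: complex^'n^'n)"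
  "invertible g \<Longrightarrow> invertible (matrix_inv g)"
  by (metis matrix_inv_eqI matrix_inv_mult(2))+

lemma Ad_inv_cancel:
  assumes "invertible g"
  shows "Ad (matrix_inv g) (Ad g x) = x" "Ad g (Ad (matrix_inv g) x) = x"
  using assms by (simp_all add: Ad_Ad matrix_inv_inv matrix_inv_mult)

lemma lie_bracket_linear:
  "lie_bracket (x + y) z = lie_bracket x z + lie_bracket y z"
  "lie_bracket z (x + y) = lie_bracket z x + lie_bracket z y"
  "lie_bracket (cscale c x) z = cscale c (lie_bracket x z)"
  "lie_bracket z (cscale c x) = cscale c (lie_bracket z x)"
  "lie_bracket 0 z = 0" "lie_bracket z 0 = 0"
  by (simp_all add: lie_bracket_def mat_distrib)

lemma lie_bracket_skew: "lie_bracket x y = - lie_bracket y x"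
  by (simp add: lie_bracket_def)

lemma lie_bracket_jacobi:
  "lie_bracket x (lie_bracket y z) = lie_bracket (lie_bracket x y) z + lie_bracket y (lie_bracket x z)"
  by (simp add: lie_bracket_def mat_distrib matrix_mul_assoc)

text \<open>Gives complex subspaces a real dimension and a real orthogonal complement.\<close>

lemma cs_subspace_real: "cs.subspace S \<Longrightarrow> subspace S"
proof -
  have "c *\<^sub>R (x :: complex^'n^'n) = cscale (of_real c) x" for c and x :: "complex^'n^'n"
    by (simp add: vec_eq_iff) (simp add: scaleR_conv_of_real)
  then show "cs.subspace S \<Longrightarrow> subspace S" unfolding cs.subspace_def subspace_def by metis
qed

lemma trace_mult_sum: "trace (A ** B) = (\<Sum>i\<in>UNIV. \<Sum>j\<in>UNIV. A $ i $ j * B $ j $ i)"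
  by (simp add: trace_def matrix_mul_nth)

text \<open>If \<open>w\<close> is orthogonal to \<open>S\<close> for the real inner product and
  \<open>z\<close> is its conjugate transpose, then \<open>w \<bullet> s\<close> is the real part of
  \<open>trace (z ** s)\<close>. Every linear form on matrices has this shape, so the lemma supplies
  the linear equations of subspaces throughout.\<close>

lemma trace_separation:
  assumes S: "cs.subspace S" and v: "v \<notin> S"
  obtains z where "\<And>s. s \<in> S \<Longrightarrow> trace (z ** s) = 0" "trace (z ** v) \<noteq> 0"
proof -
  obtain y w where y: "y \<in> span S" and w: "\<And>s. s \<in> span S \<Longrightarrow> orthogonal w s" and v_eq: "v = y + w"
    using orthogonal_subspace_decomp_exists[of S v] by blast
  have span: "span S = S" using cs_subspace_real[OF S] by (simp add: span_eq_iff)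
  have "w \<noteq> 0" using v y v_eq span by auto
  define z where "z = (\<chi> i j. cnj (w $ j $ i))"
  have Re: "Re (trace (z ** s)) = w \<bullet> s" for s
  proof -
    have "trace (z ** s) = (\<Sum>i\<in>UNIV. \<Sum>j\<in>UNIV. cnj (w $ j $ i) * s $ j $ i)"
      by (simp add: trace_mult_sum z_def)
    also have "\<dots> = (\<Sum>j\<in>UNIV. \<Sum>i\<in>UNIV. cnj (w $ j $ i) * s $ j $ i)"
      by (rule sum.swap)
    finally show ?thesis by (simp add: inner_vec_def inner_complex_def)
  qed
  have "trace (z ** s) = 0" if "s \<in> S" for s
  proof -
    \<comment> \<open>Complex linearity of \<open>S\<close>: the real part at
      \<open>cscale \<i> s\<close> is minus the imaginary part at \<open>s\<close>.\<close>
    have "cscale \<i> s \<in> S" using S that by (rule cs.subspace_scale)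
    then have "Re (trace (z ** cscale \<i> s)) = 0"
      unfolding Re using w span by (auto simp: orthogonal_def)
    moreover have "Re (trace (z ** s)) = 0"
      unfolding Re using w span that by (auto simp: orthogonal_def)
    ultimately show ?thesis by (simp add: complex_eq_iff)
  qed
  moreover have "trace (z ** v) \<noteq> 0"
  proof
    assume "trace (z ** v) = 0"
    then have "w \<bullet> v = 0" using Re[of v] by simp
    moreover have "w \<bullet> y = 0" using w[OF y] by (simp add: orthogonal_def)
    ultimately show False using \<open>w \<noteq> 0\<close> v_eq by (simp add: inner_add_right)
  qed
  ultimately show ?thesis by (rule that)
qed

section \<open>Polynomial functions and polynomial maps\<close>

lemma poly_funs_sum:
  "(\<And>x. x \<in> S \<Longrightarrow> f x \<in> poly_funs C) \<Longrightarrow> (\<lambda>a. \<Sum>x\<in>S. f x a) \<in> poly_funs C"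
  by (induction S rule: infinite_finite_induct)
    (simp_all add: poly_funs.const poly_funs.add)

lemma poly_funs_prod:
  "(\<And>x. x \<in> S \<Longrightarrow> f x \<in> poly_funs C) \<Longrightarrow> (\<lambda>a. \<Prod>x\<in>S. f x a) \<in> poly_funs C"
  by (induction S rule: infinite_finite_induct)
    (simp_all add: poly_funs.const poly_funs.mult)

lemma poly_funs_compose:
  assumes "f \<in> poly_funs C" "\<And>c. c \<in> C \<Longrightarrow> (\<lambda>x. c (\<phi> x)) \<in> poly_funs C'"
  shows "(\<lambda>x. f (\<phi> x)) \<in> poly_funs C'"
  using assms(1) by induction (auto intro: poly_funs.intros assms(2))

lemma poly_funs_compose_poly:
  assumes "f \<in> poly_funs C" "\<And>c. c \<in> C \<Longrightarrow> \<exists>p. \<forall>t. c (\<phi> t) = poly p t"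
  shows "\<exists>p. \<forall>t. f (\<phi> t) = poly p t"
  using assms(1)
proof induction
  case (const c)
  show ?case by (rule exI[of _ "[:c:]"]) simp
next
  case (add f g)
  then show ?case by (metis poly_add)
next
  case (mult f g)
  then show ?case by (metis poly_mult)
qed (rule assms(2))

definition poly_map :: "('a \<Rightarrow> complex) set \<Rightarrow> ('a \<Rightarrow> complex^'n^'n) \<Rightarrow> bool"
  where "poly_map C \<phi> \<longleftrightarrow> (\<forall>i j. (\<lambda>x. \<phi> x $ i $ j) \<in> poly_funs C)"

lemma poly_map_const: "poly_map C (\<lambda>_. A)"
  by (simp add: poly_map_def poly_funs.const)

lemma poly_map_id: "poly_map mat_coords (\<lambda>x. x)"
  unfolding poly_map_def by (auto intro: poly_funs.coord simp: mat_coords_def)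

lemma poly_map_add: "poly_map C \<phi> \<Longrightarrow> poly_map C \<psi> \<Longrightarrow> poly_map C (\<lambda>x. \<phi> x + \<psi> x)"
  by (simp add: poly_map_def poly_funs.add)

lemma poly_map_mult: "poly_map C \<phi> \<Longrightarrow> poly_map C \<psi> \<Longrightarrow> poly_map C (\<lambda>x. \<phi> x ** \<psi> x)"
  by (simp add: poly_map_def matrix_mul_nth poly_funs_sum poly_funs.mult)

lemma poly_map_mpow: "poly_map C \<phi> \<Longrightarrow> poly_map C (\<lambda>x. mpow (\<phi> x) k)"
  by (induction k) (simp_all add: poly_map_const mpow_Suc poly_map_mult)

lemma poly_map_compose:
  "f \<in> poly_funs mat_coords \<Longrightarrow> poly_map C \<phi> \<Longrightarrow> (\<lambda>x. f (\<phi> x)) \<in> poly_funs C"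
  by (rule poly_funs_compose[of _ mat_coords]) (auto simp: mat_coords_def poly_map_def)

lemma poly_map_trace: "poly_map C \<phi> \<Longrightarrow> (\<lambda>x. trace (\<phi> x)) \<in> poly_funs C"
  by (simp add: trace_def poly_map_def poly_funs_sum)

lemma poly_map_det: "poly_map C \<phi> \<Longrightarrow> (\<lambda>x. det (\<phi> x)) \<in> poly_funs C"
  unfolding det_def by (intro poly_funs_sum poly_funs.mult poly_funs.const poly_funs_prod)
    (simp add: poly_map_def)

section \<open>Derivatives of matrix curves and of polynomial functions\<close>

definition mderiv :: "(complex \<Rightarrow> complex^'n^'n) \<Rightarrow> complex^'n^'n \<Rightarrow> complex \<Rightarrow> bool"
  where "mderiv \<gamma> D t \<longleftrightarrow> (\<forall>i j. ((\<lambda>s. \<gamma> s $ i $ j) has_field_derivative D $ i $ j) (at t))"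

lemma mderiv_const: "mderiv (\<lambda>_. A) 0 t"
  by (simp add: mderiv_def)

lemma mderiv_add: "mderiv \<gamma> D t \<Longrightarrow> mderiv \<delta> E t \<Longrightarrow> mderiv (\<lambda>s. \<gamma> s + \<delta> s) (D + E) t"
  by (simp add: mderiv_def DERIV_add)

lemma mderiv_mult:
  "mderiv \<gamma> D t \<Longrightarrow> mderiv \<delta> E t \<Longrightarrow> mderiv (\<lambda>s. \<gamma> s ** \<delta> s) (D ** \<delta> t + \<gamma> t ** E) t"
  unfolding mderiv_def matrix_mul_nth
  by (auto intro!: derivative_eq_intros simp: matrix_mul_nth sum.distrib mult.commute)

lemma mderiv_cscale:
  "(f has_field_derivative f') (at t) \<Longrightarrow> mderiv \<gamma> D t \<Longrightarrow>
    mderiv (\<lambda>s. cscale (f s) (\<gamma> s)) (cscale f' (\<gamma> t) + cscale (f t) D) t"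
  unfolding mderiv_def by (auto intro!: derivative_eq_intros)

lemma mderiv_compose:
  assumes "(f has_field_derivative f') (at t)" "mderiv \<gamma> D (f t)"
  shows "mderiv (\<lambda>s. \<gamma> (f s)) (cscale f' D) t"
  unfolding mderiv_def
proof (intro allI)
  fix i j
  have "((\<lambda>s. \<gamma> s $ i $ j) has_field_derivative D $ i $ j) (at (f t))"
    using assms(2) by (simp add: mderiv_def)
  from DERIV_chain2[OF this assms(1)]
  show "((\<lambda>s. \<gamma> (f s) $ i $ j) has_field_derivative cscale f' D $ i $ j) (at t)"
    by (simp add: mult.commute)
qed

lemma mderiv_zero_constant:
  assumes "\<And>t. mderiv \<gamma> 0 t"
  shows "\<gamma> t = \<gamma> 0"
proof -
  have "\<gamma> t $ i $ j = \<gamma> 0 $ i $ j" for i j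
  proof -
    have "((\<lambda>s. \<gamma> s $ i $ j) has_field_derivative 0) (at s within UNIV)" for s
      using assms[of s] by (simp add: mderiv_def)
    then obtain c where "\<And>s. \<gamma> s $ i $ j = c"
      using has_field_derivative_zero_constant[of UNIV "\<lambda>s. \<gamma> s $ i $ j"] by auto
    then show ?thesis by simp
  qed
  then show ?thesis by (simp add: vec_eq_iff)
qed

text \<open>A single gradient \<open>g\<close>, polynomial in the base point, has to serve all
  curves at once. This is what makes \<open>dir_deriv\<close> linear in the direction, polynomial in
  the base point and subject to the chain rule.\<close>

lemma poly_gradient:
  fixes f :: "complex^'n^'n \<Rightarrow> complex"
  assumes "f \<in> poly_funs mat_coords"
  shows "\<exists>g. (\<forall>i j. g i j \<in> poly_funs mat_coords) \<and> (\<forall>\<gamma> D t. mderiv \<gamma> D t \<longrightarrow>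
    ((\<lambda>s. f (\<gamma> s)) has_field_derivative (\<Sum>i\<in>UNIV. \<Sum>j\<in>UNIV. g i j (\<gamma> t) * D $ i $ j)) (at t))"
  using assms
proof induction
  case (const c)
  show ?case by (rule exI[of _ "\<lambda>_ _ _. 0"]) (simp add: poly_funs.const)
next
  case (coord f)
  then obtain k l where f: "f = (\<lambda>A. A $ k $ l)" by (auto simp: mat_coords_def)
  have "(\<Sum>i\<in>UNIV. \<Sum>j\<in>UNIV. (if i = k \<and> j = l then 1 else 0) * D $ i $ j) = D $ k $ l" for D :: "complex^'n^'n"
  proof -
    have "(\<Sum>j\<in>UNIV. (if i = k \<and> j = l then 1 else 0) * D $ i $ j) = (if i = k then D $ k $ l else 0)" for i
      by (simp add: mult_delta_left)
    then show ?thesis by simp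
  qed
  then show ?case
    by (intro exI[of _ "\<lambda>i j _. if i = k \<and> j = l then 1 else 0"])
      (auto simp: poly_funs.const f mderiv_def)
next
  case (add f1 f2)
  then obtain g1 g2 where g: "\<forall>i j. g1 i j \<in> poly_funs mat_coords" "\<forall>\<gamma> D t. mderiv \<gamma> D t \<longrightarrow>
      ((\<lambda>s. f1 (\<gamma> s)) has_field_derivative (\<Sum>i\<in>UNIV. \<Sum>j\<in>UNIV. g1 i j (\<gamma> t) * D $ i $ j)) (at t)"
    "\<forall>i j. g2 i j \<in> poly_funs mat_coords" "\<forall>\<gamma> D t. mderiv \<gamma> D t \<longrightarrow>
      ((\<lambda>s. f2 (\<gamma> s)) has_field_derivative (\<Sum>i\<in>UNIV. \<Sum>j\<in>UNIV. g2 i j (\<gamma> t) * D $ i $ j)) (at t)"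
    by blast
  show ?case
  proof (intro exI[of _ "\<lambda>i j x. g1 i j x + g2 i j x"] conjI allI impI)
    fix i j show "(\<lambda>x. g1 i j x + g2 i j x) \<in> poly_funs mat_coords" using g by (simp add: poly_funs.add)
  next
    fix \<gamma> D t assume *: "mderiv \<gamma> (D :: complex^'n^'n) t"
    show "((\<lambda>s. f1 (\<gamma> s) + f2 (\<gamma> s)) has_field_derivative
        (\<Sum>i\<in>UNIV. \<Sum>j\<in>UNIV. (g1 i j (\<gamma> t) + g2 i j (\<gamma> t)) * D $ i $ j)) (at t)"
      using DERIV_add[OF g(2)[rule_format, OF *] g(4)[rule_format, OF *]]
      by (simp add: sum.distrib distrib_right)
  qed
next
  case (mult f1 f2)
  then obtain g1 g2 where g: "\<forall>i j. g1 i j \<in> poly_funs mat_coords" "\<forall>\<gamma> D t. mderiv \<gamma> D t \<longrightarrow>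
      ((\<lambda>s. f1 (\<gamma> s)) has_field_derivative (\<Sum>i\<in>UNIV. \<Sum>j\<in>UNIV. g1 i j (\<gamma> t) * D $ i $ j)) (at t)"
    "\<forall>i j. g2 i j \<in> poly_funs mat_coords" "\<forall>\<gamma> D t. mderiv \<gamma> D t \<longrightarrow>
      ((\<lambda>s. f2 (\<gamma> s)) has_field_derivative (\<Sum>i\<in>UNIV. \<Sum>j\<in>UNIV. g2 i j (\<gamma> t) * D $ i $ j)) (at t)"
    by blast
  show ?case
  proof (intro exI[of _ "\<lambda>i j x. g1 i j x * f2 x + g2 i j x * f1 x"] conjI allI impI)
    fix i j show "(\<lambda>x. g1 i j x * f2 x + g2 i j x * f1 x) \<in> poly_funs mat_coords"
      using g mult by (simp add: poly_funs.add poly_funs.mult)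
  next
    fix \<gamma> D t assume *: "mderiv \<gamma> (D :: complex^'n^'n) t"
    show "((\<lambda>s. f1 (\<gamma> s) * f2 (\<gamma> s)) has_field_derivative
        (\<Sum>i\<in>UNIV. \<Sum>j\<in>UNIV. (g1 i j (\<gamma> t) * f2 (\<gamma> t) + g2 i j (\<gamma> t) * f1 (\<gamma> t)) * D $ i $ j)) (at t)"
      using DERIV_mult[OF g(2)[rule_format, OF *] g(4)[rule_format, OF *]]
      by (simp add: sum.distrib distrib_right distrib_left sum_distrib_left sum_distrib_right mult_ac)
  qed
qed

definition dir_deriv :: "(complex^'n^'n \<Rightarrow> complex) \<Rightarrow> complex^'n^'n \<Rightarrow> complex^'n^'n \<Rightarrow> complex"
  where "dir_deriv f a v = deriv (\<lambda>t. f (a + cscale t v)) 0"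

lemma mderiv_line: "mderiv (\<lambda>t. a + cscale t v) v t"
  unfolding mderiv_def by (auto intro!: derivative_eq_intros)

lemma dir_deriv_gradient:
  assumes "f \<in> poly_funs mat_coords"
  obtains g where "\<And>i j. g i j \<in> poly_funs mat_coords"
    "\<And>a v. dir_deriv f a v = (\<Sum>i\<in>UNIV. \<Sum>j\<in>UNIV. g i j a * v $ i $ j)"
    "\<And>\<gamma> D t. mderiv \<gamma> D t \<Longrightarrow> ((\<lambda>s. f (\<gamma> s)) has_field_derivative dir_deriv f (\<gamma> t) D) (at t)"
proof -
  obtain g where g: "\<And>i j. g i j \<in> poly_funs mat_coords" "\<And>\<gamma> D t. mderiv \<gamma> D t \<Longrightarrow>
      ((\<lambda>s. f (\<gamma> s)) has_field_derivative (\<Sum>i\<in>UNIV. \<Sum>j\<in>UNIV. g i j (\<gamma> t) * D $ i $ j)) (at t)"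
    using poly_gradient[OF assms] by blast
  have dir_deriv: "dir_deriv f a v = (\<Sum>i\<in>UNIV. \<Sum>j\<in>UNIV. g i j a * v $ i $ j)" for a v
    using g(2)[OF mderiv_line[of a v 0]] by (simp add: dir_deriv_def DERIV_imp_deriv)
  show thesis by (rule that[of g]) (use g dir_deriv in auto)
qed

lemma dir_deriv_chain:
  assumes "f \<in> poly_funs mat_coords" "mderiv \<gamma> D t"
  shows "((\<lambda>s. f (\<gamma> s)) has_field_derivative dir_deriv f (\<gamma> t) D) (at t)"
  using dir_deriv_gradient[OF assms(1)] assms(2) by metis

lemma dir_deriv_add: "f \<in> poly_funs mat_coords \<Longrightarrow> dir_deriv f a (v + w) = dir_deriv f a v + dir_deriv f a w"
  by (erule dir_deriv_gradient) (simp add: distrib_left sum.distrib)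

lemma dir_deriv_cscale: "f \<in> poly_funs mat_coords \<Longrightarrow> dir_deriv f a (cscale c v) = c * dir_deriv f a v"
  by (erule dir_deriv_gradient) (simp add: sum_distrib_left mult_ac)

lemma dir_deriv_poly_map:
  assumes "f \<in> poly_funs mat_coords" "poly_map mat_coords \<phi>"
  shows "(\<lambda>a. dir_deriv f a (\<phi> a)) \<in> poly_funs mat_coords"
  using assms by (elim dir_deriv_gradient) (simp add: poly_map_def poly_funs_sum poly_funs.mult)

lemma dir_deriv_add_fun: "f \<in> poly_funs mat_coords \<Longrightarrow> g \<in> poly_funs mat_coords \<Longrightarrow>
    dir_deriv (\<lambda>x. f x + g x) a v = dir_deriv f a v + dir_deriv g a v"
  unfolding dir_deriv_def[of "\<lambda>x. f x + g x"] 
  using DERIV_add[OF dir_deriv_chain[OF _ mderiv_line[of a v 0], of f] dir_deriv_chain[OF _ mderiv_line[of a v 0], of g]]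
  by (simp add: DERIV_imp_deriv)

lemma dir_deriv_mult_fun: "f \<in> poly_funs mat_coords \<Longrightarrow> g \<in> poly_funs mat_coords \<Longrightarrow>
    dir_deriv (\<lambda>x. f x * g x) a v = dir_deriv f a v * g a + f a * dir_deriv g a v"
  unfolding dir_deriv_def[of "\<lambda>x. f x * g x"] 
  using DERIV_mult[OF dir_deriv_chain[OF _ mderiv_line[of a v 0], of f] dir_deriv_chain[OF _ mderiv_line[of a v 0], of g]]
  by (simp add: DERIV_imp_deriv mult_ac)

lemma dir_deriv_coord: "dir_deriv (\<lambda>x. x $ i $ j) a v = v $ i $ j"
  unfolding dir_deriv_def by (intro DERIV_imp_deriv) (auto intro!: derivative_eq_intros)

lemma dir_deriv_const: "dir_deriv (\<lambda>x. c) a v = 0"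
  unfolding dir_deriv_def by simp

section \<open>First-order jets as tangent vectors\<close>

lemma poly_sq_dvd_iff: "[:0, 1:]\<^sup>2 dvd p \<longleftrightarrow> poly p 0 = 0 \<and> poly (pderiv p) 0 = (0 :: complex)"
proof
  assume "[:0, 1:]\<^sup>2 dvd p"
  then obtain q where "p = [:0, 1:]\<^sup>2 * q" by (auto simp: dvd_def)
  then show "poly p 0 = 0 \<and> poly (pderiv p) 0 = 0"
    by (simp add: pderiv_mult power2_eq_square pderiv_pCons)
next
  assume *: "poly p 0 = 0 \<and> poly (pderiv p) 0 = 0"
  then have "[:0, 1:] dvd p" using poly_eq_0_iff_dvd[of p 0] by simp
  then obtain q where q: "p = [:0, 1:] * q" by (auto simp: dvd_def)
  with * have "poly q 0 = 0" by (simp add: pderiv_mult pderiv_pCons)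
  then have "[:0, 1:] dvd q" using poly_eq_0_iff_dvd[of q 0] by simp
  then show "[:0, 1:]\<^sup>2 dvd p" unfolding q by (simp only: power2_eq_square mult_dvd_mono dvd_refl)
qed

lemma jet_curve_1: "jet_curve 1 \<gamma> t = \<gamma> 0 + cscale t (\<gamma> 1)"
  by (simp add: jet_curve_def)

lemma poly_funs_line:
  fixes f :: "complex^'n^'n \<Rightarrow> complex"
  assumes "f \<in> poly_funs mat_coords"
  shows "\<exists>p. \<forall>t. f (a + cscale t v) = poly p t"
proof (rule poly_funs_compose_poly[OF assms, where \<phi> = "\<lambda>t. a + cscale t v"])
  fix c :: "complex^'n^'n \<Rightarrow> complex" assume "c \<in> mat_coords"
  then obtain i j where "c = (\<lambda>A. A $ i $ j)" by (auto simp: mat_coords_def)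
  then show "\<exists>p. \<forall>t. c (a + cscale t v) = poly p t"
    by (intro exI[of _ "[:a $ i $ j, v $ i $ j:]"]) simp
qed

text \<open>A complex polynomial is determined by its values, so the choice of \<open>p\<close> in
  the definition of \<open>jets\<close> does not matter; divisibility by \<open>t^2\<close> then
  reads off the value and the derivative of \<open>f\<close> along the line.\<close>

lemma jets_1:
  assumes "I \<subseteq> poly_funs mat_coords"
  shows "\<gamma> \<in> jets 1 I \<longleftrightarrow>
    (\<forall>k>1. \<gamma> k = 0) \<and> (\<forall>f\<in>I. f (\<gamma> 0) = 0 \<and> dir_deriv f (\<gamma> 0) (\<gamma> 1) = 0)"
proof -
  have "(\<exists>p. (\<forall>t. poly p t = f (jet_curve 1 \<gamma> t)) \<and> [:0, 1:] ^ (1 + 1) dvd p) \<longleftrightarrow>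
      f (\<gamma> 0) = 0 \<and> dir_deriv f (\<gamma> 0) (\<gamma> 1) = 0" if "f \<in> I" for f
  proof -
    have *: "poly p 0 = f (\<gamma> 0)" "poly (pderiv p) 0 = dir_deriv f (\<gamma> 0) (\<gamma> 1)"
      if "\<forall>t. poly p t = f (jet_curve 1 \<gamma> t)" for p
    proof -
      have p: "(\<lambda>t. f (\<gamma> 0 + cscale t (\<gamma> 1))) = poly p" using that unfolding jet_curve_1 by (auto simp: fun_eq_iff)
      show "poly p 0 = f (\<gamma> 0)" using fun_cong[OF p, of 0] by simp
      show "poly (pderiv p) 0 = dir_deriv f (\<gamma> 0) (\<gamma> 1)"
        unfolding dir_deriv_def p by (simp add: DERIV_imp_deriv[OF poly_DERIV])
    qed
    have "f \<in> poly_funs mat_coords" using assms that by blast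
    from poly_funs_line[OF this, of "\<gamma> 0" "\<gamma> 1"]
    obtain p where p: "\<forall>t. poly p t = f (jet_curve 1 \<gamma> t)"
      unfolding jet_curve_1 by force
    have "[:0, 1:] ^ (1 + 1) dvd q \<longleftrightarrow> f (\<gamma> 0) = 0 \<and> dir_deriv f (\<gamma> 0) (\<gamma> 1) = 0"
      if "\<forall>t. poly q t = f (jet_curve 1 \<gamma> t)" for q
      using *[OF that] poly_sq_dvd_iff[of q] unfolding one_add_one by simp
    note q = this
    show ?thesis
    proof
      assume "\<exists>p. (\<forall>t. poly p t = f (jet_curve 1 \<gamma> t)) \<and> [:0, 1:] ^ (1 + 1) dvd p"
      then obtain r where r: "\<forall>t. poly r t = f (jet_curve 1 \<gamma> t)" "[:0, 1:] ^ (1 + 1) dvd r"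
        by (elim exE conjE)
      show "f (\<gamma> 0) = 0 \<and> dir_deriv f (\<gamma> 0) (\<gamma> 1) = 0" using q[OF r(1)] r(2) by (rule iffD1)
    next
      assume "f (\<gamma> 0) = 0 \<and> dir_deriv f (\<gamma> 0) (\<gamma> 1) = 0"
      with q[OF p] have "[:0, 1:] ^ (1 + 1) dvd p" by (rule iffD2)
      with p show "\<exists>p. (\<forall>t. poly p t = f (jet_curve 1 \<gamma> t)) \<and> [:0, 1:] ^ (1 + 1) dvd p"
        by (intro exI[of _ p] conjI)
    qed
  qed
  then have "(\<forall>f\<in>I. \<exists>p. (\<forall>t. poly p t = f (jet_curve 1 \<gamma> t)) \<and> [:0, 1:] ^ (1 + 1) dvd p) \<longleftrightarrow>
      (\<forall>f\<in>I. f (\<gamma> 0) = 0 \<and> dir_deriv f (\<gamma> 0) (\<gamma> 1) = 0)"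
    by (rule ball_cong[OF refl])
  then show ?thesis unfolding jets_def mem_Collect_eq by (rule arg_cong2[of _ _ _ _ "(\<and>)", OF refl])
qed

section \<open>Engel's theorem\<close>

text \<open>The right ideal spanned by products of \<open>j\<close> elements of \<open>K\<close>
  followed by any matrix: the flag \<open>K^j V\<close> transferred to the space of matrices. A step
  equal to \<open>{0}\<close> says that all products of that many elements of \<open>K\<close>
  vanish.\<close>

primrec left_products :: "(complex^'n^'n) set \<Rightarrow> nat \<Rightarrow> (complex^'n^'n) set"
  where
    "left_products K 0 = UNIV"
  | "left_products K (Suc j) = cs.span {x ** w | x w. x \<in> K \<and> w \<in> left_products K j}"

lemma subspace_left_products: "cs.subspace (left_products K j)"
  by (cases j) (auto simp: cs.subspace_UNIV)

lemma left_products_mult: "x \<in> K \<Longrightarrow> w \<in> left_products K j \<Longrightarrow> x ** w \<in> left_products K (Suc j)"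
  by (auto intro: cs.span_base)

lemma left_products_Suc_subset: "left_products K (Suc j) \<subseteq> left_products K j"
proof (induction j)
  case (Suc j)
  have "{x ** w | x w. x \<in> K \<and> w \<in> left_products K (Suc j)} \<subseteq> left_products K (Suc j)"
    using Suc left_products_mult by blast
  then show ?case unfolding left_products.simps(2)[of K "Suc j"]
    by (rule cs.span_minimal[OF _ subspace_left_products])
qed simp

lemma left_products_antimono: "i \<le> j \<Longrightarrow> left_products K j \<subseteq> left_products K i"
  by (rule lift_Suc_antimono_le[of "left_products K"]) (rule left_products_Suc_subset)

text \<open>Moving \<open>y\<close> to the right past a factor from \<open>K\<close> keeps the
  number of such factors. The hypothesis covers both ways of normalizing \<open>K\<close>: by
  conjugation, \<open>y x = (Ad y x) y\<close>, and by bracket,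
  \<open>y x = x y + [y, x]\<close>.\<close>

lemma left_products_stable:
  assumes "\<And>x. x \<in> K \<Longrightarrow> \<exists>x'\<in>K. \<exists>x''\<in>K. y ** x = x' ** y + x''"
  shows "w \<in> left_products K j \<Longrightarrow> y ** w \<in> left_products K j"
proof (induction j arbitrary: w)
  case (Suc j)
  note sub = subspace_left_products[of K "Suc j"]
  show ?case using Suc.prems unfolding left_products.simps(2)[of K j]
  proof (induction rule: cs.span_induct)
    case base
    have "cs.subspace {w. y ** w \<in> left_products K (Suc j)}"
      using sub unfolding cs.subspace_def by (simp add: mat_distrib del: left_products.simps)
    then show ?case by simp
  next
    case (step v)
    then obtain x w where v: "v = x ** w" and x: "x \<in> K" and w: "w \<in> left_products K j" by auto
    obtain x' x'' where x': "x' \<in> K" "x'' \<in> K" "y ** x = x' ** y + x''" using assms[OF x] by auto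
    have "y ** v = x' ** (y ** w) + x'' ** w"
      unfolding v by (simp add: matrix_mul_assoc x'(3) mat_distrib)
    moreover have "x' ** (y ** w) \<in> left_products K (Suc j)" "x'' ** w \<in> left_products K (Suc j)"
      using x' w Suc.IH[OF w] left_products_mult by blast+
    ultimately have "y ** v \<in> left_products K (Suc j)" using cs.subspace_add[OF sub] by metis
    then show ?case by simp
  qed
qed simp

text \<open>\<open>y\<close> preserves every step of the filtration and \<open>x\<close> moves it
  one step down, so the powers of \<open>x ** y\<close> run down to zero.\<close>

lemma nilpotent_of_left_products:
  assumes "left_products K m = {0}" "x \<in> K"
    and "\<And>j w. w \<in> left_products K j \<Longrightarrow> y ** w \<in> left_products K j"
  shows "nilpotent_mat (x ** y)"
proof -
  have "mpow (x ** y) j \<in> left_products K j" for j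
  proof (induction j)
    case (Suc j)
    then show ?case using left_products_mult[OF assms(2) assms(3)]
      by (simp add: mpow_Suc matrix_mul_assoc[symmetric] del: left_products.simps)
  qed simp
  from this[of m] show ?thesis using assms(1) by (auto simp: nilpotent_mat_iff)
qed

lemma prod_in_left_products:
  "set us \<subseteq> M \<Longrightarrow> foldr (**) us (mat 1) \<in> left_products M (length us)"
  by (induction us) (auto simp del: left_products.simps(2) intro: left_products_mult)

text \<open>An iterated bracket of \<open>2 p\<close> elements of \<open>M\<close> with
  \<open>x0\<close> is a combination of terms \<open>u x0 v\<close> in which \<open>u\<close> and
  \<open>v\<close> share \<open>2 p\<close> factors from \<open>M\<close>; one of the two has at
  least \<open>p\<close> factors and vanishes. So one cannot keep bracketing with \<open>M\<close>
  and stay outside \<open>M\<close> forever, and the process stops at an \<open>x\<close> as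
  claimed.\<close>

lemma ad_nilpotent_escape:
  assumes M: "left_products M p = {0}" and K: "\<And>m x. m \<in> M \<Longrightarrow> x \<in> K \<Longrightarrow> lie_bracket m x \<in> K"
    and 0: "0 \<in> M" and x0: "x0 \<in> K" "x0 \<notin> M"
  shows "\<exists>x\<in>K - M. \<forall>m\<in>M. lie_bracket m x \<in> M"
proof (rule ccontr)
  assume contra: "\<not> ?thesis"
  let ?prod = "\<lambda>us. foldr (**) us (mat 1)"
  let ?W = "\<lambda>i. {?prod us ** x0 ** ?prod vs | us vs. set us \<subseteq> M \<and> set vs \<subseteq> M \<and> length us + length vs = i}"
  have snoc: "?prod (vs @ [m]) = ?prod vs ** m" for vs and m :: "complex^'n^'n"
    by (induction vs) (simp_all add: matrix_mul_assoc)
  have step: "lie_bracket m x \<in> cs.span (?W (Suc i))" if "x \<in> cs.span (?W i)" and m: "m \<in> M" for i m x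
    using that(1)
  proof (induction rule: cs.span_induct)
    case base
    show ?case by (simp add: cs.subspace_def lie_bracket_linear cs.span_zero cs.span_add cs.span_scale)
  next
    case (step v)
    then obtain us vs where v: "v = ?prod us ** x0 ** ?prod vs" "set us \<subseteq> M" "set vs \<subseteq> M" "length us + length vs = i"
      by blast
    have eq: "lie_bracket m v = ?prod (m # us) ** x0 ** ?prod vs - ?prod us ** x0 ** ?prod (vs @ [m])"
      unfolding snoc by (simp add: lie_bracket_def v(1) matrix_mul_assoc)
    have w1: "?prod (m # us) ** x0 ** ?prod vs \<in> ?W (Suc i)"
      using v m by (intro CollectI exI[of _ "m # us"] exI[of _ vs]) simp
    have w2: "?prod us ** x0 ** ?prod (vs @ [m]) \<in> ?W (Suc i)"
      using v m by (intro CollectI exI[of _ us] exI[of _ "vs @ [m]"]) simp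
    show ?case unfolding eq by (rule cs.span_diff[OF cs.span_base[OF w1] cs.span_base[OF w2]])
  qed
  have "\<exists>x\<in>K - M. x \<in> cs.span (?W i)" for i
  proof (induction i)
    case 0
    show ?case using x0 by (intro bexI[of _ x0] cs.span_base) auto
  next
    case (Suc i)
    then obtain x where x: "x \<in> K - M" "x \<in> cs.span (?W i)" by blast
    with contra obtain m where "m \<in> M" "lie_bracket m x \<notin> M" by blast
    with x K step[OF x(2)] show ?case by (intro bexI[of _ "lie_bracket m x"]) auto
  qed
  then obtain x where x: "x \<in> K - M" "x \<in> cs.span (?W (p + p))" by blast
  have zero: "?prod us = 0" if "set us \<subseteq> M" "p \<le> length us" for us
    using prod_in_left_products[OF that(1)] left_products_antimono[OF that(2), of M] M by auto
  have "?W (p + p) \<subseteq> {0}"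
  proof
    fix w assume "w \<in> ?W (p + p)"
    then obtain us vs where w: "w = ?prod us ** x0 ** ?prod vs" "set us \<subseteq> M" "set vs \<subseteq> M"
      "length us + length vs = p + p" by blast
    then have "p \<le> length us \<or> p \<le> length vs" by linarith
    then show "w \<in> {0}" using w zero by auto
  qed
  then have "cs.span (?W (p + p)) \<subseteq> {0}" by (rule cs.span_minimal) simp
  with x 0 show False by auto
qed

text \<open>Powers of \<open>x\<close> subdivide each step of the filtration of \<open>M\<close>
  into at most \<open>N\<close> smaller ones, so \<open>p * N\<close> factors of the enlarged space
  suffice.\<close>

lemma left_products_extend:
  assumes M: "left_products M p = {0}" and x: "nilpotent_mat x"
    and norm: "\<And>m. m \<in> M \<Longrightarrow> lie_bracket x m \<in> M"
  shows "\<exists>q. left_products {m + cscale c x | m c. m \<in> M} q = {0}"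
proof -
  define M' where "M' = {m + cscale c x | m c. m \<in> M}"
  obtain N where N: "mpow x N = 0" using x by (auto simp: nilpotent_mat_iff)
  have stable: "x ** w \<in> left_products M j" if "w \<in> left_products M j" for w j
  proof (rule left_products_stable[OF _ that])
    fix m assume "m \<in> M"
    moreover have "x ** m = m ** x + lie_bracket x m" by (simp add: lie_bracket_def)
    ultimately show "\<exists>x'\<in>M. \<exists>x''\<in>M. x ** m = x' ** x + x''" using norm by blast
  qed
  have stable_pow: "mpow x k ** w \<in> left_products M j" if "w \<in> left_products M j" for w j k
    using that stable by (induction k) (simp_all add: mpow_Suc matrix_mul_assoc[symmetric])
  \<comment> \<open>Modulo step \<open>i + 1\<close> only the power of \<open>x\<close> counts: a
    factor from \<open>M\<close> raises the step, while \<open>x\<close> preserves each step because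
    it normalizes \<open>M\<close>.\<close>
  define H where "H i j = {mpow x j ** w + w' | w w'. w \<in> left_products M i \<and> w' \<in> left_products M (Suc i)}" for i j
  have HI: "mpow x j ** w + w' \<in> H i j" if "w \<in> left_products M i" "w' \<in> left_products M (Suc i)" for w w' i j
    using that unfolding H_def by blast
  have HE: "\<exists>w\<in>left_products M i. \<exists>w'\<in>left_products M (Suc i). h = mpow x j ** w + w'" if "h \<in> H i j" for h i j
    using that unfolding H_def by blast
  have sub_H: "cs.subspace (H i j)" for i j
  proof (rule cs.subspaceI)
    show "0 \<in> H i j"
      using HI[OF cs.subspace_0[OF subspace_left_products] cs.subspace_0[OF subspace_left_products]] by simp
    fix a assume "a \<in> H i j"
    then obtain w w' where a: "a = mpow x j ** w + w'" "w \<in> left_products M i" "w' \<in> left_products M (Suc i)" using HE by metis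
    {
      fix b assume "b \<in> H i j"
      then obtain v v' where b: "b = mpow x j ** v + v'" "v \<in> left_products M i" "v' \<in> left_products M (Suc i)" using HE by metis
      have "a + b = mpow x j ** (w + v) + (w' + v')" by (simp add: a b mat_distrib)
      then show "a + b \<in> H i j"
        using HI[OF cs.subspace_add[OF subspace_left_products a(2) b(2)] cs.subspace_add[OF subspace_left_products a(3) b(3)]]
        by (simp only:)
    }
    fix c
    have "cscale c a = mpow x j ** cscale c w + cscale c w'" by (simp add: a mat_distrib)
    then show "cscale c a \<in> H i j"
      using HI[OF cs.subspace_scale[OF subspace_left_products a(2)] cs.subspace_scale[OF subspace_left_products a(3)]]
      by (simp only:)
  qed
  have step: "y ** h \<in> H i (Suc j)" if y': "y \<in> M'" and h': "h \<in> H i j" for y h i j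
  proof -
    obtain m c where y: "y = m + cscale c x" "m \<in> M" using y' unfolding M'_def by blast
    obtain w w' where h: "h = mpow x j ** w + w'" "w \<in> left_products M i" "w' \<in> left_products M (Suc i)"
      using HE[OF h'] by blast
    have "y ** h = mpow x (Suc j) ** cscale c w + (m ** (mpow x j ** w) + m ** w' + cscale c (x ** w'))"
      by (simp add: y h mat_distrib mpow_Suc matrix_mul_assoc)
    moreover have "m ** (mpow x j ** w) + m ** w' + cscale c (x ** w') \<in> left_products M (Suc i)"
    proof (intro cs.subspace_add cs.subspace_scale subspace_left_products)
      show "m ** (mpow x j ** w) \<in> left_products M (Suc i)"
        by (rule left_products_mult[OF y(2) stable_pow[OF h(2)]])
      show "m ** w' \<in> left_products M (Suc i)"
        by (rule subsetD[OF left_products_Suc_subset left_products_mult[OF y(2) h(3)]])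
      show "x ** w' \<in> left_products M (Suc i)" by (rule stable[OF h(3)])
    qed
    moreover have "cscale c w \<in> left_products M i" using h by (intro cs.subspace_scale subspace_left_products)
    ultimately show ?thesis using HI by metis
  qed
  have H: "left_products M' (a + j) \<subseteq> H i j" if "left_products M' a \<subseteq> left_products M i" for a i j
  proof (induction j)
    case 0
    show ?case
    proof
      fix w assume "w \<in> left_products M' (a + 0)"
      then have "w \<in> left_products M i" using that by auto
      from HI[OF this cs.subspace_0[OF subspace_left_products], of 0] show "w \<in> H i 0" by simp
    qed
  next
    case (Suc j)
    have "{x ** w | x w. x \<in> M' \<and> w \<in> left_products M' (a + j)} \<subseteq> H i (Suc j)"
    proof
      fix v assume "v \<in> {x ** w | x w. x \<in> M' \<and> w \<in> left_products M' (a + j)}"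
      then obtain y h where "v = y ** h" "y \<in> M'" "h \<in> left_products M' (a + j)" by blast
      with step subsetD[OF Suc] show "v \<in> H i (Suc j)" by metis
    qed
    then have "cs.span {x ** w | x w. x \<in> M' \<and> w \<in> left_products M' (a + j)} \<subseteq> H i (Suc j)"
      by (rule cs.span_minimal[OF _ sub_H])
    then show ?case by (simp only: add_Suc_right left_products.simps(2))
  qed
  have "left_products M' (i * N) \<subseteq> left_products M i" for i
  proof (induction i)
    case (Suc i)
    have "H i N \<subseteq> left_products M (Suc i)" by (auto simp: H_def N simp del: left_products.simps)
    with H[OF Suc, of N] show ?case unfolding mult_Suc add.commute[of N] by (rule subset_trans)
  qed simp
  from this[of p] have "left_products M' (p * N) \<subseteq> {0}" using M by simp
  then show ?thesis using cs.subspace_0[OF subspace_left_products] unfolding M'_def by blast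
qed

text \<open>A subalgebra of maximal dimension among those whose long products vanish is all of
  \<open>K\<close>; otherwise a nilpotent element normalizing it could be adjoined. The dimension is
  the real one, which need only grow strictly.\<close>

theorem engel:
  fixes K :: "(complex^'n^'n) set"
  assumes K: "cs.subspace K" and Lie: "\<And>x y. x \<in> K \<Longrightarrow> y \<in> K \<Longrightarrow> lie_bracket x y \<in> K"
    and nil: "\<And>x. x \<in> K \<Longrightarrow> nilpotent_mat x"
  shows "\<exists>m. left_products K m = {0}"
proof -
  define P where "P M \<longleftrightarrow> cs.subspace M \<and> M \<subseteq> K \<and> (\<forall>x\<in>M. \<forall>y\<in>M. lie_bracket x y \<in> M) \<and>
    (\<exists>m. left_products M m = {0})" for M
  have "left_products {0} 1 = {0}" by (auto simp: cs.span_empty)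
  then have "P {0}" unfolding P_def using cs.subspace_0[OF K]
    by (intro conjI exI[of _ 1] ballI) (simp_all add: lie_bracket_linear del: left_products.simps)
  moreover have "\<forall>M. P M \<longrightarrow> dim M < Suc (dim (UNIV :: (complex^'n^'n) set))"
    by (simp add: le_imp_less_Suc dim_subset del: dim_UNIV)
  ultimately have "\<exists>M. P M \<and> (\<forall>M'. P M' \<longrightarrow> dim M' \<le> dim M)" by (rule ex_has_greatest_nat)
  then obtain M where "P M" and max: "\<And>M'. P M' \<Longrightarrow> dim M' \<le> dim M" by (elim exE conjE) simp
  then obtain p where M: "cs.subspace M" "M \<subseteq> K" "\<And>x y. x \<in> M \<Longrightarrow> y \<in> M \<Longrightarrow> lie_bracket x y \<in> M"
    "left_products M p = {0}" by (auto simp: P_def)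
  have "M = K"
  proof (rule ccontr)
    assume "M \<noteq> K"
    then obtain x0 where "x0 \<in> K" "x0 \<notin> M" using M(2) by blast
    then obtain x where x: "x \<in> K" "x \<notin> M" "\<And>m. m \<in> M \<Longrightarrow> lie_bracket m x \<in> M"
      using ad_nilpotent_escape[OF M(4), of K x0] Lie M(2) cs.subspace_0[OF M(1)] by blast
    have x': "lie_bracket x m \<in> M" if "m \<in> M" for m
      using x(3)[OF that] cs.subspace_neg[OF M(1)] lie_bracket_skew by metis
    define M' where "M' = {m + cscale c x | m c. m \<in> M}"
    have M'I: "m + cscale c x \<in> M'" if "m \<in> M" for m c using that by (auto simp: M'_def)
    have M'E: "\<exists>m\<in>M. \<exists>c. a = m + cscale c x" if "a \<in> M'" for a using that by (auto simp: M'_def)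
    have sub: "cs.subspace M'"
    proof (rule cs.subspaceI)
      show "0 \<in> M'" using M'I[OF cs.subspace_0[OF M(1)], of 0] by simp
      fix a assume "a \<in> M'"
      then obtain m c where a: "a = m + cscale c x" "m \<in> M" using M'E by blast
      {
        fix b assume "b \<in> M'"
        then obtain m' c' where b: "b = m' + cscale c' x" "m' \<in> M" using M'E by blast
        have "a + b = (m + m') + cscale (c + c') x" by (simp add: a b cs.scale_left_distrib)
        then show "a + b \<in> M'" using M'I[OF cs.subspace_add[OF M(1) a(2) b(2)]] by simp
      }
      fix e
      have "cscale e a = cscale e m + cscale (e * c) x" by (simp add: a mat_distrib)
      then show "cscale e a \<in> M'" using M'I[OF cs.subspace_scale[OF M(1) a(2)]] by simp
    qed
    have subK: "M' \<subseteq> K"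
      using M(2) x(1) K by (auto simp: M'_def intro: cs.subspace_add cs.subspace_scale)
    have Lie': "lie_bracket a b \<in> M'" if ab: "a \<in> M'" "b \<in> M'" for a b
    proof -
      obtain m c m' c' where "a = m + cscale c x" "m \<in> M" "b = m' + cscale c' x" "m' \<in> M"
        using M'E[OF ab(1)] M'E[OF ab(2)] by blast
      moreover have "lie_bracket x x = 0" by (simp add: lie_bracket_def)
      \<comment> \<open>As \<open>[x, x] = 0\<close>, the bracket falls into \<open>M\<close>
        itself, hence the coefficient 0 of \<open>x\<close>.\<close>
      ultimately have "lie_bracket a b = (lie_bracket m m' + cscale c (lie_bracket x m') + cscale c' (lie_bracket m x)) + cscale 0 x"
        "lie_bracket m m' + cscale c (lie_bracket x m') + cscale c' (lie_bracket m x) \<in> M"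
        using M(1,3) x(3) x' by (auto simp: lie_bracket_linear intro!: cs.subspace_add cs.subspace_scale)
      then show ?thesis using M'I[of _ 0] by (metis cs.scale_zero_left add.right_neutral)
    qed
    have fin: "\<exists>q. left_products M' q = {0}"
      unfolding M'_def by (rule left_products_extend[OF M(4) nil[OF x(1)] x'])
    have "P M'" unfolding P_def
    proof (intro conjI ballI)
      show "lie_bracket a b \<in> M'" if "a \<in> M'" "b \<in> M'" for a b using that by (rule Lie')
    qed (rule sub subK fin)+
    then have le: "dim M' \<le> dim M" by (rule max)
    have "M \<subseteq> M'"
    proof
      fix m assume "m \<in> M" then show "m \<in> M'" using M'I[of m 0] by simp
    qed
    moreover have "x \<in> M'" using M'I[OF cs.subspace_0[OF M(1)], of 1] by simp
    ultimately have "M \<subset> M'" using x(2) by blast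
    moreover have "span M = M" "span M' = M'"
      using cs_subspace_real[OF M(1)] cs_subspace_real[OF sub] by (metis span_eq_iff)+
    ultimately have "span M \<subset> span M'" by metis
    then have "dim M < dim M'" by (rule dim_psubset)
    with le show False by (metis not_le)
  qed
  with M(4) show ?thesis by blast
qed

section \<open>Jordan normal form\<close>

lemma jordan_matrix_entries:
  fixes n_as :: "(nat \<times> complex) list"
  defines "J \<equiv> jordan_matrix n_as"
  assumes "i < sum_list (map fst n_as)" "j < sum_list (map fst n_as)" "i \<noteq> j"
  shows "J $$ (i, j) \<in> {0, 1}" "J $$ (i, j) \<noteq> 0 \<Longrightarrow> j = Suc i \<and> J $$ (i, i) = J $$ (j, j)"
proof -
  have "J $$ (i, j) \<in> {0, 1} \<and> (J $$ (i, j) \<noteq> 0 \<longrightarrow> j = Suc i \<and> J $$ (i, i) = J $$ (j, j))"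
    using assms(2-) unfolding J_def
  proof (induction n_as arbitrary: i j)
    case (Cons na n_as)
    obtain n a where na: "na = (n, a)" by (cases na)
    let ?m = "sum_list (map fst n_as)"
    have J: "jordan_matrix (na # n_as) $$ (k, l) =
        (if k < n then if l < n then jordan_block n a $$ (k, l) else 0
         else if l < n then 0 else jordan_matrix n_as $$ (k - n, l - n))"
      if "k < n + ?m" "l < n + ?m" for k l
      using that unfolding na jordan_matrix_Cons by (subst index_mat_four_block) auto
    have ij: "i < n + ?m" "j < n + ?m" using Cons.prems na by auto
    have Suc_eq: "j - n = Suc (i - n) \<longleftrightarrow> Suc i = j" if "\<not> i < n" "\<not> j < n"
      using that by arith
    show ?case
      using Cons.IH[of "i - n" "j - n"] Cons.prems(3) ij
      by (cases "Suc i = j") (auto simp: J Suc_eq)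
  qed simp
  then show "J $$ (i, j) \<in> {0, 1}" "J $$ (i, j) \<noteq> 0 \<Longrightarrow> j = Suc i \<and> J $$ (i, i) = J $$ (j, j)"
    by auto
qed

definition diagm :: "('n \<Rightarrow> complex) \<Rightarrow> complex^'n^'n"
  where "diagm d = (\<chi> i j. if i = j then d i else 0)"

lemma diagm_nth: "diagm d $ i $ j = (if i = j then d i else 0)"
  by (simp add: diagm_def)

text \<open>The index type carries no order; \<open>f\<close> records the position of an index, so
  that \<open>f j = Suc (f i)\<close> says "superdiagonal". The equation \<open>d i = d j\<close>
  makes \<open>N\<close> commute with \<open>diagm d\<close>.\<close>

lemma jordan_form:
  fixes A :: "complex^'n^'n"
  obtains Q Q' N :: "complex^'n^'n" and d :: "'n \<Rightarrow> complex" and f :: "'n \<Rightarrow> nat"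
  where "Q ** Q' = mat 1" "Q' ** Q = mat 1" "A = Q ** (diagm d + N) ** Q'"
    "inj f" "\<And>i. f i < CARD('n)" "\<And>i j. N $ i $ j \<in> {0, 1}"
    "\<And>i j. N $ i $ j \<noteq> 0 \<Longrightarrow> f j = Suc (f i) \<and> d i = d j"
proof -
  define n where "n = CARD('n)"
  obtain f :: "'n \<Rightarrow> nat" where f: "bij_betw f UNIV {0..<n}"
    using ex_bij_betw_finite_nat[of "UNIV :: 'n set"] by (auto simp: n_def)
  define g where "g = inv_into UNIV f"
  have fg: "g (f i) = i" for i using f by (simp add: g_def bij_betw_def)
  have f_less: "f i < n" for i using f by (auto simp: bij_betw_def)
  define toJ where "toJ = (\<lambda>A :: complex^'n^'n. Matrix.mat n n (\<lambda>(i, j). A $ g i $ g j))"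
  define ofJ where "ofJ = (\<lambda>M :: complex Matrix.mat. (\<chi> i j. M $$ (f i, f j)) :: complex^'n^'n)"
  have ofJ_to: "ofJ (toJ A) = A" for A
    by (simp add: ofJ_def toJ_def f_less fg vec_eq_iff)
  have ofJ_mult: "ofJ (M * M') = ofJ M ** ofJ M'" if "M \<in> carrier_mat n n" "M' \<in> carrier_mat n n" for M M'
  proof -
    have "(\<Sum>k = 0..<n. M $$ (f i, k) * M' $$ (k, f j)) = (\<Sum>k\<in>UNIV. M $$ (f i, f k) * M' $$ (f k, f j))" for i j
      by (rule sum.reindex_bij_betw[OF f, symmetric])
    then show ?thesis using that
      by (simp add: ofJ_def vec_eq_iff matrix_mul_nth f_less Matrix.scalar_prod_def)
  qed
  have ofJ_1: "ofJ (1\<^sub>m n) = mat 1"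
    using f by (auto simp: ofJ_def vec_eq_iff mat_def f_less bij_betw_def inj_eq)
  have carrier: "toJ A \<in> carrier_mat n n" by (simp add: toJ_def)
  from char_poly_factorized[OF carrier] obtain as where "char_poly (toJ A) = (\<Prod>a\<leftarrow>as. [:- a, 1:])" by auto
  from jordan_nf_exists[OF carrier this] obtain n_as where "jordan_nf (toJ A) n_as" by auto
  then have "similar_mat (toJ A) (jordan_matrix n_as)" by (simp add: jordan_nf_def)
  then obtain P P' where wit: "similar_mat_wit (toJ A) (jordan_matrix n_as) P P'"
    unfolding similar_mat_def by auto
  note wit = similar_mat_witD2[OF carrier wit]
  have n_as: "sum_list (map fst n_as) = n" using wit(5) by auto
  define J where "J = ofJ (jordan_matrix n_as)"
  define d where "d = (\<lambda>i. J $ i $ i)"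
  define N where "N = J - diagm d"
  have N: "N $ i $ j = (if i = j then 0 else J $ i $ j)" for i j
    by (simp add: N_def diagm_nth d_def)
  show thesis
  proof (rule that[of "ofJ P" "ofJ P'" d N f])
    show "ofJ P ** ofJ P' = mat 1" "ofJ P' ** ofJ P = mat 1"
      using wit by (simp_all add: ofJ_mult[symmetric] ofJ_1)
    have "A = ofJ (P * jordan_matrix n_as * P')" using wit(3) ofJ_to[of A] by simp
    also have "\<dots> = ofJ P ** J ** ofJ P'" using wit by (simp add: ofJ_mult J_def matrix_mul_assoc)
    finally show "A = ofJ P ** (diagm d + N) ** ofJ P'" by (simp add: N_def)
    show "inj f" using f by (simp add: bij_betw_def)
    show "f i < CARD('n)" for i using f_less by (simp add: n_def)
    have "f i \<noteq> f j" if "i \<noteq> j" for i j using that fg by metis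
    note J = jordan_matrix_entries[of "f i" n_as "f j" for i j, unfolded n_as, OF f_less f_less this]
    show "N $ i $ j \<in> {0, 1}" for i j
      using J(1)[of i j] by (auto simp: N J_def ofJ_def)
    show "f j = Suc (f i) \<and> d i = d j" if "N $ i $ j \<noteq> 0" for i j
      using J(2)[of i j] that by (auto simp: N J_def ofJ_def d_def split: if_splits)
  qed
qed

section \<open>Traces, nilpotency and the exponential curve\<close>

lemma diagm_mult: "diagm d ** A = (\<chi> i j. d i * A $ i $ j)" "A ** diagm d = (\<chi> i j. A $ i $ j * d j)"
  by (simp_all add: vec_eq_iff matrix_mul_nth diagm_nth mult_delta_left mult_delta_right)

lemma conj_mult:
  fixes Q Q' A B :: "complex^'n^'n"
  assumes "Q' ** Q = mat 1"
  shows "(Q ** A ** Q') ** (Q ** B ** Q') = Q ** (A ** B) ** Q'"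
proof -
  have "(Q ** A ** Q') ** (Q ** B ** Q') = Q ** A ** (Q' ** Q) ** B ** Q'"
    by (simp add: matrix_mul_assoc)
  then show ?thesis by (simp add: assms matrix_mul_assoc)
qed

lemma trace_conj:
  fixes Q Q' A :: "complex^'n^'n"
  assumes "Q' ** Q = mat 1"
  shows "trace (Q ** A ** Q') = trace A"
  using trace_cyclic[of Q' Q A] trace_cyclic[of Q A Q'] assms trace_mul_sym[of "Q ** A" Q']
  by (simp add: matrix_mul_assoc)

lemma mpow_superdiagonal:
  assumes "\<And>i j. N $ i $ j \<noteq> 0 \<Longrightarrow> f j = Suc (f i)"
  shows "mpow N k $ i $ j \<noteq> 0 \<Longrightarrow> f j = f i + (k :: nat)"
proof (induction k arbitrary: i)
  case 0
  then show ?case by (simp add: mat_def split: if_splits)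
next
  case (Suc k)
  then have "\<exists>l. N $ i $ l * mpow N k $ l $ j \<noteq> 0"
    unfolding mpow_Suc matrix_mul_nth by (meson sum.neutral)
  then obtain l where "N $ i $ l \<noteq> 0" "mpow N k $ l $ j \<noteq> 0" by auto
  then show ?case using assms Suc.IH by simp
qed

lemma mpow_superdiagonal_zero:
  assumes "\<And>i j. N $ i $ j \<noteq> 0 \<Longrightarrow> f j = Suc (f i)" "\<And>i. f i < n" "n \<le> k"
  shows "mpow N k = (0 :: complex^'n^'n)"
proof -
  have "mpow N k $ i $ j = 0" for i j
  proof (rule ccontr)
    assume nz: "mpow N k $ i $ j \<noteq> 0"
    have "f j = f i + k" by (rule mpow_superdiagonal[of N f, OF _ nz]) (rule assms(1))
    then show False using assms(2)[of j] assms(3) by simp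
  qed
  then show ?thesis by (simp add: vec_eq_iff)
qed

lemma mpow_triangular:
  fixes f :: "'n::finite \<Rightarrow> nat"
  assumes N: "\<And>i j. N $ i $ j \<noteq> 0 \<Longrightarrow> f j = Suc (f i)" and f: "inj f"
  shows "(mpow (diagm d + N) k $ i $ j \<noteq> 0 \<longrightarrow> f i \<le> f j) \<and> mpow (diagm d + N) k $ i $ i = d i ^ k"
proof (induction k arbitrary: i j)
  case 0
  then show ?case by (simp add: mat_def)
next
  case (Suc k)
  let ?J = "diagm d + N"
  have J: "f i \<le> f j" if "?J $ i $ j \<noteq> 0" for i j
    using that N[of i j] by (cases "i = j") (auto simp: diagm_nth)
  have "N $ i $ i = 0" using N[of i i] by auto
  then have Jii: "?J $ i $ i = d i" by (simp add: diagm_nth)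
  have 1: "f i \<le> f j" if "mpow ?J (Suc k) $ i $ j \<noteq> 0"
  proof -
    have "\<exists>l. ?J $ i $ l * mpow ?J k $ l $ j \<noteq> 0"
      using that unfolding mpow_Suc matrix_mul_nth by (meson sum.neutral)
    then obtain l where "?J $ i $ l \<noteq> 0" "mpow ?J k $ l $ j \<noteq> 0" by auto
    then show ?thesis using J Suc.IH by (meson order_trans)
  qed
  have "?J $ i $ l * mpow ?J k $ l $ i = 0" if "l \<noteq> i" for l
  proof (rule ccontr)
    assume "?J $ i $ l * mpow ?J k $ l $ i \<noteq> 0"
    then have "f i \<le> f l" "f l \<le> f i" using J Suc.IH by auto
    then show False using that f by (simp add: inj_eq)
  qed
  then have "mpow ?J (Suc k) $ i $ i = (\<Sum>l\<in>{i}. ?J $ i $ l * mpow ?J k $ l $ i)"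
    unfolding mpow_Suc matrix_mul_nth by (intro sum.mono_neutral_right) auto
  then have "mpow ?J (Suc k) $ i $ i = d i ^ Suc k" using Jii Suc.IH by simp
  with 1 show ?case by simp
qed

text \<open>Take \<open>p\<close> vanishing at every value of \<open>d\<close> except
  \<open>d i\<close>. Then \<open>x p(x)\<close> is a combination of positive powers, so its sum
  over all \<open>d j\<close> vanishes; but that sum is the multiplicity of \<open>d i\<close> times
  \<open>d i * poly p (d i)\<close>.\<close>

lemma power_sums_zero:
  fixes d :: "'n::finite \<Rightarrow> complex"
  assumes "\<And>k. k > 0 \<Longrightarrow> (\<Sum>i\<in>UNIV. d i ^ k) = 0"
  shows "d i = 0"
proof (rule ccontr)
  assume nz: "d i \<noteq> 0"
  define p where "p = (\<Prod>z\<in>range d - {d i}. [:- z, 1:])"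
  have "(\<Sum>j\<in>UNIV. d j * poly p (d j)) = (\<Sum>j\<in>UNIV. \<Sum>k\<le>degree p. coeff p k * d j ^ Suc k)"
    by (simp add: poly_altdef sum_distrib_left mult_ac)
  also have "\<dots> = (\<Sum>k\<le>degree p. coeff p k * (\<Sum>j\<in>UNIV. d j ^ Suc k))"
    by (subst sum.swap) (simp only: sum_distrib_left)
  also have "\<dots> = 0" by (intro sum.neutral ballI) (simp only: assms zero_less_Suc mult_zero_right)
  finally have z1: "(\<Sum>j\<in>UNIV. d j * poly p (d j)) = 0" .
  have z2: "d j * poly p (d j) = (if d j = d i then d i * poly p (d i) else 0)" for j
  proof (cases "d j = d i")
    case False
    then have "(\<Prod>z\<in>range d - {d i}. poly [:- z, 1:] (d j)) = 0"
      by (intro prod_zero bexI[of _ "d j"]) auto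
    with False show ?thesis by (simp add: p_def poly_prod)
  qed simp
  have "(\<Sum>j\<in>UNIV. if d j = d i then d i * poly p (d i) else 0) = 0"
    by (rule trans[OF sum.cong[OF refl z2[symmetric]] z1])
  then have "of_nat (card {j. d j = d i}) * (d i * poly p (d i)) = 0"
    by (simp add: sum.If_cases)
  moreover have "card {j. d j = d i} > 0" by (subst card_gt_0_iff) auto
  moreover have "poly p (d i) \<noteq> 0" unfolding p_def poly_prod by (subst prod_zero_iff) auto
  ultimately show False using nz by simp
qed

text \<open>The traces of the powers are the power sums of the eigenvalues.\<close>

lemma nilpotent_if_traces_zero:
  fixes A :: "complex^'n^'n"
  assumes "\<And>k. k > 0 \<Longrightarrow> trace (mpow A k) = 0"
  shows "nilpotent_mat A"
proof -
  obtain Q Q' N d and f :: "'n \<Rightarrow> nat" where Q: "Q ** Q' = mat 1" "Q' ** Q = mat 1"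
    and A: "A = Q ** (diagm d + N) ** Q'" and f: "inj f" "\<And>i. f i < CARD('n)"
    and N: "\<And>i j. N $ i $ j \<noteq> 0 \<Longrightarrow> f j = Suc (f i) \<and> d i = d j"
    using jordan_form[of A] by metis
  have super: "f j = Suc (f i)" if "N $ i $ j \<noteq> 0" for i j using N[OF that] by simp
  have tri: "mpow (diagm d + N) k $ i $ i = d i ^ k" for i k
    using mpow_triangular[of N f d k i i, OF super f(1)] by simp
  have "trace (mpow A k) = (\<Sum>i\<in>UNIV. d i ^ k)" for k
    unfolding A mpow_conj[OF Q(2,1), symmetric] trace_conj[OF Q(2)] by (simp only: trace_def tri)
  then have "d i = 0" for i using power_sums_zero[of d i] assms by simp
  then have "diagm d = 0" by (simp add: vec_eq_iff diagm_nth)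
  moreover have "mpow N CARD('n) = 0"
    by (rule mpow_superdiagonal_zero[of N f "CARD('n)", OF super f(2) order_refl])
  ultimately show ?thesis unfolding A using Q
    by (intro nilpotent_conj) (auto simp: nilpotent_mat_iff)
qed

lemma trace_nilpotent:
  fixes A :: "complex^'n^'n"
  assumes "nilpotent_mat A"
  shows "trace A = 0"
proof -
  obtain Q Q' N d and f :: "'n \<Rightarrow> nat" where Q: "Q ** Q' = mat 1" "Q' ** Q = mat 1"
    and A: "A = Q ** (diagm d + N) ** Q'" and f: "inj f"
    and N: "\<And>i j. N $ i $ j \<noteq> 0 \<Longrightarrow> f j = Suc (f i) \<and> d i = d j"
    using jordan_form[of A] by metis
  obtain k where "mpow A k = 0" using assms by (auto simp: nilpotent_mat_iff)
  moreover have "mpow (diagm d + N) k = mpow (Q' ** A ** Q) k"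
    by (simp add: A matrix_mul_assoc Q) (simp add: matrix_mul_assoc[symmetric] Q)
  ultimately have "mpow (diagm d + N) k = 0"
    by (simp add: mpow_conj[OF Q(1,2), symmetric])
  moreover have super: "f j = Suc (f i)" if "N $ i $ j \<noteq> 0" for i j using N[OF that] by simp
  have tri: "mpow (diagm d + N) k $ i $ i = d i ^ k" for i k
    using mpow_triangular[of N f d k i i, OF super f] by simp
  ultimately have "d i = 0" for i using tri[of k i] by (cases k) (auto simp: mat_def)
  moreover have "(diagm d + N) $ i $ i = d i" for i using tri[of 1 i] by simp
  ultimately show ?thesis unfolding A trace_conj[OF Q(2)] by (simp add: trace_def)
qed

section \<open>The exponential of a matrix as an exponential polynomial\<close>

definition exp_poly_curve :: "complex set \<Rightarrow> nat \<Rightarrow> (complex \<Rightarrow> nat \<Rightarrow> complex^'n^'n) \<Rightarrow> complex \<Rightarrow> complex^'n^'n"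
  where "exp_poly_curve L K M t = (\<Sum>l\<in>L. \<Sum>k<K. cscale (t ^ k * exp (l * t)) (M l k))"

lemma exp_poly_curve_nth:
  "exp_poly_curve L K M t $ i $ j = (\<Sum>l\<in>L. \<Sum>k<K. M l k $ i $ j * t ^ k * exp (l * t))"
  by (simp add: exp_poly_curve_def mult_ac)

text \<open>The curve is \<open>exp (t X)\<close>. Here \<open>M l k\<close> is the projection onto
  the generalized eigenspace of \<open>l\<close>, times the \<open>k\<close>-th power of the
  nilpotent part of \<open>X\<close>, divided by \<open>k!\<close>. So the sum of
  \<open>cscale (cnj l) (M l 0)\<close> is the semisimple part with conjugated eigenvalues, and its
  product with \<open>X\<close> has trace equal to the sum of the squared moduli of the
  eigenvalues.\<close>

lemma exp_curve_exists:
  fixes X :: "complex^'n^'n"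
  obtains L K M where "finite L" "exp_poly_curve L K M 0 = mat 1"
    "\<And>t. mderiv (exp_poly_curve L K M) (X ** exp_poly_curve L K M t) t"
    "\<And>t. exp_poly_curve L K M t ** X = X ** exp_poly_curve L K M t"
    "K > 0"
    "(\<Sum>l\<in>L. cscale (cnj l) (M l 0)) ** X = X ** (\<Sum>l\<in>L. cscale (cnj l) (M l 0))"
    "trace (X ** (\<Sum>l\<in>L. cscale (cnj l) (M l 0))) = 0 \<Longrightarrow> nilpotent_mat X"
proof -
  obtain Q Q' N d and f :: "'n \<Rightarrow> nat" where Q: "Q ** Q' = mat 1" "Q' ** Q = mat 1"
    and X: "X = Q ** (diagm d + N) ** Q'" and f: "inj f" "\<And>i. f i < CARD('n)"
    and N: "\<And>i j. N $ i $ j \<noteq> 0 \<Longrightarrow> f j = Suc (f i) \<and> d i = d j"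
    using jordan_form[of X] by metis
  define E where "E l = (diagm (\<lambda>i. if d i = l then 1 else 0) :: complex^'n^'n)" for l
  define L where "L = range d"
  define K where "K = CARD('n)"
  define M where "M l k = cscale (1 / fact k) (Q ** (E l ** mpow N k) ** Q')" for l k
  have N_zero: "mpow N k = 0" if "k \<ge> K" for k
  proof (rule mpow_superdiagonal_zero[of N f K])
    show "f j = Suc (f i)" if "N $ i $ j \<noteq> 0" for i j using N[OF that] by simp
  qed (use f that in \<open>auto simp: K_def\<close>)
  have EN: "E l ** N = N ** E l" for l
    using N by (force simp: E_def diagm_mult vec_eq_iff)
  have DN: "diagm d ** N = N ** diagm d"
    using N by (force simp: diagm_mult vec_eq_iff)
  have DE: "diagm d ** E l = cscale l (E l)" "E l ** diagm d = cscale l (E l)" for l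
    by (auto simp: E_def diagm_mult vec_eq_iff diagm_nth)
  have DNk: "mpow N k ** diagm d = diagm d ** mpow N k" for k
    by (rule mpow_commute) (simp add: DN)
  have XM: "X ** M l k = cscale l (M l k) + cscale (of_nat (Suc k)) (M l (Suc k))"
    and MX: "M l k ** X = cscale l (M l k) + cscale (of_nat (Suc k)) (M l (Suc k))" for l k
  proof -
    have "(diagm d + N) ** (E l ** mpow N k) = diagm d ** E l ** mpow N k + N ** E l ** mpow N k"
      by (simp add: mat_distrib matrix_mul_assoc)
    also have "N ** E l ** mpow N k = E l ** mpow N (Suc k)"
      by (simp add: EN[symmetric] mpow_Suc matrix_mul_assoc)
    finally have 1: "(diagm d + N) ** (E l ** mpow N k) = cscale l (E l ** mpow N k) + E l ** mpow N (Suc k)"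
      by (simp add: DE)
    have "(E l ** mpow N k) ** (diagm d + N) = E l ** (mpow N k ** diagm d) + E l ** mpow N (Suc k)"
      by (simp add: mat_distrib matrix_mul_assoc mpow_Suc2)
    also have "E l ** (mpow N k ** diagm d) = E l ** diagm d ** mpow N k"
      by (simp add: DNk matrix_mul_assoc)
    finally have 2: "(E l ** mpow N k) ** (diagm d + N) = cscale l (E l ** mpow N k) + E l ** mpow N (Suc k)"
      by (simp add: DE)
    have fact: "of_nat (Suc k) * (1 / fact (Suc k)) = (1 / fact k :: complex)"
      unfolding fact_Suc using of_nat_neq_0[of k, where 'a = complex]
      by (simp add: divide_simps del: of_nat_Suc)
    have rhs: "cscale l (M l k) + cscale (of_nat (Suc k)) (M l (Suc k)) =
        cscale (1 / fact k) (Q ** (cscale l (E l ** mpow N k) + E l ** mpow N (Suc k)) ** Q')"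
      unfolding M_def cs.scale_scale fact by (simp add: mat_distrib mult.commute)
    show "X ** M l k = cscale l (M l k) + cscale (of_nat (Suc k)) (M l (Suc k))"
      unfolding rhs 1[symmetric] by (simp add: M_def X conj_mult[OF Q(2)])
    show "M l k ** X = cscale l (M l k) + cscale (of_nat (Suc k)) (M l (Suc k))"
      unfolding rhs 2[symmetric] by (simp add: M_def X conj_mult[OF Q(2)])
  qed
  have sum_E: "(\<Sum>l\<in>L. cscale (h l) (E l)) = diagm (\<lambda>i. h (d i))" for h :: "complex \<Rightarrow> complex"
  proof -
    have "(\<Sum>l\<in>L. h l * (if i = j then if d i = l then 1 else 0 else 0)) = (if i = j then h (d i) else 0)" for i j :: 'n
      by (simp add: L_def mult_delta_right)
    then show ?thesis by (simp add: vec_eq_iff E_def diagm_nth)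
  qed
  have sum_M: "(\<Sum>l\<in>L. cscale (h l) (M l 0)) = Q ** diagm (\<lambda>i. h (d i)) ** Q'" for h
    unfolding sum_E[symmetric] by (simp add: M_def matrix_sum_distrib)
  let ?c = "exp_poly_curve L K M"
  have K: "K > 0" by (simp add: K_def)
  have "?c 0 = (\<Sum>l\<in>L. \<Sum>k<K. if k = 0 then M l 0 else 0)"
    unfolding exp_poly_curve_def by (intro sum.cong refl) (auto simp: power_0_left)
  also have "\<dots> = (\<Sum>l\<in>L. cscale 1 (M l 0))" using K by simp
  also have "\<dots> = mat 1"
  proof -
    have "diagm (\<lambda>i :: 'n. 1) = mat 1"
      by (simp add: diagm_def mat_def)
    then show ?thesis unfolding sum_M by (simp add: Q)
  qed
  finally have c0: "?c 0 = mat 1" .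
  have deriv: "mderiv ?c (X ** ?c t) t" for t
    unfolding mderiv_def
  proof (intro allI)
    fix i j
    let ?m = "\<lambda>l k. M l k $ i $ j"
    have "(X ** ?c t) $ i $ j =
        (\<Sum>l\<in>L. \<Sum>k<K. t ^ k * exp (l * t) * (l * ?m l k + of_nat (Suc k) * ?m l (Suc k)))"
      unfolding exp_poly_curve_def matrix_sum_distrib cscale_mult_right XM by simp
    also have "\<dots> = (\<Sum>l\<in>L. \<Sum>k<K. (of_nat k * t ^ (k - 1) + l * t ^ k) * exp (l * t) * ?m l k)"
    proof (rule sum.cong[OF refl])
      fix l
      \<comment> \<open>The extra term \<open>k = K\<close> vanishes because \<open>N^K = 0\<close>;
        it makes room for the index shift.\<close>
      have "(\<Sum>k<K. of_nat k * t ^ (k - 1) * exp (l * t) * ?m l k) =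
          (\<Sum>k<Suc K. of_nat k * t ^ (k - 1) * exp (l * t) * ?m l k)"
        using N_zero[of K] by (simp add: M_def)
      also have "\<dots> = (\<Sum>k<K. of_nat (Suc k) * t ^ k * exp (l * t) * ?m l (Suc k))"
        by (subst sum.lessThan_Suc_shift) simp
      finally show "(\<Sum>k<K. t ^ k * exp (l * t) * (l * ?m l k + of_nat (Suc k) * ?m l (Suc k))) =
          (\<Sum>k<K. (of_nat k * t ^ (k - 1) + l * t ^ k) * exp (l * t) * ?m l k)"
        by (simp add: algebra_simps sum.distrib)
    qed
    finally have eq: "(X ** ?c t) $ i $ j =
      (\<Sum>l\<in>L. \<Sum>k<K. (of_nat k * t ^ (k - 1) + l * t ^ k) * exp (l * t) * ?m l k)" .
    show "((\<lambda>s. ?c s $ i $ j) has_field_derivative (X ** ?c t) $ i $ j) (at t)"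
      unfolding eq exp_poly_curve_nth
      by (auto intro!: derivative_eq_intros sum.cong simp: algebra_simps)
  qed
  have comm: "?c t ** X = X ** ?c t" for t
    by (simp add: exp_poly_curve_def matrix_sum_distrib XM MX)
  let ?D = "\<Sum>l\<in>L. cscale (cnj l) (M l 0)"
  have comm_D: "?D ** X = X ** ?D" by (simp add: matrix_sum_distrib XM MX)
  have "nilpotent_mat X" if "trace (X ** ?D) = 0"
  proof -
    have "X ** ?D = Q ** ((diagm d + N) ** diagm (\<lambda>i. cnj (d i))) ** Q'"
      unfolding sum_M X conj_mult[OF Q(2)] ..
    then have "trace (X ** ?D) = trace ((diagm d + N) ** diagm (\<lambda>i. cnj (d i)))"
      by (simp add: trace_conj[OF Q(2)])
    also have "\<dots> = (\<Sum>i\<in>UNIV. d i * cnj (d i))"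
    proof -
      have "N $ i $ i = 0" for i using N[of i i] by auto
      then show ?thesis by (simp add: trace_def diagm_mult diagm_nth)
    qed
    also have "\<dots> = of_real (\<Sum>i\<in>UNIV. (cmod (d i))\<^sup>2)"
      by (simp add: complex_norm_square[symmetric])
    finally have "(\<Sum>i\<in>UNIV. (cmod (d i))\<^sup>2) = 0" using that by (metis of_real_eq_0_iff)
    then have "d i = 0" for i by (simp add: sum_nonneg_eq_0_iff)
    then have "diagm d = 0" by (simp add: vec_eq_iff diagm_nth)
    then show ?thesis unfolding X using Q N_zero[of K]
      by (intro nilpotent_conj) (auto simp: nilpotent_mat_iff)
  qed
  then show thesis using that[of L K M] c0 deriv comm comm_D K by (simp add: L_def)
qed

text \<open>\<open>T\<close> is the operator \<open>d/dt - m0\<close>, written on the coefficient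
  polynomials. At the exponent \<open>m0\<close> it is plain differentiation, so enough iterations
  erase that term; at any other exponent it multiplies the leading coefficient by
  \<open>m - m0\<close> and is injective.\<close>

lemma exp_polys_independent:
  fixes P :: "complex \<Rightarrow> complex poly"
  assumes "finite L" "\<And>t. (\<Sum>m\<in>L. poly (P m) t * exp (m * t)) = 0" "m \<in> L"
  shows "P m = 0"
  using assms
proof (induction L arbitrary: P m rule: finite_induct)
  case (insert m0 L)
  define T where "T P m = pderiv (P m) + smult (m - m0) (P m)" for P and m :: complex
  have T_sum: "(\<Sum>m\<in>insert m0 L. poly (T P m) t * exp (m * t)) = 0"
    if P: "\<And>t. (\<Sum>m\<in>insert m0 L. poly (P m) t * exp (m * t)) = 0" for P t
  proof -
    let ?S = "\<lambda>t. \<Sum>m\<in>insert m0 L. poly (P m) t * exp (m * t)"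
    have "(?S has_field_derivative (\<Sum>m\<in>insert m0 L. (poly (pderiv (P m)) t + m * poly (P m) t) * exp (m * t))) (at t)"
      by (auto intro!: derivative_eq_intros sum.cong simp: algebra_simps)
    moreover have "(?S has_field_derivative 0) (at t)" unfolding P by simp
    ultimately have "(\<Sum>m\<in>insert m0 L. (poly (pderiv (P m)) t + m * poly (P m) t) * exp (m * t)) = 0"
      by (rule DERIV_unique)
    moreover have "(\<Sum>m\<in>insert m0 L. poly (T P m) t * exp (m * t)) =
        (\<Sum>m\<in>insert m0 L. (poly (pderiv (P m)) t + m * poly (P m) t) * exp (m * t)) - m0 * ?S t"
      by (simp only: T_def poly_add poly_smult sum_distrib_left sum_subtractf[symmetric])
        (intro sum.cong refl, simp add: algebra_simps)
    ultimately show ?thesis unfolding P by simp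
  qed
  have T_inj: "P m = 0" if "T P m = 0" "m \<noteq> m0" for P m
  proof (rule ccontr)
    assume "P m \<noteq> 0"
    have "coeff (T P m) (degree (P m)) = (m - m0) * lead_coeff (P m)"
      by (simp add: T_def coeff_pderiv coeff_eq_0)
    with that \<open>P m \<noteq> 0\<close> show False by simp
  qed
  have T_pow: "(\<Sum>m\<in>insert m0 L. poly ((T ^^ k) P m) t * exp (m * t)) = 0" for k t
    using insert.prems(1) T_sum by (induction k arbitrary: t) auto
  have "degree ((T ^^ k) P m0) \<le> degree (P m0) - k" for k
    by (induction k) (auto simp: T_def degree_pderiv)
  from this[of "degree (P m0)"] have "degree ((T ^^ degree (P m0)) P m0) = 0" by simp
  then have "(T ^^ Suc (degree (P m0))) P m0 = 0" by (simp add: T_def pderiv_eq_0_iff)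
  then have zero: "(T ^^ Suc (degree (P m0))) P m = 0" if "m \<in> L" for m
    using insert.IH[OF _ that, of "(T ^^ Suc (degree (P m0))) P"] T_pow[of "Suc (degree (P m0))"] insert.hyps
    by (simp del: funpow.simps)
  have T_pow_inj: "(T ^^ k) P m = 0 \<Longrightarrow> m \<noteq> m0 \<Longrightarrow> P m = 0" for k m
    by (induction k) (auto dest: T_inj)
  have L0: "P m = 0" if "m \<in> L" for m
    using T_pow_inj[OF zero[OF that]] that insert.hyps by blast
  then have "poly (P m0) t * exp (m0 * t) = 0" for t
    using insert.prems(1)[of t] insert.hyps by simp
  then have "poly (P m0) t = 0" for t by simp
  then have "P m0 = 0" using poly_all_0_iff_0 by blast
  with L0 insert.prems(2) show ?case by blast
qed simp

text \<open>
  \<open>exp_poly_rep \<phi> a b\<close>: in some presentation of \<open>\<phi>\<close> as a sum of terms \<open>c t^k exp (\<mu> t)\<close>, the terms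
  with \<open>k = 0\<close> contribute \<open>a = \<Sum> c\<close> and \<open>b = \<Sum> c cnj \<mu>\<close>.  By linear independence \<open>b\<close> depends on
  \<open>\<phi>\<close> only, and \<open>\<phi> \<mapsto> b\<close> is a derivation over evaluation at 0, since \<open>cnj\<close> is additive.
\<close>

inductive exp_poly_rep :: "(complex \<Rightarrow> complex) \<Rightarrow> complex \<Rightarrow> complex \<Rightarrow> bool" where
  zero: "exp_poly_rep (\<lambda>_. 0) 0 0"
| step: "exp_poly_rep \<phi> a b \<Longrightarrow> exp_poly_rep (\<lambda>t. \<phi> t + c * t ^ k * exp (m * t))
    (a + (if k = 0 then c else 0)) (b + (if k = 0 then c * cnj m else 0))"

lemma exp_poly_rep_add:
  assumes "exp_poly_rep \<psi> a' b'" "exp_poly_rep \<phi> a b"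
  shows "exp_poly_rep (\<lambda>t. \<phi> t + \<psi> t) (a + a') (b + b')"
  using assms(1)
proof induction
  case zero
  then show ?case using assms(2) by simp
next
  case (step \<psi> a' b' c k m)
  from exp_poly_rep.step[OF step.IH, of c k m] show ?case by (simp add: add.assoc)
qed

lemma exp_poly_rep_monomial:
  "exp_poly_rep (\<lambda>t. c * t ^ k * exp (m * t)) (if k = 0 then c else 0) (if k = 0 then c * cnj m else 0)"
  using exp_poly_rep.step[OF exp_poly_rep.zero, of c k m] by simp

lemma exp_poly_rep_const: "exp_poly_rep (\<lambda>_. c) c 0"
  using exp_poly_rep_monomial[of c 0 0] by simp

lemma exp_poly_rep_monomial_mult:
  assumes "exp_poly_rep \<psi> a b"
  shows "exp_poly_rep (\<lambda>t. c * t ^ k * exp (m * t) * \<psi> t)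
    (if k = 0 then c * a else 0) (if k = 0 then c * b + c * cnj m * a else 0)"
  using assms
proof induction
  case zero
  then show ?case using exp_poly_rep.zero by simp
next
  case (step \<psi> a b c' k' m')
  from exp_poly_rep_add[OF exp_poly_rep_monomial[of "c * c'" "k + k'" "m + m'"] step.IH]
  show ?case by (rule back_subst[of "\<lambda>(x, y, z). exp_poly_rep x y z" "(_, _, _)" "(_, _, _)", simplified])
    (auto simp: algebra_simps power_add exp_add)
qed

lemma exp_poly_rep_mult:
  assumes "exp_poly_rep \<phi> a b" "exp_poly_rep \<psi> a' b'"
  shows "exp_poly_rep (\<lambda>t. \<phi> t * \<psi> t) (a * a') (b * a' + a * b')"
  using assms(1)
proof induction
  case zero
  then show ?case using exp_poly_rep.zero by simp
next
  case (step \<phi> a b c k m)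
  from exp_poly_rep_add[OF exp_poly_rep_monomial_mult[OF assms(2), of c k m] step.IH]
  show ?case by (rule back_subst[of "\<lambda>(x, y, z). exp_poly_rep x y z" "(_, _, _)" "(_, _, _)", simplified])
    (auto simp: algebra_simps)
qed

lemma exp_poly_rep_sum:
  assumes "finite S" "\<And>x. x \<in> S \<Longrightarrow> exp_poly_rep (\<phi> x) (a x) (b x)"
  shows "exp_poly_rep (\<lambda>t. \<Sum>x\<in>S. \<phi> x t) (\<Sum>x\<in>S. a x) (\<Sum>x\<in>S. b x)"
  using assms by (induction S) (auto intro: exp_poly_rep.zero exp_poly_rep_add)

text \<open>Collecting terms by exponent gives polynomials \<open>P m\<close>; the terms with
  \<open>k = 0\<close> are their values at 0, so \<open>b\<close> is the sum of
  \<open>poly (P m) 0 * cnj m\<close>. Independence kills every \<open>P m\<close>.\<close>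

lemma exp_poly_rep_zero_unique:
  assumes "exp_poly_rep \<phi> a b" "\<And>t. \<phi> t = 0"
  shows "b = 0"
proof -
  have "\<exists>L P. finite L \<and> (\<forall>m. m \<notin> L \<longrightarrow> P m = 0) \<and> (\<forall>t. \<phi> t = (\<Sum>m\<in>L. poly (P m) t * exp (m * t))) \<and>
      b = (\<Sum>m\<in>L. poly (P m) 0 * cnj m)"
    using assms(1)
  proof induction
    case zero
    show ?case by (intro exI[of _ "{}"] exI[of _ "\<lambda>_. 0"]) simp
  next
    case (step \<phi> a b c k m)
    then obtain L P where L: "finite L" "\<forall>m. m \<notin> L \<longrightarrow> P m = 0"
      "\<forall>t. \<phi> t = (\<Sum>m\<in>L. poly (P m) t * exp (m * t))" "b = (\<Sum>m\<in>L. poly (P m) 0 * cnj m)" by blast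
    \<comment> \<open>As \<open>P\<close> vanishes off \<open>L\<close>, a term can be added at
      \<open>m\<close> whether or not \<open>m\<close> is already in \<open>L\<close>.\<close>
    let ?L = "insert m L" and ?P = "P(m := P m + monom c k)"
    have P: "?P x = P x + (if x = m then monom c k else 0)" for x by simp
    have ext: "(\<Sum>m\<in>?L. poly (P m) t * h m) = (\<Sum>m\<in>L. poly (P m) t * h m)" for t h
      using L(1,2) by (intro sum.mono_neutral_right) auto
    have sum: "(\<Sum>x\<in>?L. poly (?P x) t * h x) = (\<Sum>x\<in>L. poly (P x) t * h x) + c * t ^ k * h m" for t h
    proof -
      have "(\<Sum>x\<in>?L. poly (?P x) t * h x) =
          (\<Sum>x\<in>?L. poly (P x) t * h x) + (\<Sum>x\<in>?L. if x = m then c * t ^ k * h m else 0)"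
        unfolding sum.distrib[symmetric]
        by (intro sum.cong refl) (simp add: poly_monom algebra_simps)
      then show ?thesis using L(1) ext by simp
    qed
    show ?case
    proof (intro exI[of _ ?L] exI[of _ ?P] conjI allI impI)
      show "finite ?L" using L by simp
      show "?P x = 0" if "x \<notin> ?L" for x using L that by simp
      show "\<phi> t + c * t ^ k * exp (m * t) = (\<Sum>m\<in>?L. poly (?P m) t * exp (m * t))" for t
        unfolding sum using L by simp
      show "b + (if k = 0 then c * cnj m else 0) = (\<Sum>m\<in>?L. poly (?P m) 0 * cnj m)"
        unfolding sum using L by (simp add: power_0_left)
    qed
  qed
  then obtain L P where L: "finite L" "\<And>t. \<phi> t = (\<Sum>m\<in>L. poly (P m) t * exp (m * t))"
    "b = (\<Sum>m\<in>L. poly (P m) 0 * cnj m)" by blast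
  have "P m = 0" if "m \<in> L" for m
    using exp_polys_independent[OF L(1) _ that, of P] L(2) assms(2) by simp
  then show ?thesis using L(3) by simp
qed

section \<open>Algebraic groups and their Lie algebras\<close>

abbreviation vanishing :: "(complex^'n^'n) set \<Rightarrow> (complex^'n^'n \<Rightarrow> complex) set"
  where "vanishing \<equiv> vanishing_ideal mat_coords"

lemma vanishing_poly: "f \<in> vanishing S \<Longrightarrow> f \<in> poly_funs mat_coords"
  by (simp add: vanishing_ideal_def)

lemma vanishing_zero: "f \<in> vanishing S \<Longrightarrow> x \<in> S \<Longrightarrow> f x = 0"
  by (simp add: vanishing_ideal_def)

lemma vanishingI: "f \<in> poly_funs mat_coords \<Longrightarrow> (\<And>x. x \<in> S \<Longrightarrow> f x = 0) \<Longrightarrow> f \<in> vanishing S"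
  by (simp add: vanishing_ideal_def)

lemma poly_map_sandwich:
  fixes p q :: "complex^'n^'n"
  shows "poly_map mat_coords (\<lambda>x. p ** x ** q)"
  by (intro poly_map_mult poly_map_const poly_map_id)

lemma dir_deriv_sandwich:
  fixes p q :: "complex^'n^'n"
  assumes "f \<in> poly_funs mat_coords"
  shows "dir_deriv (\<lambda>x. f (p ** x ** q)) a v = dir_deriv f (p ** a ** q) (p ** v ** q)"
proof -
  have line: "p ** (a + cscale t v) ** q = p ** a ** q + cscale t (p ** v ** q)" for t
    by (simp add: mat_distrib)
  show ?thesis unfolding dir_deriv_def line ..
qed

lemma mderiv_trace:
  assumes "mderiv \<gamma> D t"
  shows "((\<lambda>s. trace (z ** \<gamma> s)) has_field_derivative trace (z ** D)) (at t)"
  using assms unfolding trace_mult_sum mderiv_def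
  by (auto intro!: derivative_eq_intros sum.cong simp: mult.commute)

lemma algebraic_group_invertible: "algebraic_group G \<Longrightarrow> g \<in> G \<Longrightarrow> invertible g"
  unfolding algebraic_group_def using closedin_subset by fastforce

lemma algebraic_group_closed:
  assumes "algebraic_group G" "invertible g" "\<And>f. f \<in> vanishing G \<Longrightarrow> f g = 0"
  shows "g \<in> G"
proof -
  obtain T where T: "closedin zariski_mat T" "G = T \<inter> {g. invertible g}"
    using assms(1) unfolding algebraic_group_def closedin_subtopology by blast
  have "g \<in> zariski_mat closure_of G" using assms(3) by (simp add: closure_of_zariski)
  moreover have "zariski_mat closure_of G \<subseteq> T" using T by (intro closure_of_minimal) auto
  ultimately show ?thesis using T assms(2) by auto
qed

lemma algebraic_group_mult: "algebraic_group G \<Longrightarrow> g \<in> G \<Longrightarrow> h \<in> G \<Longrightarrow> g ** h \<in> G"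
  by (simp add: algebraic_group_def)

lemma algebraic_group_inv: "algebraic_group G \<Longrightarrow> g \<in> G \<Longrightarrow> matrix_inv g \<in> G"
  by (simp add: algebraic_group_def)

lemma algebraic_group_one: "algebraic_group G \<Longrightarrow> mat 1 \<in> G"
  by (simp add: algebraic_group_def)

lemma Lie_iff:
  assumes "algebraic_group G"
  shows "X \<in> Lie G \<longleftrightarrow> (\<forall>f\<in>vanishing G. dir_deriv f (mat 1) X = 0)"
proof -
  have sub: "vanishing G \<subseteq> poly_funs mat_coords" by (auto simp: vanishing_ideal_def)
  show ?thesis
    unfolding Lie_def mem_Collect_eq jets_1[OF sub]
    using vanishing_zero[OF _ algebraic_group_one[OF assms]] by auto
qed

lemma Lie_subspace:
  assumes "algebraic_group G"
  shows "cs.subspace (Lie G)"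
proof (rule cs.subspaceI)
  have "dir_deriv f (mat 1) 0 = 0" for f :: "complex^'a^'a \<Rightarrow> complex" by (simp add: dir_deriv_def)
  then show "0 \<in> Lie G" by (simp add: Lie_iff[OF assms])
qed (simp_all add: Lie_iff[OF assms] dir_deriv_add[OF vanishing_poly] dir_deriv_cscale[OF vanishing_poly])

lemma vanishing_translate:
  assumes "algebraic_group G" "g \<in> G" "h \<in> G" "f \<in> vanishing G"
  shows "(\<lambda>x. f (g ** x ** h)) \<in> vanishing G"
  using assms by (intro vanishingI poly_map_compose[OF _ poly_map_sandwich])
    (auto intro: vanishing_zero algebraic_group_mult vanishing_poly)

text \<open>Translating an equation of \<open>G\<close> by \<open>g\<close> gives another one, so
  left translation carries the tangent space at the identity into the one at
  \<open>g\<close>.\<close>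

lemma dir_deriv_group:
  assumes "algebraic_group G" "g \<in> G" "X \<in> Lie G" "f \<in> vanishing G"
  shows "dir_deriv f g (g ** X) = 0"
  using vanishing_translate[OF assms(1,2) algebraic_group_one[OF assms(1)] assms(4)]
    assms(3) dir_deriv_sandwich[OF vanishing_poly[OF assms(4)], of g "mat 1" "mat 1" X]
  by (simp add: Lie_iff[OF assms(1)])

lemma Lie_Ad:
  assumes "algebraic_group G" "g \<in> G" "X \<in> Lie G"
  shows "Ad g X \<in> Lie G"
  unfolding Lie_iff[OF assms(1)]
proof
  fix f assume f: "f \<in> vanishing G"
  from vanishing_translate[OF assms(1,2) algebraic_group_inv[OF assms(1,2)] f]
  have "dir_deriv (\<lambda>x. f (g ** x ** matrix_inv g)) (mat 1) X = 0"
    using assms(3) by (simp add: Lie_iff[OF assms(1)])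
  then show "dir_deriv f (mat 1) (Ad g X) = 0"
    unfolding dir_deriv_sandwich[OF vanishing_poly[OF f]]
    by (simp add: Ad_def matrix_inv_mult algebraic_group_invertible[OF assms(1,2)])
qed

text \<open>
  The left invariant vector field of an element of the Lie algebra preserves the vanishing ideal,
  so all derivatives at 0 of an equation of the group along the one-parameter curve vanish.
\<close>

lemma exp_vanishing:
  fixes G :: "(complex^'n^'n) set"
  assumes G: "algebraic_group G" and X: "X \<in> Lie G" and c0: "c 0 = mat 1"
    and c: "\<And>t. mderiv c (c t ** X) t" and f: "f \<in> vanishing G"
  shows "f (c t) = 0"
proof -
  let ?X = "\<lambda>f a. dir_deriv f a (a ** X)"
  have X_stable: "?X f \<in> vanishing G" if "f \<in> vanishing G" for f
  proof (rule vanishingI)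
    show "?X f \<in> poly_funs mat_coords"
      by (intro dir_deriv_poly_map[OF vanishing_poly[OF that]] poly_map_mult poly_map_id poly_map_const)
  qed (rule dir_deriv_group[OF G _ X that])
  have deriv: "((\<lambda>t. f (c t)) has_field_derivative ?X f (c t)) (at t)" if "f \<in> vanishing G" for f t
    by (rule dir_deriv_chain[OF vanishing_poly[OF that] c])
  have "(deriv ^^ n) (\<lambda>t. f (c t)) 0 = 0" if "f \<in> vanishing G" for f n
    using that
  proof (induction n arbitrary: f)
    case 0
    then show ?case using vanishing_zero[OF _ algebraic_group_one[OF G]] by (simp add: c0)
  next
    case (Suc n)
    have "deriv (\<lambda>t. f (c t)) = (\<lambda>t. ?X f (c t))"
      using DERIV_imp_deriv[OF deriv[OF Suc.prems]] by (simp add: fun_eq_iff)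
    then show ?case using Suc.IH[OF X_stable[OF Suc.prems]] by (simp add: funpow_Suc_right del: funpow.simps)
  qed
  moreover have "(\<lambda>t. f (c t)) holomorphic_on UNIV"
    using deriv[OF f] by (auto simp: holomorphic_on_open)
  ultimately show ?thesis
    using holomorphic_fun_eq_0_on_connected[of "\<lambda>t. f (c t)" UNIV 0 t] f
    by (simp add: convex_connected[OF convex_UNIV])
qed

lemma exp_curve_inverse:
  assumes c0: "c 0 = mat 1" and c: "\<And>t. mderiv c (X ** c t) t" and comm: "\<And>t. c t ** X = X ** c t"
  shows "c t ** c (- t) = mat 1"
proof -
  have "mderiv (\<lambda>s. c s ** c (- s)) 0 t" for t
  proof -
    have "mderiv (\<lambda>s. c (- s)) (cscale (- 1) (X ** c (- t))) t"
      by (rule mderiv_compose[OF _ c]) (auto intro!: derivative_eq_intros)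
    from mderiv_mult[OF c this]
    have "mderiv (\<lambda>s. c s ** c (- s)) (X ** c t ** c (- t) + c t ** cscale (- 1) (X ** c (- t))) t" .
    moreover have "c t ** cscale (- 1) (X ** c (- t)) = - (X ** c t ** c (- t))"
      by (simp add: matrix_mul_assoc comm)
    ultimately show ?thesis by simp
  qed
  from mderiv_zero_constant[of "\<lambda>s. c s ** c (- s)", OF this] show ?thesis by (simp add: c0)
qed

lemma Lie_exp:
  fixes G :: "(complex^'n^'n) set"
  assumes "algebraic_group G" "X \<in> Lie G"
  obtains c where "c 0 = mat 1" "\<And>t. c t \<in> G" "\<And>t. mderiv c (X ** c t) t"
    "\<And>t. c t ** X = X ** c t" "\<And>t. matrix_inv (c t) = c (- t)"
proof -
  obtain L K M where e: "exp_poly_curve L K M 0 = mat 1"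
    "\<And>t. mderiv (exp_poly_curve L K M) (X ** exp_poly_curve L K M t) t"
    "\<And>t. exp_poly_curve L K M t ** X = X ** exp_poly_curve L K M t"
    by (rule exp_curve_exists[of X], rule that, assumption+)
  let ?c = "exp_poly_curve L K M"
  have inv: "?c t ** ?c (- t) = mat 1" for t by (rule exp_curve_inverse[OF e])
  have "?c t \<in> G" for t
  proof (rule algebraic_group_closed[OF assms(1)])
    show "invertible (?c t)" by (rule matrix_inv_eqI(2)[OF inv])
    show "f (?c t) = 0" if "f \<in> vanishing G" for f
      by (rule exp_vanishing[of G X ?c, OF assms e(1) _ that]) (simp add: e)
  qed
  then show thesis using that[of ?c] e matrix_inv_eqI(1)[OF inv] by simp
qed

lemma Lie_exp_Ad_deriv:
  assumes "\<And>t. mderiv c (X ** c t) t" "\<And>t. c t ** X = X ** c t" "\<And>t. matrix_inv (c t) = c (- t)"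
  shows "mderiv (\<lambda>t. Ad (c t) w) (Ad (c t) (lie_bracket X w)) t"
proof -
  have "mderiv (\<lambda>s. c (- s)) (cscale (- 1) (X ** c (- t))) t"
    by (rule mderiv_compose[OF _ assms(1)]) (auto intro!: derivative_eq_intros)
  from mderiv_mult[OF mderiv_mult[OF assms(1)[of t] mderiv_const[of w t]] this]
  have "mderiv (\<lambda>t. Ad (c t) w)
      ((X ** c t ** w + c t ** 0) ** c (- t) + c t ** w ** cscale (- 1) (X ** c (- t))) t"
    by (simp add: Ad_def assms(3))
  moreover have "(X ** c t ** w + c t ** 0) ** c (- t) + c t ** w ** cscale (- 1) (X ** c (- t)) =
      Ad (c t) (lie_bracket X w)"
    by (simp add: Ad_def assms(3) lie_bracket_def mat_distrib assms(2)[of t, symmetric] matrix_mul_assoc)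
  ultimately show ?thesis by simp
qed

text \<open>A linear form vanishing on \<open>W\<close> is zero along the curve
  \<open>Ad (c s) w\<close>, and its derivative at 0 is its value at
  \<open>lie_bracket X w\<close>.\<close>

lemma Ad_stable_imp_ad_stable:
  assumes G: "algebraic_group G" and W: "cs.subspace W" "\<And>g w. g \<in> G \<Longrightarrow> w \<in> W \<Longrightarrow> Ad g w \<in> W"
    and X: "X \<in> Lie G" and w: "w \<in> W"
  shows "lie_bracket X w \<in> W"
proof (rule ccontr)
  assume "lie_bracket X w \<notin> W"
  then obtain z where z: "\<And>s. s \<in> W \<Longrightarrow> trace (z ** s) = 0" "trace (z ** lie_bracket X w) \<noteq> 0"
    using trace_separation[OF W(1)] by metis
  obtain c where c: "c 0 = mat 1" "\<And>t. c t \<in> G" "\<And>t. mderiv c (X ** c t) t"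
    "\<And>t. c t ** X = X ** c t" "\<And>t. matrix_inv (c t) = c (- t)"
    using Lie_exp[OF G X] by metis
  have "((\<lambda>s. trace (z ** Ad (c s) w)) has_field_derivative trace (z ** Ad (c 0) (lie_bracket X w))) (at 0)"
    by (rule mderiv_trace[OF Lie_exp_Ad_deriv[OF c(3-5)]])
  moreover have "trace (z ** Ad (c s) w) = 0" for s using z(1) W(2) c(2) w by blast
  ultimately have "((\<lambda>s. 0) has_field_derivative trace (z ** lie_bracket X w)) (at 0)"
    by (simp add: c(1))
  from DERIV_unique[OF this DERIV_const] show False using z(2) by simp
qed

lemma Lie_bracket_closed:
  "algebraic_group G \<Longrightarrow> X \<in> Lie G \<Longrightarrow> Y \<in> Lie G \<Longrightarrow> lie_bracket X Y \<in> Lie G"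
  by (rule Ad_stable_imp_ad_stable[OF _ Lie_subspace Lie_Ad])

text \<open>Chevalley's replica of \<open>X\<close> obtained by complex conjugation of its eigenvalues.\<close>

lemma Lie_replica:
  fixes G :: "(complex^'n^'n) set"
  assumes "algebraic_group G" "X \<in> Lie G"
  obtains D where "D \<in> Lie G" "D ** X = X ** D" "trace (X ** D) = 0 \<Longrightarrow> nilpotent_mat X"
proof -
  obtain L K M where L: "finite L" and e: "exp_poly_curve L K M 0 = mat 1"
    "\<And>t. mderiv (exp_poly_curve L K M) (X ** exp_poly_curve L K M t) t"
    "\<And>t. exp_poly_curve L K M t ** X = X ** exp_poly_curve L K M t"
    and K: "K > 0"
    and D: "(\<Sum>l\<in>L. cscale (cnj l) (M l 0)) ** X = X ** (\<Sum>l\<in>L. cscale (cnj l) (M l 0))"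
      "trace (X ** (\<Sum>l\<in>L. cscale (cnj l) (M l 0))) = 0 \<Longrightarrow> nilpotent_mat X"
    by (rule exp_curve_exists[of X], rule that, assumption+)
  let ?c = "exp_poly_curve L K M"
  let ?D = "\<Sum>l\<in>L. cscale (cnj l) (M l 0)"
  \<comment> \<open>Both \<open>f \<mapsto> dir_deriv f (mat 1) ?D\<close> and the coefficient
    \<open>b\<close> along the curve are derivations over evaluation at the identity, so agreement
    on coordinates spreads to all polynomials.\<close>
  have rep: "exp_poly_rep (\<lambda>t. f (?c t)) (f (mat 1)) (dir_deriv f (mat 1) ?D)" if "f \<in> poly_funs mat_coords" for f
    using that
  proof induction
    case (const c)
    then show ?case using exp_poly_rep_const by (simp add: dir_deriv_const)
  next
    case (coord f)
    then obtain i j where f: "f = (\<lambda>A. A $ i $ j)" by (auto simp: mat_coords_def)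
    have "exp_poly_rep (\<lambda>t. \<Sum>l\<in>L. \<Sum>k<K. M l k $ i $ j * t ^ k * exp (l * t))
        (\<Sum>l\<in>L. \<Sum>k<K. if k = 0 then M l k $ i $ j else 0)
        (\<Sum>l\<in>L. \<Sum>k<K. if k = 0 then M l k $ i $ j * cnj l else 0)"
      by (intro exp_poly_rep_sum exp_poly_rep_monomial L finite_lessThan)
    moreover have "(\<Sum>l\<in>L. \<Sum>k<K. if k = 0 then M l k $ i $ j else 0) = mat 1 $ i $ j"
    proof -
      have "?c 0 $ i $ j = (\<Sum>l\<in>L. \<Sum>k<K. if k = 0 then M l k $ i $ j else 0)"
        unfolding exp_poly_curve_nth by (intro sum.cong refl) (simp add: power_0_left)
      then show ?thesis by (simp add: e)
    qed
    moreover have "(\<Sum>l\<in>L. \<Sum>k<K. if k = 0 then M l k $ i $ j * cnj l else 0) = ?D $ i $ j"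
      using K by (simp add: mult.commute)
    ultimately show ?case unfolding f dir_deriv_coord exp_poly_curve_nth by simp
  next
    case (add f g)
    from exp_poly_rep_add[OF add.IH(2,1)] show ?case by (simp add: dir_deriv_add_fun add.hyps)
  next
    case (mult f g)
    from exp_poly_rep_mult[OF mult.IH(1,2)] show ?case by (simp add: dir_deriv_mult_fun mult.hyps)
  qed
  have "?D \<in> Lie G" unfolding Lie_iff[OF assms(1)]
  proof
    fix f assume f: "f \<in> vanishing G"
    show "dir_deriv f (mat 1) ?D = 0"
      by (rule exp_poly_rep_zero_unique[OF rep[OF vanishing_poly[OF f]]])
        (rule exp_vanishing[of G X ?c, OF assms e(1) _ f], simp add: e)
  qed
  then show thesis using that D by blast
qed

section \<open>The trace form of a reductive group\<close>

lemma polynomial_curve_equation: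
  fixes \<gamma> :: "complex \<Rightarrow> complex^'n^'n"
  assumes \<gamma>: "\<And>i j. \<exists>p. \<forall>t. \<gamma> t $ i $ j = poly p t"
    and closed: "closedin zariski_mat E" and b: "\<gamma> b \<notin> E"
  obtains p where "p \<noteq> 0" "\<And>t. \<gamma> t \<in> E \<Longrightarrow> poly p t = 0"
proof -
  from closed have "\<exists>F\<subseteq>poly_funs mat_coords. E = {x. \<forall>f\<in>F. f x = 0}"
    by (simp only: closedin_zariski)
  then obtain F where F: "F \<subseteq> poly_funs mat_coords" "E = {x. \<forall>f\<in>F. f x = 0}"
    by (elim exE conjE) (rule that)
  from b obtain f where f: "f \<in> F" "f (\<gamma> b) \<noteq> 0" unfolding F(2) by auto
  have "\<exists>p. \<forall>t. f (\<gamma> t) = poly p t"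
  proof (rule poly_funs_compose_poly[of f mat_coords \<gamma>])
    show "f \<in> poly_funs mat_coords" using F(1) f(1) by (rule subsetD)
    show "\<exists>p. \<forall>t. c (\<gamma> t) = poly p t" if "c \<in> mat_coords" for c
      using that \<gamma> by (auto simp: mat_coords_def)
  qed
  then obtain p where p: "\<And>t. f (\<gamma> t) = poly p t" by auto
  show thesis
  proof (rule that[of p])
    show "p \<noteq> 0" using f(2) p by auto
    show "poly p t = 0" if "\<gamma> t \<in> E" for t using that f(1) unfolding F(2) p[symmetric] by simp
  qed
qed

text \<open>The affine line is irreducible: two closed sets separating the range would give nonzero
  polynomials in \<open>t\<close> with product zero.\<close>

lemma polynomial_curve_connected:
  fixes \<gamma> :: "complex \<Rightarrow> complex^'n^'n"
  assumes \<gamma>: "\<And>i j. \<exists>p. \<forall>t. \<gamma> t $ i $ j = poly p t"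
  shows "connectedin zariski_mat (range \<gamma>)"
proof -
  have False if E: "closedin zariski_mat E1" "closedin zariski_mat E2" "range \<gamma> \<subseteq> E1 \<union> E2"
    "E1 \<inter> E2 \<inter> range \<gamma> = {}" "E1 \<inter> range \<gamma> \<noteq> {}" "E2 \<inter> range \<gamma> \<noteq> {}" for E1 E2
  proof -
    obtain a where a: "\<gamma> a \<in> E1" using E(5) by auto
    obtain b where b: "\<gamma> b \<in> E2" using E(6) by auto
    have "\<gamma> a \<notin> E2" "\<gamma> b \<notin> E1" using E(4) a b by auto
    obtain p where p: "p \<noteq> 0" "\<And>t. \<gamma> t \<in> E1 \<Longrightarrow> poly p t = 0"
      using polynomial_curve_equation[OF \<gamma> E(1) \<open>\<gamma> b \<notin> E1\<close>] by metis
    obtain q where q: "q \<noteq> 0" "\<And>t. \<gamma> t \<in> E2 \<Longrightarrow> poly q t = 0"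
      using polynomial_curve_equation[OF \<gamma> E(2) \<open>\<gamma> a \<notin> E2\<close>] by metis
    have "poly (p * q) t = 0" for t
    proof -
      have "\<gamma> t \<in> E1 \<union> E2" using E(3) by (rule subsetD) simp
      then show ?thesis using p(2)[of t] q(2)[of t] by auto
    qed
    then have "p * q = 0" by (simp add: poly_all_0_iff_0[symmetric] del: poly_mult)
    with p q show False by simp
  qed
  then show ?thesis unfolding connectedin_closedin topspace_zariski
    by (intro conjI subset_UNIV notI) (elim exE conjE, assumption?)
qed

lemma gchoose_poly: "\<exists>p. \<forall>t. (t :: complex) gchoose k = poly p t"
proof
  show "\<forall>t. (t :: complex) gchoose k =
      poly (smult (1 / fact k) (\<Prod>i = 0..<k. [:- of_nat i, 1:])) t"
    by (simp add: gbinomial_prod_rev poly_prod)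
qed

text \<open>The complex power \<open>u^t\<close> by the binomial series in \<open>u - 1\<close>,
  which is finite by nilpotency; Pascal's rule yields \<open>u^(t + 1) = u u^t\<close>.\<close>

lemma unipotent_curve:
  fixes u :: "complex^'n^'n"
  assumes "unipotent_mat u"
  obtains \<gamma> where "\<And>i j. \<exists>p. \<forall>t. \<gamma> t $ i $ j = poly p t" "\<And>m. \<gamma> (of_nat m) = mpow u m"
proof -
  define v where "v = u - mat 1"
  obtain N where "mpow v N = 0"
    using assms unfolding unipotent_mat_def nilpotent_mat_iff v_def by auto
  \<comment> \<open>The range \<open>k < Suc N\<close> always contains the term \<open>k = 0\<close>
    that is split off below.\<close>
  then have N: "mpow v (Suc N) = 0" by (rule mpow_zero_mono) simp
  define \<gamma> where "\<gamma> t = (\<Sum>k<Suc N. cscale (t gchoose k) (mpow v k))" for t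
  have poly: "\<exists>p. \<forall>t. \<gamma> t $ i $ j = poly p t" for i j
  proof -
    obtain p where p: "\<And>k t. (t :: complex) gchoose k = poly (p k) t" using gchoose_poly by metis
    show ?thesis
      by (rule exI[of _ "\<Sum>k<Suc N. smult (mpow v k $ i $ j) (p k)"])
        (simp add: \<gamma>_def p poly_sum mult.commute del: sum.lessThan_Suc)
  qed
  have step: "\<gamma> (t + 1) = u ** \<gamma> t" for t
  proof -
    have "v ** \<gamma> t = (\<Sum>k<Suc N. cscale (t gchoose k) (mpow v (Suc k)))"
      by (simp add: \<gamma>_def matrix_sum_distrib mpow_Suc del: sum.lessThan_Suc)
    also have "\<dots> = (\<Sum>k<N. cscale (t gchoose k) (mpow v (Suc k)))" by (simp add: N)
    finally have "\<gamma> t + v ** \<gamma> t = mat 1 + (\<Sum>k<N. cscale ((t gchoose k) + (t gchoose Suc k)) (mpow v (Suc k)))"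
      unfolding \<gamma>_def by (subst sum.lessThan_Suc_shift)
        (simp add: cs.scale_left_distrib sum.distrib add_ac)
    also have "\<dots> = \<gamma> (t + 1)"
      unfolding \<gamma>_def by (subst sum.lessThan_Suc_shift) (simp add: gbinomial_Suc_Suc)
    finally show ?thesis by (simp add: v_def mat_distrib)
  qed
  have "\<gamma> (of_nat m) = mpow u m" for m :: nat
  proof (induction m)
    case 0
    show ?case unfolding \<gamma>_def by (subst sum.lessThan_Suc_shift) simp
  next
    case (Suc m)
    then show ?case using step[of "of_nat m"] by (simp add: mpow_Suc add.commute)
  qed
  from that[of \<gamma>, OF poly this] show thesis .
qed

lemma poly_zero_of_nat:
  assumes "\<And>m. poly p (of_nat m :: complex) = 0"
  shows "p = 0"
proof (rule ccontr)
  assume "p \<noteq> 0"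
  then have "finite {x. poly p x = 0}" by (rule poly_roots_finite)
  moreover have "range of_nat \<subseteq> {x. poly p x = 0}" using assms by auto
  moreover have "infinite (range (of_nat :: nat \<Rightarrow> complex))"
    by (intro range_inj_infinite) (simp add: inj_on_def)
  ultimately show False using finite_subset by blast
qed

text \<open>Each \<open>u\<close> is joined to the identity by the curve \<open>u^t\<close>. A
  polynomial in \<open>t\<close> that vanishes at all natural numbers is zero, so the equations of
  \<open>U\<close>, which hold at the powers of \<open>u\<close>, hold along the curve.\<close>

lemma unipotent_group_connected:
  fixes U :: "(complex^'n^'n) set"
  assumes U: "algebraic_group U" and uni: "\<And>u. u \<in> U \<Longrightarrow> unipotent_mat u"
  shows "connected_space (subtopology zariski_mat U)"
proof -
  have pow: "mpow u m \<in> U" if "u \<in> U" for u m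
    using that U by (induction m) (auto simp: mpow_Suc intro: algebraic_group_mult algebraic_group_one)
  have curve: "\<exists>\<gamma> :: complex \<Rightarrow> complex^'n^'n. range \<gamma> \<subseteq> U \<and> u \<in> range \<gamma> \<and> mat 1 \<in> range \<gamma> \<and> connectedin zariski_mat (range \<gamma>)"
    if u: "u \<in> U" for u
  proof -
    have u': "matrix_inv u \<in> U" by (rule algebraic_group_inv[OF U u])
    obtain \<gamma> where \<gamma>: "\<And>i j. \<exists>p. \<forall>t. \<gamma> t $ i $ j = poly p t" "\<And>m. \<gamma> (of_nat m) = mpow u m"
      using unipotent_curve[OF uni[OF u]] by metis
    obtain \<gamma>' where \<gamma>': "\<And>i j. \<exists>p. \<forall>t. \<gamma>' t $ i $ j = poly p t" "\<And>m. \<gamma>' (of_nat m) = mpow (matrix_inv u) m"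
      using unipotent_curve[OF uni[OF u']] by metis
    have f_poly: "\<exists>p. \<forall>t. f (\<gamma> t) = poly p t" if "f \<in> poly_funs mat_coords" for f
      by (rule poly_funs_compose_poly[of f mat_coords \<gamma>]) (use that \<gamma>(1) in \<open>auto simp: mat_coords_def\<close>)
    have uu': "u ** matrix_inv u = matrix_inv u ** u" "u ** matrix_inv u = mat 1"
      using matrix_inv_mult[OF algebraic_group_invertible[OF U u]] by auto
    \<comment> \<open>\<open>U\<close> is closed only among the invertible matrices, so membership
      also needs an inverse of \<open>\<gamma> t\<close>; the curve through the powers of
      \<open>matrix_inv u\<close> provides it.\<close>
    have inv: "\<gamma> t ** \<gamma>' t = mat 1" for t
    proof -
      have "(\<gamma> t ** \<gamma>' t) $ i $ j = mat 1 $ i $ j" for i j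
      proof -
        obtain p q where p: "\<And>k t. \<gamma> t $ i $ k = poly (p k) t" and q: "\<And>k t. \<gamma>' t $ k $ j = poly (q k) t"
          using \<gamma>(1)[of i] \<gamma>'(1)[of _ j] by metis
        let ?r = "(\<Sum>k\<in>UNIV. p k * q k) - [:mat 1 $ i $ j:]"
        have r: "poly ?r t = (\<gamma> t ** \<gamma>' t) $ i $ j - mat 1 $ i $ j" for t
          by (simp add: matrix_mul_nth p q poly_sum)
        have "\<gamma> (of_nat m) ** \<gamma>' (of_nat m) = mat 1" for m
          unfolding \<gamma>(2) \<gamma>'(2) mpow_mult_commuting[OF uu'(1), symmetric] uu'(2)
          by (induction m) (simp_all add: mpow_Suc)
        then have "poly ?r (of_nat m) = 0" for m unfolding r by simp
        then have "?r = 0" by (rule poly_zero_of_nat)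
        then show ?thesis using r[of t] by simp
      qed
      then show ?thesis by (simp add: vec_eq_iff)
    qed
    have "\<gamma> t \<in> U" for t
    proof (rule algebraic_group_closed[OF U matrix_inv_eqI(2)[OF inv]])
      fix f assume f: "f \<in> vanishing U"
      obtain p where p: "\<And>t. f (\<gamma> t) = poly p t" using f_poly[OF vanishing_poly[OF f]] by blast
      have "poly p (of_nat m) = 0" for m
        unfolding p[symmetric] \<gamma>(2) by (rule vanishing_zero[OF f pow[OF u]])
      then have "p = 0" by (rule poly_zero_of_nat)
      then show "f (\<gamma> t) = 0" by (simp add: p)
    qed
    moreover have "\<gamma> 0 = mat 1" "\<gamma> 1 = u" using \<gamma>(2)[of 0] \<gamma>(2)[of 1] by simp_all
    ultimately have "range \<gamma> \<subseteq> U" "u \<in> range \<gamma>" "mat 1 \<in> range \<gamma>"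
      using rangeI[of \<gamma> 0] rangeI[of \<gamma> 1] by auto
    with polynomial_curve_connected[OF \<gamma>(1)] show ?thesis by (intro exI[of _ \<gamma>] conjI)
  qed
  have cover: "\<exists>S. S \<subseteq> U \<and> u \<in> S \<and> mat 1 \<in> S \<and> connectedin zariski_mat S" if u: "u \<in> U" for u
  proof -
    obtain \<gamma> :: "complex \<Rightarrow> complex^'n^'n" where "range \<gamma> \<subseteq> U \<and> u \<in> range \<gamma> \<and> mat 1 \<in> range \<gamma> \<and>
        connectedin zariski_mat (range \<gamma>)"
      using curve[OF u] by (elim exE)
    then show ?thesis by (rule exI)
  qed
  define \<A> where "\<A> = {S. S \<subseteq> U \<and> mat 1 \<in> S \<and> connectedin zariski_mat S}"
  have "mat 1 \<in> \<Inter>\<A>" by (simp add: \<A>_def)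
  then have "connectedin zariski_mat (\<Union>\<A>)"
    by (intro connectedin_Union) (auto simp: \<A>_def)
  moreover have "\<Union>\<A> = U"
  proof
    show "\<Union>\<A> \<subseteq> U" by (auto simp: \<A>_def)
    show "U \<subseteq> \<Union>\<A>"
    proof
      fix u assume "u \<in> U"
      from cover[OF this] show "u \<in> \<Union>\<A>" unfolding \<A>_def by auto
    qed
  qed
  ultimately show ?thesis by (simp add: connectedin_def)
qed

text \<open>
  The elements acting trivially on the traces of all elements of \<open>G\<close> form a normal unipotent
  subgroup, the kernel of the semisimplification of the given representation.
\<close>

lemma reductive_trace_kernel:
  fixes G :: "(complex^'n^'n) set"
  assumes red: "reductive_group G" and g: "g \<in> G" and tr: "\<And>a. a \<in> G \<Longrightarrow> trace (g ** a) = trace a"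
  shows "g = mat 1"
proof -
  have G: "algebraic_group G" using red by (simp add: reductive_group_def)
  define U where "U = {g \<in> G. \<forall>a\<in>G. trace (g ** a) = trace a}"
  have inv: "matrix_inv h ** h = mat 1" "h ** matrix_inv h = mat 1" if "h \<in> G" for h
    using matrix_inv_mult algebraic_group_invertible[OF G that] by auto
  have U: "algebraic_group U" unfolding algebraic_group_def
  proof (intro conjI ballI)
    show "mat 1 \<in> U" using algebraic_group_one[OF G] by (simp add: U_def)
    show "g ** h \<in> U" if "g \<in> U" "h \<in> U" for g h
      using that algebraic_group_mult[OF G] by (simp add: U_def matrix_mul_assoc[symmetric])
    show "matrix_inv g \<in> U" if g: "g \<in> U" for g
    proof -
      have "g \<in> G" using g by (simp add: U_def)
      have "trace (matrix_inv g ** a) = trace a" if "a \<in> G" for a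
      proof -
        have "matrix_inv g ** a \<in> G" using \<open>g \<in> G\<close> that algebraic_group_mult[OF G] algebraic_group_inv[OF G] by blast
        then have "trace (g ** (matrix_inv g ** a)) = trace (matrix_inv g ** a)" using g by (simp add: U_def)
        then show ?thesis by (simp add: matrix_mul_assoc inv[OF \<open>g \<in> G\<close>])
      qed
      then show ?thesis using \<open>g \<in> G\<close> algebraic_group_inv[OF G] by (simp add: U_def)
    qed
    define F where "F = vanishing G \<union> (\<lambda>a x. trace (x ** a) + - trace a) ` G"
    have F_poly: "F \<subseteq> poly_funs mat_coords"
    proof
      fix f assume "f \<in> F"
      then consider "f \<in> vanishing G" | a where "f = (\<lambda>x. trace (x ** a) + - trace a)"
        by (auto simp: F_def)
      then show "f \<in> poly_funs mat_coords"
      proof cases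
        case 2
        show ?thesis unfolding 2
          by (intro poly_funs.add poly_funs.const poly_map_trace poly_map_mult poly_map_id poly_map_const)
      qed (rule vanishing_poly)
    qed
    have "closedin zariski_mat {x. \<forall>f\<in>F. f x = 0}"
      unfolding closedin_zariski by (intro exI[of _ F] conjI refl F_poly)
    note closed = this
    have mem: "x \<in> U \<longleftrightarrow> x \<in> {x. \<forall>f\<in>F. f x = 0} \<inter> {g. invertible g}" for x
    proof
      assume "x \<in> U"
      then have "x \<in> G" "\<And>a. a \<in> G \<Longrightarrow> trace (x ** a) = trace a" by (simp_all add: U_def)
      then show "x \<in> {x. \<forall>f\<in>F. f x = 0} \<inter> {g. invertible g}"
        using algebraic_group_invertible[OF G] vanishing_zero[of _ G x] by (auto simp: F_def)
    next
      assume x: "x \<in> {x. \<forall>f\<in>F. f x = 0} \<inter> {g. invertible g}"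
      then have "invertible x" by simp
      moreover have "f x = 0" if "f \<in> vanishing G" for f using x that by (simp add: F_def)
      ultimately have "x \<in> G" by (rule algebraic_group_closed[OF G])
      moreover have "trace (x ** a) + - trace a = 0" if "a \<in> G" for a
      proof -
        have "(\<lambda>x. trace (x ** a) + - trace a) \<in> F" unfolding F_def by (intro UnI2 imageI that)
        moreover have "\<forall>f\<in>F. f x = 0" using x by simp
        ultimately have "(\<lambda>x. trace (x ** a) + - trace a) x = 0" by (rule bspec[rotated])
        then show ?thesis .
      qed
      ultimately show "x \<in> U" by (simp add: U_def)
    qed
    have "U = {x. \<forall>f\<in>F. f x = 0} \<inter> {g. invertible g}" by (rule set_eqI, rule mem)
    with closed show "closedin (subtopology zariski_mat {g. invertible g}) U"
      unfolding closedin_subtopology by (intro exI[of _ "{x. \<forall>f\<in>F. f x = 0}"] conjI)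
  qed
  have uni: "unipotent_mat u" if u: "u \<in> U" for u
    unfolding unipotent_mat_def
  proof (rule nilpotent_if_traces_zero)
    let ?v = "u - mat 1"
    have u': "u \<in> G" "\<And>a. a \<in> G \<Longrightarrow> trace (u ** a) = trace a" using u by (auto simp: U_def)
    \<comment> \<open>Comparing \<open>u ** a\<close> with \<open>a\<close> raises the power of
      \<open>?v\<close> by one; \<open>a = mat 1\<close> then gives the traces of all positive
      powers.\<close>
    have *: "trace (?v ** (mpow ?v k ** a)) = 0" if "a \<in> G" for k a
      using that
    proof (induction k arbitrary: a)
      case 0
      then show ?case using u'(2) by (simp add: mat_distrib trace_sub)
    next
      case (Suc k)
      have "?v ** (mpow ?v (Suc k) ** a) = ?v ** (mpow ?v k ** (u ** a)) - ?v ** (mpow ?v k ** a)"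
        by (simp add: mpow_Suc2 mat_distrib matrix_mul_assoc)
      then show ?case using Suc.IH[OF algebraic_group_mult[OF G u'(1) Suc.prems]] Suc.IH[OF Suc.prems]
        by (simp add: trace_sub)
    qed
    show "trace (mpow ?v k) = 0" if "k > 0" for k
      using *[OF algebraic_group_one[OF G], of "k - 1"] that by (cases k) (simp_all add: mpow_Suc)
  qed
  have normal: "h ** u ** matrix_inv h \<in> U" if "h \<in> G" "u \<in> U" for h u
  proof -
    have u: "u \<in> G" "\<And>a. a \<in> G \<Longrightarrow> trace (u ** a) = trace a" using that(2) by (auto simp: U_def)
    have "trace (h ** u ** matrix_inv h ** a) = trace a" if a: "a \<in> G" for a
    proof -
      have "matrix_inv h ** a ** h \<in> G"
        using that algebraic_group_mult[OF G] algebraic_group_inv[OF G \<open>h \<in> G\<close>] \<open>h \<in> G\<close> by blast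
      then have "trace (u ** (matrix_inv h ** a ** h)) = trace (matrix_inv h ** a ** h)" by (rule u(2))
      moreover have "trace (h ** u ** matrix_inv h ** a) = trace (u ** (matrix_inv h ** a ** h))"
        using trace_cyclic[of h "u ** matrix_inv h" a] by (simp add: matrix_mul_assoc)
      moreover have "trace (matrix_inv h ** a ** h) = trace a"
        using trace_cyclic[of h "matrix_inv h" a] trace_cyclic[of "matrix_inv h" a h] inv[OF \<open>h \<in> G\<close>]
          trace_mul_sym[of "matrix_inv h ** a" h]
        by (simp add: matrix_mul_assoc)
      ultimately show ?thesis by simp
    qed
    then show ?thesis using that u(1) algebraic_group_mult[OF G] algebraic_group_inv[OF G]
      by (simp add: U_def)
  qed
  have "U = {mat 1}"
    using red U uni normal unipotent_group_connected[OF U uni]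
    unfolding reductive_group_def by (auto simp: U_def)
  moreover have "g \<in> U" using g tr by (simp add: U_def)
  ultimately show ?thesis by simp
qed

theorem trace_form_nondegenerate:
  fixes G :: "(complex^'n^'n) set"
  assumes red: "reductive_group G" and X: "X \<in> Lie G" "\<And>Y. Y \<in> Lie G \<Longrightarrow> trace (X ** Y) = 0"
  shows "X = 0"
proof -
  have G: "algebraic_group G" using red by (simp add: reductive_group_def)
  define K where "K = {X \<in> Lie G. \<forall>Y\<in>Lie G. trace (X ** Y) = 0}"
  have sub: "cs.subspace K"
    using Lie_subspace[OF G] unfolding cs.subspace_def K_def by (auto simp: mat_distrib trace_add)
  have Ad_K: "Ad g x \<in> K" if g: "g \<in> G" and x: "x \<in> K" for g x
  proof -
    have inv: "invertible g" by (rule algebraic_group_invertible[OF G g])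
    have "trace (Ad g x ** Y) = 0" if "Y \<in> Lie G" for Y
    proof -
      have "Ad g x ** Y = Ad g (x ** Ad (matrix_inv g) Y)"
        by (simp add: Ad_mult[OF inv] Ad_inv_cancel[OF inv])
      then show ?thesis using x Lie_Ad[OF G algebraic_group_inv[OF G g] that]
        by (simp add: trace_Ad[OF inv] K_def)
    qed
    then show ?thesis using x Lie_Ad[OF G g] by (simp add: K_def)
  qed
  have K_Lie: "lie_bracket x y \<in> K" if "x \<in> K" "y \<in> K" for x y
    by (rule Ad_stable_imp_ad_stable[OF G sub Ad_K _ that(2)]) (use that in \<open>auto simp: K_def\<close>)
  \<comment> \<open>\<open>x\<close> is orthogonal to all of \<open>Lie G\<close>, in particular to
    its own replica.\<close>
  have nil: "nilpotent_mat x" if "x \<in> K" for x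
  proof -
    obtain D where "D \<in> Lie G" "trace (x ** D) = 0 \<Longrightarrow> nilpotent_mat x"
      using Lie_replica[OF G, of x] \<open>x \<in> K\<close> by (auto simp: K_def)
    then show ?thesis using that by (simp add: K_def)
  qed
  obtain m where m: "left_products K m = {0}" using engel[OF sub K_Lie nil] by blast
  have "X \<in> K" using X by (simp add: K_def)
  \<comment> \<open>\<open>a x = (Ad a x) a\<close> and \<open>K\<close> is
    \<open>Ad\<close>-stable, so \<open>a\<close> preserves the filtration that \<open>X\<close>
    moves down.\<close>
  have tr: "trace (X ** a) = 0" if a: "a \<in> G" for a
  proof (rule trace_nilpotent, rule nilpotent_of_left_products[OF m \<open>X \<in> K\<close>])
    fix j w assume "w \<in> left_products K j"
    then show "a ** w \<in> left_products K j"
    proof (rule left_products_stable[rotated])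
      fix x assume "x \<in> K"
      have "a ** x = Ad a x ** a + 0"
        using matrix_inv_mult[OF algebraic_group_invertible[OF G a]]
        by (simp add: Ad_def matrix_mul_assoc[symmetric])
      then show "\<exists>x'\<in>K. \<exists>x''\<in>K. a ** x = x' ** a + x''"
        using Ad_K[OF a \<open>x \<in> K\<close>] cs.subspace_0[OF sub] by blast
    qed
  qed
  obtain c where c: "c 0 = mat 1" "\<And>t. c t \<in> G" "\<And>t. mderiv c (X ** c t) t"
    using Lie_exp[OF G X(1)] by metis
  \<comment> \<open>The derivative of \<open>trace (c s ** a)\<close> is
    \<open>trace (X ** (c s ** a))\<close>, zero by \<open>tr\<close>; so each \<open>c t\<close>
    acts trivially on the traces of \<open>G\<close>.\<close>
  have "c t = mat 1" for t
  proof (rule reductive_trace_kernel[OF red c(2)])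
    fix a assume a: "a \<in> G"
    have "((\<lambda>s. trace (c s ** a)) has_field_derivative 0) (at s within UNIV)" for s
    proof -
      have "trace (a ** (X ** c s)) = trace (X ** (c s ** a))"
        using trace_cyclic[of a X "c s"] by (simp add: matrix_mul_assoc)
      also have "\<dots> = 0" by (rule tr[OF algebraic_group_mult[OF G c(2) a]])
      finally have "trace (a ** (X ** c s)) = 0" .
      then have "((\<lambda>s. trace (a ** c s)) has_field_derivative 0) (at s)"
        using mderiv_trace[OF c(3)[of s], of a] by simp
      moreover have "(\<lambda>s. trace (a ** c s)) = (\<lambda>s. trace (c s ** a))"
        by (rule ext) (rule trace_mul_sym)
      ultimately show ?thesis by simp
    qed
    then obtain k where "\<And>s. trace (c s ** a) = k"
      using has_field_derivative_zero_constant[of UNIV "\<lambda>s. trace (c s ** a)"] by auto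
    then have "trace (c t ** a) = trace (c 0 ** a)" by simp
    then show "trace (c t ** a) = trace a" by (simp add: c(1))
  qed
  then have "c = (\<lambda>_. mat 1)" by (rule ext)
  then have "mderiv c 0 0" using mderiv_const[of "mat 1" 0] by simp
  then have "(X ** c 0) $ i $ j = 0" for i j
  proof -
    have "((\<lambda>s. c s $ i $ j) has_field_derivative (X ** c 0) $ i $ j) (at 0)"
      using c(3)[of 0] by (simp add: mderiv_def)
    moreover have "((\<lambda>s. c s $ i $ j) has_field_derivative 0) (at 0)"
      using \<open>mderiv c 0 0\<close> by (simp add: mderiv_def)
    ultimately show ?thesis by (rule DERIV_unique)
  qed
  then show ?thesis by (simp add: c(1) vec_eq_iff)
qed

section \<open>Tangent vectors at nilpotent matrices\<close>

lemma jordan_form_nilpotent: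
  fixes A :: "complex^'n^'n"
  assumes "nilpotent_mat A"
  obtains Q Q' N :: "complex^'n^'n" and f :: "'n \<Rightarrow> nat"
  where "Q ** Q' = mat 1" "Q' ** Q = mat 1" "A = Q ** N ** Q'"
    "inj f" "\<And>i. f i < CARD('n)" "\<And>i j. N $ i $ j \<in> {0, 1}"
    "\<And>i j. N $ i $ j \<noteq> 0 \<Longrightarrow> f j = Suc (f i)"
proof -
  obtain Q Q' N d and f :: "'n \<Rightarrow> nat" where Q: "Q ** Q' = mat 1" "Q' ** Q = mat 1"
    and A: "A = Q ** (diagm d + N) ** Q'" and f: "inj f" "\<And>i. f i < CARD('n)"
    and N01: "\<And>i j. N $ i $ j \<in> {0, 1}"
    and N: "\<And>i j. N $ i $ j \<noteq> 0 \<Longrightarrow> f j = Suc (f i) \<and> d i = d j"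
    by (rule jordan_form[of A], rule that, assumption+)
  have super: "f j = Suc (f i)" if "N $ i $ j \<noteq> 0" for i j using N[OF that] by simp
  obtain k where k: "mpow A k = 0" using assms by (auto simp: nilpotent_mat_iff)
  have "diagm d + N = Q' ** A ** Q"
    by (simp add: A matrix_mul_assoc Q) (simp add: matrix_mul_assoc[symmetric] Q)
  then have "mpow (diagm d + N) k = 0"
    using k by (simp add: mpow_conj[OF Q(1,2), symmetric])
  moreover have "mpow (diagm d + N) k $ i $ i = d i ^ k" for i
    using mpow_triangular[of N f d k i i, OF super f(1)] by simp
  ultimately have "d i ^ k = 0" for i by simp
  then have "d i = 0" for i by (simp add: power_eq_0_iff)
  then have "diagm d = 0" by (simp add: vec_eq_iff diagm_nth)
  with A have "A = Q ** N ** Q'" by simp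
  then show thesis by (rule that[OF Q _ f N01 super])
qed

primrec pow_deriv :: "complex^'n^'n \<Rightarrow> complex^'n^'n \<Rightarrow> nat \<Rightarrow> complex^'n^'n"
  where
    "pow_deriv e v 0 = 0"
  | "pow_deriv e v (Suc p) = v ** mpow e p + e ** pow_deriv e v p"

lemma mderiv_mpow: "mderiv (\<lambda>t. mpow (e + cscale t v) p) (pow_deriv e v p) 0"
proof (induction p)
  case 0
  show ?case by (simp add: mderiv_const)
next
  case (Suc p)
  from mderiv_mult[OF mderiv_line[of e v 0] Suc] show ?case by (simp add: mpow_Suc)
qed

section \<open>Determinantal equations for the rank\<close>

lemma prod_differentiable:
  fixes f :: "'i \<Rightarrow> complex \<Rightarrow> complex"
  assumes "finite S" "\<And>i. i \<in> S \<Longrightarrow> (f i has_field_derivative f' i) (at t)"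
  shows "\<exists>D. ((\<lambda>s. \<Prod>i\<in>S. f i s) has_field_derivative D) (at t)"
  using assms
proof (induction S)
  case empty
  show ?case by (auto intro: DERIV_const)
next
  case (insert x S)
  then obtain D where "((\<lambda>s. \<Prod>i\<in>S. f i s) has_field_derivative D) (at t)" by auto
  from DERIV_mult[OF insert.prems[OF insertI1] this] insert.hyps show ?case by auto
qed

text \<open>Each product in the Leibniz expansion has exactly one factor from the vanishing column,
  and only differentiating that factor contributes.\<close>

lemma det_deriv_zero_column:
  fixes \<gamma> :: "complex \<Rightarrow> complex^'n^'n"
  assumes \<gamma>: "mderiv \<gamma> D 0" and zero: "\<And>i. \<gamma> 0 $ i $ j0 = 0"
  shows "((\<lambda>s. det (\<gamma> s)) has_field_derivative
    det (\<chi> i j. if j = j0 then D $ i $ j0 else \<gamma> 0 $ i $ j)) (at 0)"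
proof -
  let ?A = "(\<chi> i j. if j = j0 then D $ i $ j0 else \<gamma> 0 $ i $ j) :: complex^'n^'n"
  have entry: "((\<lambda>s. \<gamma> s $ i $ j) has_field_derivative D $ i $ j) (at 0)" for i j
    using \<gamma> by (simp add: mderiv_def)
  have prod: "((\<lambda>s. \<Prod>i\<in>UNIV. \<gamma> s $ i $ \<tau> i) has_field_derivative (\<Prod>i\<in>UNIV. ?A $ i $ \<tau> i)) (at 0)"
    if \<tau>: "\<tau> permutes UNIV" for \<tau>
  proof -
    obtain i where i: "\<tau> i = j0" using permutes_surj[OF \<tau>] by (metis surjD)
    have ne: "\<tau> k \<noteq> j0" if "k \<noteq> i" for k
      using permutes_inj[OF \<tau>] that i by (auto simp: inj_def)
    obtain E where "((\<lambda>s. \<Prod>k\<in>UNIV - {i}. \<gamma> s $ k $ \<tau> k) has_field_derivative E) (at 0)"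
      using prod_differentiable[of "UNIV - {i}" "\<lambda>k s. \<gamma> s $ k $ \<tau> k", OF _ entry] by auto
    from DERIV_mult[OF entry[of i j0] this]
    have "((\<lambda>s. \<gamma> s $ i $ j0 * (\<Prod>k\<in>UNIV - {i}. \<gamma> s $ k $ \<tau> k)) has_field_derivative
        D $ i $ j0 * (\<Prod>k\<in>UNIV - {i}. \<gamma> 0 $ k $ \<tau> k)) (at 0)"
      by (simp add: zero)
    moreover have "(\<Prod>k\<in>UNIV. \<gamma> s $ k $ \<tau> k) = \<gamma> s $ i $ j0 * (\<Prod>k\<in>UNIV - {i}. \<gamma> s $ k $ \<tau> k)" for s
      by (subst prod.remove[of _ i]) (simp_all add: i)
    moreover have "(\<Prod>k\<in>UNIV. ?A $ k $ \<tau> k) = D $ i $ j0 * (\<Prod>k\<in>UNIV - {i}. \<gamma> 0 $ k $ \<tau> k)"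
    proof -
      have "(\<Prod>k\<in>UNIV. ?A $ k $ \<tau> k) = ?A $ i $ \<tau> i * (\<Prod>k\<in>UNIV - {i}. ?A $ k $ \<tau> k)"
        by (rule prod.remove) simp_all
      also have "(\<Prod>k\<in>UNIV - {i}. ?A $ k $ \<tau> k) = (\<Prod>k\<in>UNIV - {i}. \<gamma> 0 $ k $ \<tau> k)"
        by (rule prod.cong) (simp_all add: ne)
      finally show ?thesis by (simp add: i)
    qed
    ultimately show ?thesis by simp
  qed
  show ?thesis unfolding det_def
    by (intro DERIV_sum DERIV_cmult prod) simp
qed

lemma card_compl: "card (- S) = CARD('n) - card S" for S :: "'n::finite set"
  by (simp add: Compl_eq_Diff_UNIV card_Diff_subset)

lemma extend_to_permutation:
  fixes \<sigma> :: "'n::finite \<Rightarrow> 'n"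
  assumes "inj_on \<sigma> C"
  obtains \<tau> where "bij \<tau>" "\<And>j. j \<in> C \<Longrightarrow> \<tau> j = \<sigma> j"
proof -
  have "card (- C) = card (- \<sigma> ` C)"
    by (simp add: card_compl card_image[OF assms])
  then obtain h where h: "bij_betw h (- C) (- \<sigma> ` C)"
    using finite_same_card_bij[of "- C" "- \<sigma> ` C"] by auto
  let ?\<tau> = "\<lambda>j. if j \<in> C then \<sigma> j else h j"
  have "bij_betw ?\<tau> C (\<sigma> ` C)"
    using inj_on_imp_bij_betw[OF assms] by (subst bij_betw_cong[where g = \<sigma>]) auto
  moreover have "bij_betw ?\<tau> (- C) (- \<sigma> ` C)"
    using h by (subst bij_betw_cong[where g = h]) auto
  ultimately have "bij_betw ?\<tau> (C \<union> - C) (\<sigma> ` C \<union> - \<sigma> ` C)"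
    by (rule bij_betw_combine) auto
  then have "bij ?\<tau>" by (simp only: Compl_partition)
  then show thesis by (rule that) simp
qed

lemma matrix_axis_nth: "(A *v axis j 1) $ i = (A $ i $ j :: complex)"
  by (simp add: matrix_vector_mult_def axis_def mult_delta_right)

lemma mat_eqI_axis:
  fixes A B :: "complex^'n^'m"
  assumes "\<And>j. A *v axis j 1 = B *v axis j 1"
  shows "A = B"
proof -
  have "A $ i $ j = B $ i $ j" for i j
    using arg_cong[OF assms[of j], of "\<lambda>x. x $ i"] by (simp add: matrix_axis_nth)
  then show ?thesis by (simp add: vec_eq_iff)
qed

text \<open>
  Let \<open>B\<close> be a partial permutation matrix whose column \<open>j0\<close> and row \<open>i0\<close> vanish.  For a suitable
  complementary partial permutation matrix \<open>K\<close>, the function \<open>det (x + K)\<close> vanishes on the matrices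
  equivalent to \<open>B\<close>, and its differential at \<open>B\<close> is the entry \<open>(i0, j0)\<close>.
\<close>

lemma rank_equation:
  fixes B :: "complex^'n^'n"
  assumes B01: "\<And>i j. B $ i $ j \<in> {0, 1}"
    and col: "\<And>i i' j. B $ i $ j \<noteq> 0 \<Longrightarrow> B $ i' $ j \<noteq> 0 \<Longrightarrow> i = i'"
    and row: "\<And>i j j'. B $ i $ j \<noteq> 0 \<Longrightarrow> B $ i $ j' \<noteq> 0 \<Longrightarrow> j = j'"
    and j0: "\<And>i. B $ i $ j0 = 0" and i0: "\<And>j. B $ i0 $ j = 0"
  obtains K where "\<And>g g'. det (g ** B ** g' + K) = 0"
    "\<And>\<gamma> D. mderiv \<gamma> D 0 \<Longrightarrow> \<gamma> 0 = B \<Longrightarrow> D $ i0 $ j0 \<noteq> 0 \<Longrightarrow>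
      \<exists>c. c \<noteq> 0 \<and> ((\<lambda>s. det (\<gamma> s + K)) has_field_derivative c) (at 0)"
proof -
  define C where "C = {j. \<exists>i. B $ i $ j \<noteq> 0}"
  \<comment> \<open>A nonzero column \<open>j\<close> has its only entry in row
    \<open>\<sigma> j\<close>; the zero column \<open>j0\<close> is matched with the zero row
    \<open>i0\<close>.\<close>
  define \<sigma> where "\<sigma> j = (if j = j0 then i0 else (SOME i. B $ i $ j \<noteq> 0))" for j
  have j0_C: "j0 \<notin> C" by (simp add: C_def j0)
  have \<sigma>: "B $ \<sigma> j $ j \<noteq> 0" if "j \<in> C" for j
  proof -
    have "\<exists>i. B $ i $ j \<noteq> 0" using that by (simp add: C_def)
    from someI_ex[OF this] show ?thesis using that j0_C by (auto simp: \<sigma>_def)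
  qed
  have "inj_on \<sigma> (insert j0 C)"
  proof (rule inj_onI)
    fix a b assume ab: "a \<in> insert j0 C" "b \<in> insert j0 C" "\<sigma> a = \<sigma> b"
    have ne: "\<sigma> j \<noteq> \<sigma> j0" if "j \<in> C" for j
      using \<sigma>[OF that] i0 by (auto simp: \<sigma>_def[of j0])
    show "a = b"
    proof (cases "a \<in> C \<and> b \<in> C")
      case True
      then have "B $ \<sigma> a $ a \<noteq> 0" "B $ \<sigma> a $ b \<noteq> 0" using \<sigma>[of a] \<sigma>[of b] ab(3) by simp_all
      then show ?thesis by (rule row)
    next
      case False
      then show ?thesis using ab ne[of a] ne[of b] by auto
    qed
  qed
  then obtain \<tau> where \<tau>: "bij \<tau>" "\<And>j. j \<in> insert j0 C \<Longrightarrow> \<tau> j = \<sigma> j"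
    using extend_to_permutation[of \<sigma> "insert j0 C"] by metis
  have \<tau>_j0: "\<tau> j0 = i0" using \<tau>(2)[of j0] by (simp add: \<sigma>_def)
  have \<tau>_inj: "\<tau> a = \<tau> b \<longleftrightarrow> a = b" for a b using \<tau>(1) by (simp add: bij_def inj_eq)
  define P where "P = ((\<chi> i j. if i = \<tau> j then 1 else 0) :: complex^'n^'n)"
  \<comment> \<open>\<open>K\<close> fills all zero columns of \<open>B\<close> except
    \<open>j0\<close>, so that \<open>B + K\<close> is the permutation matrix \<open>P\<close> with
    column \<open>j0\<close> erased.\<close>
  define K where "K = ((\<chi> i j. if i = \<tau> j \<and> j \<notin> insert j0 C then 1 else 0) :: complex^'n^'n)"
  have B: "B $ i $ j = (if i = \<tau> j \<and> j \<in> C then 1 else 0)" for i j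
  proof (cases "j \<in> C")
    case True
    then have nz: "B $ \<tau> j $ j \<noteq> 0" using \<sigma> \<tau>(2) by simp
    show ?thesis
    proof (cases "B $ i $ j = 0")
      case False
      then have "i = \<tau> j" using nz by (rule col)
      moreover have "B $ i $ j = 1" using B01[of i j] False by blast
      ultimately show ?thesis using True by simp
    next
      case zero: True
      then have "i \<noteq> \<tau> j" using nz by auto
      with zero show ?thesis by simp
    qed
  next
    case False
    then show ?thesis by (simp add: C_def)
  qed
  have BK: "(B + K) $ i $ j = (if j = j0 then 0 else P $ i $ j)" for i j
    using j0_C by (auto simp: B K_def P_def)
  note BK' = BK[unfolded vector_add_component]
  have "P ** (\<chi> i j. if j = \<tau> i then 1 else 0) = mat 1"
  proof -
    have "(\<Sum>k\<in>UNIV. (if i = \<tau> k then 1 else 0) * (if j = \<tau> k then 1 else (0 :: complex))) = (if i = j then 1 else 0)" for i j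
    proof -
      obtain l where l: "i = \<tau> l" using \<tau>(1) by (auto simp: bij_def surj_def)
      show ?thesis by (simp add: l \<tau>_inj mult_delta_left)
    qed
    then show ?thesis by (simp add: vec_eq_iff matrix_mul_nth P_def mat_def)
  qed
  then have det_P: "det P \<noteq> 0" using matrix_inv_eqI(2) invertible_det_nz by blast
  show thesis
  proof (rule that[of K])
    fix g g'
    let ?A = "g ** B ** g' + K"
    \<comment> \<open>Generators for the range of \<open>?A\<close>: one for each nonzero column of
      \<open>B\<close>, moved by \<open>g\<close>, and one for each nonzero column of
      \<open>K\<close>. There are fewer than \<open>CARD('n)\<close>, as \<open>j0\<close> is left
      out.\<close>
    define W where "W = (\<lambda>j. g *v axis (\<tau> j) 1) ` C \<union> (\<lambda>j. axis (\<tau> j) 1) ` (- insert j0 C)"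
    have in_span: "M *v x \<in> vec.span ((\<lambda>j. axis (\<tau> j) 1) ` S)"
      if M: "\<And>i j. M $ i $ j = (if i = \<tau> j \<and> j \<in> S then 1 else 0)" for M :: "complex^'n^'n" and S x
    proof -
      have "(M *v x) $ i = (\<Sum>j\<in>S. x $ j *s (axis (\<tau> j) 1 :: complex^'n)) $ i" for i
      proof -
        have "(M *v x) $ i = (\<Sum>j\<in>UNIV. if j \<in> S then (if i = \<tau> j then 1 else 0) * x $ j else 0)"
          unfolding matrix_vector_mult_def by (auto simp: M intro!: sum.cong)
        also have "\<dots> = (\<Sum>j\<in>S. (if i = \<tau> j then 1 else 0) * x $ j)"
          by (simp add: sum.If_cases)
        also have "\<dots> = (\<Sum>j\<in>S. x $ j *s (axis (\<tau> j) 1 :: complex^'n)) $ i"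
          by (auto simp: axis_def intro!: sum.cong)
        finally show ?thesis .
      qed
      then have "M *v x = (\<Sum>j\<in>S. x $ j *s axis (\<tau> j) 1)" by (simp add: vec_eq_iff)
      then show ?thesis by (auto intro!: vec.span_sum vec.span_scale intro: vec.span_base)
    qed
    have range: "?A *v x \<in> vec.span W" for x
    proof -
      have "B *v (g' *v x) \<in> vec.span ((\<lambda>j. axis (\<tau> j) 1) ` C)" by (rule in_span[OF B])
      then have "g *v (B *v (g' *v x)) \<in> (*v) g ` vec.span ((\<lambda>j. axis (\<tau> j) 1) ` C)" by (rule imageI)
      also have "\<dots> = vec.span ((*v) g ` ((\<lambda>j. axis (\<tau> j) 1) ` C))"
        by (rule matrix_vector_mul_linear_gen[THEN vec.linear_span_image, symmetric])
      also have "\<dots> \<subseteq> vec.span W" unfolding W_def image_image by (intro vec.span_mono) auto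
      finally have "g *v (B *v (g' *v x)) \<in> vec.span W" .
      moreover have "K *v x \<in> vec.span ((\<lambda>j. axis (\<tau> j) 1) ` (- insert j0 C))"
        by (rule in_span) (simp add: K_def)
      then have "K *v x \<in> vec.span W" unfolding W_def by (rule subsetD[OF vec.span_mono, rotated]) auto
      ultimately have "g *v (B *v (g' *v x)) + K *v x \<in> vec.span W" by (rule vec.span_add)
      then show ?thesis by (simp add: matrix_vector_mul_assoc matrix_vector_mult_add_rdistrib matrix_mul_assoc)
    qed
    show "det ?A = 0"
    proof (rule ccontr)
      assume "det ?A \<noteq> 0"
      then have inv: "?A ** matrix_inv ?A = mat 1"
        using matrix_inv_mult(1) invertible_det_nz by blast
      have "x \<in> vec.span W" for x
        using range[of "matrix_inv ?A *v x"] by (simp add: matrix_vector_mul_assoc inv)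
      then have "vec.dim (UNIV :: (complex^'n) set) \<le> card W"
        by (intro vec.dim_le_card) (auto simp: W_def)
      then have "CARD('n) \<le> card W" unfolding vec_dim_card .
      moreover have "card W \<le> card C + card (- insert j0 C)"
        unfolding W_def by (rule order_trans[OF card_Un_le]) (intro add_mono card_image_le finite)
      moreover have "card C + card (- insert j0 C) < CARD('n)"
      proof -
        have "card (insert j0 C) = Suc (card C)" using j0_C by simp
        moreover have "card (insert j0 C) \<le> CARD('n)" by (rule card_mono) simp_all
        ultimately show ?thesis by (simp add: card_compl)
      qed
      ultimately show False by linarith
    qed
  next
    fix \<gamma> D assume \<gamma>: "mderiv \<gamma> D 0" "\<gamma> 0 = B" and D: "D $ i0 $ j0 \<noteq> 0"
    have md: "mderiv (\<lambda>s. \<gamma> s + K) D 0" using mderiv_add[OF \<gamma>(1) mderiv_const[of K]] by simp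
    have z: "(\<gamma> 0 + K) $ i $ j0 = 0" for i unfolding \<gamma>(2) BK by simp
    note d = det_deriv_zero_column[OF md z, unfolded \<gamma>(2)]
    have d: "((\<lambda>s. det (\<gamma> s + K)) has_field_derivative
        det (\<chi> i j. if j = j0 then D $ i $ j0 else (B + K) $ i $ j)) (at 0)" by (rule d)
    have det: "det (\<chi> i j. if j = j0 then D $ i $ j0 else (B + K) $ i $ j) = D $ i0 $ j0 * det P"
    proof -
      \<comment> \<open>Column \<open>j0\<close> of \<open>D\<close> is \<open>P *v ?x\<close>, so
        Cramer's rule turns the determinant into \<open>?x $ j0 * det P\<close>, where
        \<open>\<tau> j0 = i0\<close>.\<close>
      let ?x = "(\<chi> j. D $ \<tau> j $ j0) :: complex^'n"
      have "(P *v ?x) $ i = D $ i $ j0" for i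
      proof -
        obtain l where l: "i = \<tau> l" using \<tau>(1) by (auto simp: bij_def surj_def)
        show ?thesis by (simp add: matrix_vector_mult_def P_def l \<tau>_inj mult_delta_left)
      qed
      then have "det (\<chi> i j. if j = j0 then D $ i $ j0 else (B + K) $ i $ j) =
          det ((\<chi> i j. if j = j0 then (P *v ?x) $ i else P $ i $ j) :: complex^'n^'n)"
        by (intro arg_cong[where f = det]) (simp add: vec_eq_iff BK')
      also note cramer_lemma[of j0 P ?x]
      finally show ?thesis by (simp add: \<tau>_j0)
    qed
    show "\<exists>c. c \<noteq> 0 \<and> ((\<lambda>s. det (\<gamma> s + K)) has_field_derivative c) (at 0)"
      using d[unfolded det] D det_P by (intro exI[of _ "D $ i0 $ j0 * det P"] conjI) simp_all
  qed
qed


text \<open>Injectivity of \<open>f\<close> leaves at most one nonzero entry in each row of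
  \<open>N\<close>, so an entry of a power is the product along a single path.\<close>

lemma superdiagonal_power_entries:
  fixes N :: "complex^'n^'n" and f :: "'n \<Rightarrow> nat"
  assumes f: "inj f" and N01: "\<And>i j. N $ i $ j \<in> {0, 1}"
    and N: "\<And>i j. N $ i $ j \<noteq> 0 \<Longrightarrow> f j = Suc (f i)"
  shows "mpow N k $ i $ j \<in> {0, 1}"
proof (induction k arbitrary: i)
  case 0
  show ?case by (simp add: mat_def)
next
  case (Suc k)
  show ?case
  proof (cases "\<exists>l. N $ i $ l \<noteq> 0")
    case True
    then obtain l where l: "N $ i $ l \<noteq> 0" by blast
    have "N $ i $ m = 0" if "m \<noteq> l" for m
    proof (rule ccontr)
      assume "N $ i $ m \<noteq> 0"
      with N[OF this] N[OF l] have "f m = f l" by simp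
      with that f show False by (simp add: inj_eq)
    qed
    then have "mpow N (Suc k) $ i $ j = (\<Sum>m\<in>{l}. N $ i $ m * mpow N k $ m $ j)"
      unfolding mpow_Suc matrix_mul_nth by (intro sum.mono_neutral_right) auto
    moreover have "N $ i $ l = 1" using N01[of i l] l by blast
    ultimately show ?thesis using Suc.IH[of l] by simp
  next
    case False
    then show ?thesis by (simp add: mpow_Suc matrix_mul_nth)
  qed
qed

lemma axis_images_span:
  fixes B :: "complex^'n^'n" and s :: "complex^'n"
  assumes "\<And>i. i \<notin> R \<Longrightarrow> s $ i = 0" "\<And>i. i \<in> R \<Longrightarrow> B *v axis (h i) 1 = axis i 1"
  shows "\<exists>w. B *v w = s"
proof
  let ?w = "(\<chi> k. \<Sum>i\<in>R. if h i = k then s $ i else 0) :: complex^'n"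
  have "(B *v ?w) $ m = s $ m" for m
  proof -
    have B: "B $ m $ h i = (if m = i then 1 else 0)" if "i \<in> R" for i
      using arg_cong[OF assms(2)[OF that], of "\<lambda>x. x $ m"] by (simp add: matrix_axis_nth) (simp add: axis_def)
    have "(B *v ?w) $ m = (\<Sum>k\<in>UNIV. \<Sum>i\<in>R. B $ m $ k * (if h i = k then s $ i else 0))"
      by (simp add: matrix_vector_mult_def sum_distrib_left)
    also have "\<dots> = (\<Sum>i\<in>R. \<Sum>k\<in>UNIV. B $ m $ k * (if h i = k then s $ i else 0))"
      by (rule sum.swap)
    also have "\<dots> = (\<Sum>i\<in>R. B $ m $ h i * s $ i)"
      by (simp add: mult_delta_right)
    also have "\<dots> = (\<Sum>i\<in>R. if m = i then s $ i else 0)"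
      by (rule sum.cong) (simp_all add: B)
    also have "\<dots> = s $ m" using assms(1)[of m] by simp
    finally show ?thesis .
  qed
  then show "B *v ?w = s" by (simp add: vec_eq_iff)
qed

text \<open>
  A direction annihilating the rank equations splits: following the Jordan chains, the solution
  \<open>y\<close> of \<open>v = y N - N y\<close> is prescribed by its value at the top of each chain, and the constraint
  at the bottom of the chain can be met.
\<close>

lemma superdiagonal_split:
  fixes N v :: "complex^'n^'n" and f :: "'n \<Rightarrow> nat"
  assumes f: "inj f" "\<And>i. f i < CARD('n)" and N01: "\<And>i j. N $ i $ j \<in> {0, 1}"
    and N: "\<And>i j. N $ i $ j \<noteq> 0 \<Longrightarrow> f j = Suc (f i)"
    and v: "\<And>p i j. (\<And>k. mpow N p $ k $ j = 0) \<Longrightarrow> (\<And>k. mpow N p $ i $ k = 0) \<Longrightarrow>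
      pow_deriv N v p $ i $ j = 0"
  shows "\<exists>y. v = y ** N - N ** y"
proof -
  let ?b = "\<lambda>j. axis j 1 :: complex^'n"
  have pow_f: "f j = f i + k" if "mpow N k $ i $ j \<noteq> 0" for i j k
    by (rule mpow_superdiagonal[of N f, OF _ that]) (rule N)
  have pow_col: "mpow N k *v ?b j = ?b i" if nz: "mpow N k $ i $ j \<noteq> 0" for i j k
  proof -
    have "mpow N k $ m $ j = (if m = i then 1 else 0)" for m
    proof (cases "m = i")
      case True
      then show ?thesis using superdiagonal_power_entries[OF f(1) N01 N, of k i j] nz by auto
    next
      case False
      have "mpow N k $ m $ j = 0"
      proof (rule ccontr)
        assume "mpow N k $ m $ j \<noteq> 0"
        from pow_f[OF this] pow_f[OF nz] have "f m = f i" by simp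
        with False f(1) show False by (simp add: inj_eq)
      qed
      with False show ?thesis by simp
    qed
    then show ?thesis by (simp add: vec_eq_iff matrix_axis_nth) (simp add: axis_def)
  qed
  have pow_nz: "mpow N k $ i $ j \<noteq> 0" if "mpow N k *v ?b j = ?b i" for i j k
    using arg_cong[OF that, of "\<lambda>x. x $ i"] by (simp add: matrix_axis_nth)
  have pow_zero: "mpow N k *v ?b j = 0 \<longleftrightarrow> (\<forall>i. mpow N k $ i $ j = 0)" for j k
    by (simp add: vec_eq_iff matrix_axis_nth)
  \<comment> \<open>A zero row \<open>t\<close> means that \<open>?b t\<close> is not in the image
    of \<open>N\<close>: it is the top of a Jordan chain. Each application of \<open>N\<close>
    lowers \<open>f\<close> by one, so \<open>f t - f j\<close> steps lead from the top to
    \<open>?b j\<close>.\<close>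
  have chain: "\<exists>t. (\<forall>l. N $ t $ l = 0) \<and> f j \<le> f t \<and> mpow N (f t - f j) *v ?b t = ?b j" for j
  proof (induction "CARD('n) - f j" arbitrary: j rule: less_induct)
    case less
    show ?case
    proof (cases "\<forall>l. N $ j $ l = 0")
      case True
      then show ?thesis by (intro exI[of _ j]) simp
    next
      case False
      then obtain l where l: "N $ j $ l \<noteq> 0" by blast
      have fl: "f l = Suc (f j)" by (rule N[OF l])
      then have "CARD('n) - f l < CARD('n) - f j" using f(2)[of l] by linarith
      from less[OF this] obtain t where t: "\<forall>l. N $ t $ l = 0" "f l \<le> f t" "mpow N (f t - f l) *v ?b t = ?b l"
        by blast
      have "f t - f j = Suc (f t - f l)" using fl t(2) by simp
      then have "mpow N (f t - f j) *v ?b t = N *v ?b l"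
        by (simp add: mpow_Suc matrix_vector_mul_assoc[symmetric] t(3))
      also have "\<dots> = ?b j" using pow_col[of 1 j l] l by simp
      finally show ?thesis using t fl by (intro exI[of _ t]) simp
    qed
  qed
  then obtain T where T: "\<And>j l. N $ T j $ l = 0" "\<And>j. f j \<le> f (T j)"
    "\<And>j. mpow N (f (T j) - f j) *v ?b (T j) = ?b j"
    by metis
  have uniq: "T i = t" if t: "\<And>l. N $ t $ l = 0" and i: "mpow N a *v ?b t = ?b i" for i t a
  proof -
    have ft: "f t = f i + a" by (rule pow_f[OF pow_nz[OF i]])
    have top: "s = t'" if "mpow N c *v ?b t' = ?b s" and s: "\<And>l. N $ s $ l = 0" for c s t'
    proof (cases c)
      case 0
      then show ?thesis using pow_nz[OF that(1)] by (simp add: mat_def split: if_splits)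
    next
      case (Suc d)
      then have "mpow N c $ s $ t' = 0" by (simp add: mpow_Suc matrix_mul_nth s)
      then show ?thesis using pow_nz[OF that(1)] by simp
    qed
    have step: "s = t'" if s: "\<And>l. N $ s $ l = 0" and "mpow N c *v ?b s = ?b i" "mpow N d *v ?b t' = ?b i" "c \<le> d" for s t' c d
    proof -
      have "?b i = mpow N c *v (mpow N (d - c) *v ?b t')"
        using that(3,4) mpow_add[of N c "d - c"] by (simp add: matrix_vector_mul_assoc)
      moreover have "\<exists>r. mpow N (d - c) $ r $ t' \<noteq> 0"
      proof (rule ccontr)
        assume "\<not> ?thesis"
        then have "mpow N (d - c) *v ?b t' = 0" using pow_zero by blast
        with calculation have "?b i = 0" by simp
        then have "?b i $ i = 0" by simp
        then show False by (simp add: axis_def)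
      qed
      then obtain r where r: "mpow N (d - c) $ r $ t' \<noteq> 0" by blast
      ultimately have "mpow N c *v ?b r = ?b i" using pow_col[OF r] by simp
      then have "f r = f i + c" by (rule pow_f[OF pow_nz])
      moreover have "f s = f i + c" by (rule pow_f[OF pow_nz[OF that(2)]])
      ultimately have "f r = f s" by simp
      then have "r = s" using f(1) by (simp add: inj_eq)
      with pow_col[OF r] have "mpow N (d - c) *v ?b t' = ?b s" by simp
      then show ?thesis using s by (rule top)
    qed
    show ?thesis
    proof (cases "a \<le> f (T i) - f i")
      case True
      show ?thesis by (rule step[OF t i T(3) True, symmetric])
    next
      case False
      show ?thesis by (rule step[OF T(1) T(3) i]) (use False in simp)
    qed
  qed
  \<comment> \<open>For a chain of length \<open>p + 1\<close> with top \<open>t\<close>, pushing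
    \<open>y\<close> through \<open>N\<close> by \<open>y N = N y + v\<close> until
    \<open>?b t\<close> is sent to zero leaves exactly this condition on
    \<open>w = y *v ?b t\<close>.\<close>
  have "\<exists>w. \<forall>p. mpow N p *v ?b t \<noteq> 0 \<longrightarrow> mpow N (Suc p) *v ?b t = 0 \<longrightarrow>
      mpow N (Suc p) *v w + pow_deriv N v (Suc p) *v ?b t = 0" for t
  proof (cases "\<exists>p. mpow N p *v ?b t \<noteq> 0 \<and> mpow N (Suc p) *v ?b t = 0")
    case False
    then show ?thesis by blast
  next
    case True
    then obtain p where p: "mpow N p *v ?b t \<noteq> 0" "mpow N (Suc p) *v ?b t = 0" by blast
    have p_unique: "q = p" if "mpow N q *v ?b t \<noteq> 0" "mpow N (Suc q) *v ?b t = 0" for q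
    proof -
      have zero: "mpow N c *v ?b t = 0" if "mpow N d *v ?b t = 0" "d \<le> c" for c d
        using mpow_add[of N "c - d" d] that by (simp add: matrix_vector_mul_assoc[symmetric])
      show ?thesis using zero[OF p(2), of q] zero[OF that(2), of p] p(1) that(1)
        by (meson not_less_eq_eq order_antisym)
    qed
    let ?B = "mpow N (Suc p)" and ?s = "pow_deriv N v (Suc p) *v ?b t"
    \<comment> \<open>Column \<open>t\<close> of \<open>?B\<close> is zero, and so is every row
      outside \<open>?R\<close>; there the hypothesis on \<open>v\<close> makes \<open>?s\<close>
      vanish. Thus \<open>?s\<close> is supported on \<open>?R\<close> and lies in the image of
      \<open>?B\<close>.\<close>
    let ?R = "{i. \<exists>l. ?B $ i $ l \<noteq> 0}"
    have s_zero: "?s $ i = 0" if "i \<notin> ?R" for i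
    proof -
      have "pow_deriv N v (Suc p) $ i $ t = 0"
        by (rule v) (use that p(2)[unfolded pow_zero] in blast)+
      then show ?thesis by (simp only: matrix_axis_nth)
    qed
    have "\<forall>i\<in>?R. \<exists>l. ?B *v ?b l = ?b i" using pow_col by blast
    from bchoice[OF this] obtain h where h: "\<And>i. i \<in> ?R \<Longrightarrow> ?B *v ?b (h i) = ?b i" by blast
    have "\<exists>w. ?B *v w = - ?s"
    proof (rule axis_images_span)
      show "(- ?s) $ i = 0" if "i \<notin> ?R" for i
        using s_zero[OF that] by (simp only: vector_uminus_component neg_0_equal_iff_equal neg_equal_0_iff_equal)
    qed (rule h)
    then obtain w where w: "?B *v w = - ?s" by (rule exE)
    show ?thesis
    proof (intro exI[of _ w] allI impI)
      fix q assume "mpow N q *v ?b t \<noteq> 0" "mpow N (Suc q) *v ?b t = 0"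
      then have "q = p" by (rule p_unique)
      then show "mpow N (Suc q) *v w + pow_deriv N v (Suc q) *v ?b t = 0"
        using w by (simp only: right_minus_eq left_minus add.left_inverse)
    qed
  qed
  then have "\<forall>t. \<exists>w. \<forall>p. mpow N p *v ?b t \<noteq> 0 \<longrightarrow> mpow N (Suc p) *v ?b t = 0 \<longrightarrow>
      mpow N (Suc p) *v w + pow_deriv N v (Suc p) *v ?b t = 0" by (rule allI)
  from choice[OF this] obtain w where "\<forall>t p. mpow N p *v ?b t \<noteq> 0 \<longrightarrow> mpow N (Suc p) *v ?b t = 0 \<longrightarrow>
      mpow N (Suc p) *v w t + pow_deriv N v (Suc p) *v ?b t = 0" by (rule exE)
  note w = this[rule_format]
  define a where "a j = f (T j) - f j" for j
  \<comment> \<open>The value forced on \<open>y *v ?b j\<close> once \<open>y\<close> takes the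
    value \<open>w (T j)\<close> at the top of the chain.\<close>
  define c where "c j = mpow N (a j) *v w (T j) + pow_deriv N v (a j) *v ?b (T j)" for j
  define y where "y = ((\<chi> i j. c j $ i) :: complex^'n^'n)"
  have y: "y *v ?b j = c j" for j
    by (simp add: vec_eq_iff matrix_axis_nth y_def)
  have Nc: "N *v c j + v *v ?b j =
      mpow N (Suc (a j)) *v w (T j) + pow_deriv N v (Suc (a j)) *v ?b (T j)" for j
    by (simp add: c_def matrix_vector_right_distrib matrix_vector_mul_assoc matrix_vector_mult_add_rdistrib mpow_Suc)
      (simp add: matrix_vector_mul_assoc[symmetric] T(3) a_def)
  have "(y ** N - N ** y) *v ?b j = v *v ?b j" for j
  proof -
    have "y *v (N *v ?b j) = N *v c j + v *v ?b j"
    proof (cases "\<exists>i. N $ i $ j \<noteq> 0")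
      case True
      then obtain i where i: "N $ i $ j \<noteq> 0" by blast
      have Nb: "N *v ?b j = ?b i" using pow_col[of 1 i j] i by simp
      have fj: "f j = Suc (f i)" by (rule N[OF i])
      have "mpow N (Suc (a j)) *v ?b (T j) = ?b i"
        by (simp add: mpow_Suc matrix_vector_mul_assoc[symmetric] T(3) a_def Nb)
      then have "T i = T j" by (rule uniq[OF T(1)])
      moreover have "a i = Suc (a j)" using fj T(2)[of j] calculation by (simp add: a_def)
      ultimately show ?thesis unfolding Nc Nb y by (simp add: c_def)
    next
      case False
      then have Nb: "N *v ?b j = 0" using pow_zero[of 1 j] by simp
      have "mpow N (Suc (a j)) *v ?b (T j) = 0"
        by (simp add: mpow_Suc matrix_vector_mul_assoc[symmetric] T(3) a_def Nb)
      moreover have "mpow N (a j) *v ?b (T j) \<noteq> 0"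
        by (simp add: T(3) a_def axis_eq_0_iff)
      ultimately show ?thesis unfolding Nc Nb using w by simp
    qed
    then show ?thesis
      by (simp add: matrix_vector_mult_diff_rdistrib matrix_vector_mul_assoc[symmetric] y)
  qed
  then have "y ** N - N ** y = v" by (rule mat_eqI_axis)
  then show ?thesis by metis
qed

theorem tangent_of_nilpotent_conjugacy_class:
  fixes e v :: "complex^'n^'n"
  assumes e: "nilpotent_mat e"
    and v: "\<And>f. f \<in> poly_funs mat_coords \<Longrightarrow> (\<And>g. invertible g \<Longrightarrow> f (Ad g e) = 0) \<Longrightarrow> dir_deriv f e v = 0"
  shows "\<exists>y. v = y ** e - e ** y"
proof -
  obtain Q Q' N and f :: "'n \<Rightarrow> nat" where Q: "Q ** Q' = mat 1" "Q' ** Q = mat 1"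
    and e_eq: "e = Q ** N ** Q'" and f: "inj f" "\<And>i. f i < CARD('n)"
    and N01: "\<And>i j. N $ i $ j \<in> {0, 1}" and N: "\<And>i j. N $ i $ j \<noteq> 0 \<Longrightarrow> f j = Suc (f i)"
    by (rule jordan_form_nilpotent[OF e], rule that, assumption+)
  let ?v = "Q' ** v ** Q"
  have conj: "Q' ** (Q ** A ** Q') ** Q = A" "Q ** (Q' ** A ** Q) ** Q' = A" for A
    by (simp_all add: matrix_mul_assoc Q) (simp_all add: matrix_mul_assoc[symmetric] Q)
  have "pow_deriv N ?v p $ i $ j = 0"
    if j: "\<And>k. mpow N p $ k $ j = 0" and i: "\<And>k. mpow N p $ i $ k = 0" for p i j
  proof (rule ccontr)
    assume nz: "pow_deriv N ?v p $ i $ j \<noteq> 0"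
    have pow_f: "f l = f k + p" if "mpow N p $ k $ l \<noteq> 0" for k l
      by (rule mpow_superdiagonal[of N f, OF _ that]) (rule N)
    have col: "k = k'" if "mpow N p $ k $ l \<noteq> 0" "mpow N p $ k' $ l \<noteq> 0" for k k' l
    proof (rule injD[OF f(1)])
      show "f k = f k'" using pow_f[OF that(1)] pow_f[OF that(2)] by simp
    qed
    have row: "l = l'" if "mpow N p $ k $ l \<noteq> 0" "mpow N p $ k $ l' \<noteq> 0" for k l l'
    proof (rule injD[OF f(1)])
      show "f l = f l'" using pow_f[OF that(1)] pow_f[OF that(2)] by simp
    qed
    obtain K where K: "\<And>g g'. det (g ** mpow N p ** g' + K) = 0"
      "\<And>\<gamma> D. mderiv \<gamma> D 0 \<Longrightarrow> \<gamma> 0 = mpow N p \<Longrightarrow> D $ i $ j \<noteq> 0 \<Longrightarrow>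
        \<exists>c. c \<noteq> 0 \<and> ((\<lambda>s. det (\<gamma> s + K)) has_field_derivative c) (at 0)"
      by (rule rank_equation[OF superdiagonal_power_entries[OF f(1) N01 N] col row j i], assumption+, rule that, assumption+)
    \<comment> \<open>The \<open>p\<close>-th power of a conjugate of \<open>N\<close> is equivalent
      to \<open>N^p\<close>, so this equation holds on the whole class; \<open>nz\<close> makes its
      derivative along \<open>v\<close> nonzero.\<close>
    let ?f = "\<lambda>x. det (mpow (Q' ** x ** Q) p + K)"
    have poly: "?f \<in> poly_funs mat_coords"
      by (intro poly_map_det poly_map_add poly_map_const poly_map_mpow poly_map_sandwich)
    have "dir_deriv ?f e v = 0"
    proof (rule v[OF poly])
      fix g :: "complex^'n^'n" assume g: "invertible g"
      have "mpow (Q' ** Ad g e ** Q) p = (Q' ** g ** Q) ** mpow N p ** (Q' ** matrix_inv g ** Q)"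
      proof -
        have "(Q' ** g ** Q) ** (Q' ** matrix_inv g ** Q) = mat 1"
          using conj_mult[OF Q(1)] matrix_inv_mult(1)[OF g] Q(2) by simp
        moreover from this have "(Q' ** matrix_inv g ** Q) ** (Q' ** g ** Q) = mat 1"
          by (rule matrix_left_right_inverse[THEN iffD1])
        moreover have "Q' ** Ad g e ** Q = (Q' ** g ** Q) ** N ** (Q' ** matrix_inv g ** Q)"
          by (simp add: Ad_def e_eq matrix_mul_assoc)
        ultimately show ?thesis by (simp add: mpow_conj)
      qed
      then show "?f (Ad g e) = 0" using K(1) by simp
    qed
    moreover obtain c where "c \<noteq> 0"
      "((\<lambda>s. det (mpow (N + cscale s ?v) p + K)) has_field_derivative c) (at 0)"
      using K(2)[OF mderiv_mpow _ nz] by auto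
    moreover have "dir_deriv ?f e v = deriv (\<lambda>s. det (mpow (N + cscale s ?v) p + K)) 0"
    proof -
      have "Q' ** (e + cscale s v) ** Q = N + cscale s ?v" for s
        by (simp add: mat_distrib e_eq conj)
      then show ?thesis by (simp add: dir_deriv_def)
    qed
    ultimately show False by (simp add: DERIV_imp_deriv)
  qed
  from superdiagonal_split[OF f N01 N this] obtain y where y: "?v = y ** N - N ** y" by blast
  have "v = Q ** ?v ** Q'" by (simp add: conj)
  also have "\<dots> = (Q ** y ** Q') ** e - e ** (Q ** y ** Q')"
    unfolding y e_eq conj_mult[OF Q(2)] by (simp add: mat_distrib)
  finally show ?thesis by blast
qed

section \<open>Nilpotent orbits of reductive groups\<close>

text \<open>Duality in the space of all matrices: a \<open>z\<close> orthogonal to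
  \<open>[e, g]\<close> and to the orthogonal of \<open>g\<close> lies in \<open>g\<close>, and
  commutes with \<open>e\<close> by invariance and nondegeneracy, so it is orthogonal to
  \<open>v\<close>. Thus \<open>v\<close> differs from some \<open>[e, y]\<close> by an element of
  \<open>g\<close> orthogonal to \<open>g\<close>, which is 0.\<close>

lemma trace_perp_centralizer_imp_bracket:
  fixes G :: "(complex^'n^'n) set"
  assumes red: "reductive_group G" and e: "e \<in> Lie G" and v: "v \<in> Lie G"
    and perp: "\<And>z. z \<in> Lie G \<Longrightarrow> e ** z = z ** e \<Longrightarrow> trace (v ** z) = 0"
  shows "v \<in> lie_bracket e ` Lie G"
proof -
  have G: "algebraic_group G" using red by (simp add: reductive_group_def)
  note sub = Lie_subspace[OF G]
  \<comment> \<open>The sum of \<open>[e, Lie G]\<close> and the orthogonal of \<open>Lie G\<close>;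
    the second summand forces a separating \<open>z\<close> into \<open>Lie G\<close>.\<close>
  define T where "T = {t. \<exists>y\<in>Lie G. \<forall>z\<in>Lie G. trace (z ** (t - lie_bracket e y)) = 0}"
  have TI: "t \<in> T" if "y \<in> Lie G" "\<And>z. z \<in> Lie G \<Longrightarrow> trace (z ** (t - lie_bracket e y)) = 0" for t y
    using that by (auto simp: T_def)
  have "cs.subspace T"
  proof (rule cs.subspaceI)
    show "0 \<in> T" by (rule TI[OF cs.subspace_0[OF sub]]) (simp add: lie_bracket_linear)
    fix a assume "a \<in> T"
    then obtain y where a: "y \<in> Lie G" "\<And>z. z \<in> Lie G \<Longrightarrow> trace (z ** (a - lie_bracket e y)) = 0"
      by (auto simp: T_def)
    {
      fix b assume "b \<in> T"
      then obtain y' where b: "y' \<in> Lie G" "\<And>z. z \<in> Lie G \<Longrightarrow> trace (z ** (b - lie_bracket e y')) = 0"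
        by (auto simp: T_def)
      show "a + b \<in> T"
      proof (rule TI[OF cs.subspace_add[OF sub a(1) b(1)]])
        fix z assume z: "z \<in> Lie G"
        have "a + b - lie_bracket e (y + y') = (a - lie_bracket e y) + (b - lie_bracket e y')"
          by (simp add: lie_bracket_linear)
        then show "trace (z ** (a + b - lie_bracket e (y + y'))) = 0"
          using a(2)[OF z] b(2)[OF z] by (simp only: matrix_add_distrib trace_add add_0_left)
      qed
    }
    fix c
    show "cscale c a \<in> T"
    proof (rule TI[OF cs.subspace_scale[OF sub a(1)]])
      fix z assume z: "z \<in> Lie G"
      have "cscale c a - lie_bracket e (cscale c y) = cscale c (a - lie_bracket e y)"
        by (simp add: lie_bracket_linear mat_distrib)
      then show "trace (z ** (cscale c a - lie_bracket e (cscale c y))) = 0"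
        using a(2)[OF z] by (simp only: cscale_mult_right trace_cscale mult_zero_right)
    qed
  qed
  have "v \<in> T"
  proof (rule ccontr)
    assume "v \<notin> T"
    obtain z where z: "\<And>t. t \<in> T \<Longrightarrow> trace (z ** t) = 0" "trace (z ** v) \<noteq> 0"
      by (rule trace_separation[OF \<open>cs.subspace T\<close> \<open>v \<notin> T\<close>], rule that, assumption+)
    have "z \<in> Lie G"
    proof (rule ccontr)
      assume "z \<notin> Lie G"
      obtain w where w: "\<And>s. s \<in> Lie G \<Longrightarrow> trace (w ** s) = 0" "trace (w ** z) \<noteq> 0"
        by (rule trace_separation[OF sub \<open>z \<notin> Lie G\<close>], rule that, assumption+)
      have "w \<in> T"
      proof (rule TI[OF cs.subspace_0[OF sub]])
        fix s assume "s \<in> Lie G"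
        then show "trace (s ** (w - lie_bracket e 0)) = 0"
          using w(1) trace_mul_sym[of s w] by (simp add: lie_bracket_linear)
      qed
      then show False using z(1)[of w] w(2) trace_mul_sym[of w z] by simp
    qed
    have bracket: "trace (z ** lie_bracket e y) = 0" if "y \<in> Lie G" for y
      by (rule z(1), rule TI[OF that]) simp
    have "lie_bracket z e = 0"
    proof (rule trace_form_nondegenerate[OF red])
      show "lie_bracket z e \<in> Lie G" by (rule Lie_bracket_closed[OF G \<open>z \<in> Lie G\<close> e])
      show "trace (lie_bracket z e ** Y) = 0" if "Y \<in> Lie G" for Y
        using bracket[OF that] by (simp add: trace_bracket)
    qed
    then have "e ** z = z ** e" by (simp add: lie_bracket_def)
    then have "trace (v ** z) = 0" by (rule perp[OF \<open>z \<in> Lie G\<close>])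
    then show False using z(2) trace_mul_sym[of v z] by simp
  qed
  then obtain y where y: "y \<in> Lie G" "\<And>z. z \<in> Lie G \<Longrightarrow> trace (z ** (v - lie_bracket e y)) = 0"
    by (auto simp: T_def)
  have "v - lie_bracket e y = 0"
  proof (rule trace_form_nondegenerate[OF red])
    show "v - lie_bracket e y \<in> Lie G"
      by (rule cs.subspace_diff[OF sub v Lie_bracket_closed[OF G e y(1)]])
    show "trace ((v - lie_bracket e y) ** Y) = 0" if "Y \<in> Lie G" for Y
      using y(2)[OF that] trace_mul_sym[of Y "v - lie_bracket e y"] by simp
  qed
  then show ?thesis using y(1) by auto
qed

lemma nilpotent_commuting_trace:
  "nilpotent_mat e \<Longrightarrow> e ** z = z ** e \<Longrightarrow> trace (e ** z) = 0"
  by (rule trace_nilpotent[OF nilpotent_mult_commuting])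

text \<open>If \<open>z\<close> commutes with \<open>e\<close> then \<open>e ** z\<close> is
  nilpotent, so \<open>e\<close> is orthogonal to its own centralizer and equals some
  \<open>[e, y]\<close>; take \<open>h = - y\<close>.\<close>

lemma nilpotent_grading:
  assumes red: "reductive_group G" and e: "e \<in> Lie G" "nilpotent_mat e"
  obtains h where "h \<in> Lie G" "lie_bracket h e = e"
proof -
  have G: "algebraic_group G" using red by (simp add: reductive_group_def)
  have "e \<in> lie_bracket e ` Lie G"
    by (rule trace_perp_centralizer_imp_bracket[OF red e(1) e(1)]) (rule nilpotent_commuting_trace[OF e(2)])
  then obtain y where "y \<in> Lie G" "e = lie_bracket e y" by auto
  then show thesis
    using that[of "- y"] cs.subspace_neg[OF Lie_subspace[OF G], of y] by (simp add: lie_bracket_def)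
qed

lemma nilpotent_scaling:
  assumes red: "reductive_group G" and e: "e \<in> Lie G" "nilpotent_mat e" and t: "t \<noteq> 0"
  obtains g where "g \<in> G" "Ad g e = cscale t e"
proof -
  have G: "algebraic_group G" using red by (simp add: reductive_group_def)
  obtain h where h: "h \<in> Lie G" "lie_bracket h e = e" by (rule nilpotent_grading[OF red e], rule that, assumption+)
  obtain c where c: "c 0 = mat 1" "\<And>t. c t \<in> G" "\<And>t. mderiv c (h ** c t) t"
    "\<And>t. c t ** h = h ** c t" "\<And>t. matrix_inv (c t) = c (- t)"
    by (rule Lie_exp[OF G h(1)], rule that, assumption+)
  have "mderiv (\<lambda>s. cscale (exp (- s)) (Ad (c s) e)) 0 s" for s
  proof -
    have "((\<lambda>s. exp (- s)) has_field_derivative - exp (- s)) (at s)"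
      by (auto intro!: derivative_eq_intros)
    from mderiv_cscale[OF this Lie_exp_Ad_deriv[OF c(3-5), of e s]]
    show ?thesis by (simp add: h(2) cs.scale_minus_left)
  qed
  from mderiv_zero_constant[of "\<lambda>s. cscale (exp (- s)) (Ad (c s) e)", OF this, of "Ln t"]
  have "cscale (exp (- Ln t)) (Ad (c (Ln t)) e) = e" by (simp add: c(1))
  then have "cscale t (cscale (inverse t) (Ad (c (Ln t)) e)) = cscale t e"
    using t by (simp add: exp_minus)
  then have "Ad (c (Ln t)) e = cscale t e" using t by simp
  then show thesis by (rule that[OF c(2)])
qed

lemma poly_zero_if_zero_off_zero:
  assumes "\<And>t. t \<noteq> 0 \<Longrightarrow> poly p t = (0 :: complex)"
  shows "p = 0"
proof -
  have "poly ([:0, 1:] * p) t = 0" for t using assms[of t] by (cases "t = 0") simp_all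
  then have "[:0, 1:] * p = 0" using poly_all_0_iff_0 by blast
  then show ?thesis by simp
qed

lemma dir_deriv_trace: "dir_deriv (\<lambda>x. trace (z ** x)) a v = trace (z ** v)"
  unfolding dir_deriv_def by (rule DERIV_imp_deriv[OF mderiv_trace[OF mderiv_line]])

lemma poly_funs_trace: "(\<lambda>x. trace (z ** x)) \<in> poly_funs mat_coords"
  by (intro poly_map_trace poly_map_mult poly_map_id poly_map_const)

text \<open>Elements \<open>c\<close> of the span of \<open>[a, L]\<close> are nilpotent:
  \<open>trace ([y, x] c^k) = trace (y [x, c^k])\<close> vanishes because \<open>x\<close> and
  \<open>c\<close> lie in the abelian \<open>a\<close>. Engel's theorem gives a filtration, and
  \<open>w\<close> preserves it since \<open>w u = u w - [u, w]\<close>; hence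
  \<open>[x, y] w\<close> is nilpotent. With a nondegenerate trace form this makes abelian ideals
  central.\<close>

lemma abelian_ideal_trace:
  fixes L :: "(complex^'n^'n) set"
  assumes a: "cs.subspace a" "a \<subseteq> L" "\<And>y x. y \<in> L \<Longrightarrow> x \<in> a \<Longrightarrow> lie_bracket y x \<in> a"
    and abelian: "\<And>x x'. x \<in> a \<Longrightarrow> x' \<in> a \<Longrightarrow> lie_bracket x x' = 0"
    and x: "x \<in> a" and y: "y \<in> L" and w: "w \<in> L"
  shows "trace (lie_bracket x y ** w) = 0"
proof -
  define S where "S = {lie_bracket x y | x y. x \<in> a \<and> y \<in> L}"
  have S_a: "S \<subseteq> a"
  proof
    fix s assume "s \<in> S"
    then obtain x y where "s = lie_bracket x y" "x \<in> a" "y \<in> L" by (auto simp: S_def)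
    then show "s \<in> a" using cs.subspace_neg[OF a(1) a(3), of y x] lie_bracket_skew[of x y] by simp
  qed
  have b_a: "cs.span S \<subseteq> a" by (rule cs.span_minimal[OF S_a a(1)])
  have comm: "x ** x' = x' ** x" if "x \<in> a" "x' \<in> a" for x x'
    using abelian[OF that] by (simp add: lie_bracket_def)
  have nil: "nilpotent_mat c" if c: "c \<in> cs.span S" for c
  proof (rule nilpotent_if_traces_zero)
    have "trace (d ** mpow c k) = 0" if "d \<in> cs.span S" for d k
      using that
    proof (induction rule: cs.span_induct)
      case base
      show ?case by (simp add: cs.subspace_def matrix_add_distrib trace_add)
    next
      case (step d)
      then obtain x y where d: "d = lie_bracket x y" "x \<in> a" by (auto simp: S_def)
      have "c ** x = x ** c" by (rule comm) (use b_a c d in auto)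
      then have "lie_bracket x (mpow c k) = 0" using mpow_commute[of c x k] by (simp add: lie_bracket_def)
      then have "trace (lie_bracket y x ** mpow c k) = 0" by (simp add: trace_bracket)
      moreover have "d ** mpow c k = - (lie_bracket y x ** mpow c k)"
        unfolding d(1) lie_bracket_skew[of x y] by simp
      ultimately show ?case by (simp add: trace_def sum_negf)
    qed
    from this[OF c] show "trace (mpow c k) = 0" if "k > 0" for k
      using that by (cases k) (simp_all add: mpow_Suc)
  qed
  have "lie_bracket u v \<in> cs.span S" if uv: "u \<in> cs.span S" "v \<in> cs.span S" for u v
    using abelian[OF subsetD[OF b_a uv(1)] subsetD[OF b_a uv(2)]] cs.span_zero[of S] by simp
  from engel[OF cs.subspace_span this nil] obtain m where m: "left_products (cs.span S) m = {0}" by (rule exE)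
  have gen: "lie_bracket u v \<in> cs.span S" if "u \<in> a" "v \<in> L" for u v
    using that by (auto simp: S_def intro: cs.span_base)
  show ?thesis
  proof (rule trace_nilpotent, rule nilpotent_of_left_products[OF m gen[OF x y]])
    fix j z assume "z \<in> left_products (cs.span S) j"
    then show "w ** z \<in> left_products (cs.span S) j"
    proof (rule left_products_stable[rotated])
      fix u assume u: "u \<in> cs.span S"
      have "w ** u = u ** w + - lie_bracket u w" by (simp add: lie_bracket_def)
      moreover have "- lie_bracket u w \<in> cs.span S"
        using gen[OF subsetD[OF b_a u] w] by (rule cs.span_neg)
      ultimately show "\<exists>x'\<in>cs.span S. \<exists>x''\<in>cs.span S. w ** u = x' ** w + x''"
        by (intro bexI[OF _ u] bexI[of _ "- lie_bracket u w"])
    qed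
  qed
qed

lemma derived_series_ideal:
  assumes R: "lie_ideal L R"
  shows "lie_ideal L (derived_series R k)"
proof (induction k)
  case 0
  then show ?case using R by simp
next
  case (Suc k)
  let ?D = "derived_series R k" and ?S = "{lie_bracket x y | x y. x \<in> derived_series R k \<and> y \<in> derived_series R k}"
  have D: "cs.subspace ?D" "?D \<subseteq> L" "\<And>x y. x \<in> L \<Longrightarrow> y \<in> ?D \<Longrightarrow> lie_bracket x y \<in> ?D"
    using Suc by (auto simp: lie_ideal_def)
  have sub: "cs.span ?S \<subseteq> ?D"
    by (rule cs.span_minimal[OF _ D(1)]) (use D in auto)
  have "lie_bracket x y \<in> cs.span ?S" if x: "x \<in> L" and y: "y \<in> cs.span ?S" for x y
    using y
  proof (induction rule: cs.span_induct)
    case base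
    show ?case by (simp add: cs.subspace_def lie_bracket_linear cs.span_zero cs.span_add cs.span_scale)
  next
    case (step y)
    then obtain u v where y: "y = lie_bracket u v" "u \<in> ?D" "v \<in> ?D" by auto
    have "lie_bracket (lie_bracket x u) v \<in> ?S" "lie_bracket u (lie_bracket x v) \<in> ?S"
      using D(3)[OF x] y(2,3) by auto
    then show ?case unfolding y(1) lie_bracket_jacobi[of x] by (intro cs.span_add cs.span_base)
  qed
  then show ?case using sub D(2) by (auto simp: lie_ideal_def)
qed

section \<open>The orbit, its tangent spaces and its linear span\<close>

locale reductive_nilpotent_orbit =
  fixes G Orb :: "(complex^'n^'n) set" and e :: "complex^'n^'n"
  assumes red: "reductive_group G" and e: "e \<in> Lie G" "nilpotent_mat e"
    and Orb: "Orb = {Ad g e | g. g \<in> G}"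
begin

lemma G: "algebraic_group G"
  using red by (simp add: reductive_group_def)

lemma orbit_base:
  assumes "x \<in> Orb"
  shows "x \<in> Lie G" "nilpotent_mat x" "g \<in> G \<Longrightarrow> Ad g x \<in> Orb"
proof -
  obtain h where h: "h \<in> G" "x = Ad h e" using assms by (auto simp: Orb)
  note inv = algebraic_group_invertible[OF G]
  show "x \<in> Lie G" unfolding h(2) by (rule Lie_Ad[OF G h(1) e(1)])
  show "nilpotent_mat x"
    unfolding h(2) Ad_def by (rule nilpotent_conj[OF e(2) matrix_inv_mult(2,1)[OF inv[OF h(1)]]])
  show "Ad g x \<in> Orb" if g: "g \<in> G"
    unfolding h(2) Ad_Ad[OF inv[OF g] inv[OF h(1)]]
    using algebraic_group_mult[OF G g h(1)] by (auto simp: Orb)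
qed

lemma e_in_orbit: "e \<in> Orb"
  using algebraic_group_one[OF G] by (auto simp: Orb intro!: exI[of _ "mat 1"])

lemma orbit_cone: "x \<in> Orb \<Longrightarrow> t \<noteq> 0 \<Longrightarrow> cscale t x \<in> Orb"
  using nilpotent_scaling[OF red orbit_base(1,2), of x t] orbit_base(3)[of x] by metis

lemma orbit_bracket:
  assumes "x \<in> Orb"
  obtains h where "h \<in> Lie G" "lie_bracket h x = x"
  by (rule nilpotent_grading[OF red orbit_base(1,2)[OF assms]], rule that, assumption+)

theorem orbit_tangent:
  assumes x: "x \<in> Orb"
  shows "(\<forall>f\<in>vanishing Orb. dir_deriv f x v = 0) \<longleftrightarrow> v \<in> lie_bracket x ` Lie G"
proof
  assume "v \<in> lie_bracket x ` Lie G"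
  then obtain y where y: "y \<in> Lie G" "v = lie_bracket x y" by auto
  show "\<forall>f\<in>vanishing Orb. dir_deriv f x v = 0"
  proof
    fix f assume f: "f \<in> vanishing Orb"
    obtain c where c: "c 0 = mat 1" "\<And>t. c t \<in> G" "\<And>t. mderiv c (y ** c t) t"
      "\<And>t. c t ** y = y ** c t" "\<And>t. matrix_inv (c t) = c (- t)"
      by (rule Lie_exp[OF G y(1)], rule that, assumption+)
    have "((\<lambda>t. f (Ad (c t) x)) has_field_derivative dir_deriv f (Ad (c 0) x) (Ad (c 0) (lie_bracket y x))) (at 0)"
      by (rule dir_deriv_chain[OF vanishing_poly[OF f] Lie_exp_Ad_deriv[OF c(3-5)]])
    moreover have "f (Ad (c t) x) = 0" for t
      by (rule vanishing_zero[OF f orbit_base(3)[OF x c(2)]])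
    ultimately have "((\<lambda>t. 0) has_field_derivative dir_deriv f x (lie_bracket y x)) (at 0)" by (simp add: c(1))
    from DERIV_unique[OF this DERIV_const] have "dir_deriv f x (lie_bracket y x) = 0" .
    moreover have "v = cscale (- 1) (lie_bracket y x)" using y(2) lie_bracket_skew[of x y] by simp
    ultimately show "dir_deriv f x v = 0" by (simp only: dir_deriv_cscale[OF vanishing_poly[OF f]] mult_zero_right)
  qed
next
  assume v: "\<forall>f\<in>vanishing Orb. dir_deriv f x v = 0"
  \<comment> \<open>The linear equations of \<open>Lie G\<close> are among the equations of the
    orbit.\<close>
  have "v \<in> Lie G"
  proof (rule ccontr)
    assume "v \<notin> Lie G"
    obtain z where z: "\<And>s. s \<in> Lie G \<Longrightarrow> trace (z ** s) = 0" "trace (z ** v) \<noteq> 0"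
      by (rule trace_separation[OF Lie_subspace[OF G] \<open>v \<notin> Lie G\<close>], rule that, assumption+)
    have "(\<lambda>x. trace (z ** x)) \<in> vanishing Orb"
      by (rule vanishingI[OF poly_funs_trace z(1)[OF orbit_base(1)]])
    with v z(2) show False by (auto simp: dir_deriv_trace)
  qed
  \<comment> \<open>Equations of the full conjugacy class of \<open>x\<close> vanish on the orbit,
    so \<open>v\<close> is tangent to that class too.\<close>
  moreover have "\<exists>y. v = y ** x - x ** y"
  proof (rule tangent_of_nilpotent_conjugacy_class[OF orbit_base(2)[OF x]])
    fix f assume f: "f \<in> poly_funs mat_coords" and zero: "\<And>g. invertible g \<Longrightarrow> f (Ad g x) = 0"
    obtain h where h: "h \<in> G" "x = Ad h e" using x by (auto simp: Orb)
    note inv = algebraic_group_invertible[OF G]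
    have "f b = 0" if b: "b \<in> Orb" for b
    proof -
      obtain g where g: "g \<in> G" "b = Ad g e" using b by (auto simp: Orb)
      have "g ** matrix_inv h \<in> G" by (intro algebraic_group_mult[OF G] algebraic_group_inv[OF G] g h)
      from zero[OF inv[OF this]] have "f (Ad (g ** matrix_inv h) x) = 0" .
      moreover have "Ad (g ** matrix_inv h) x = b"
        unfolding Ad_Ad[OF inv[OF g(1)] inv[OF algebraic_group_inv[OF G h(1)]], symmetric]
        by (simp add: h(2) g(2) Ad_inv_cancel(1)[OF inv[OF h(1)]])
      ultimately show ?thesis by simp
    qed
    from vanishingI[OF f this] show "dir_deriv f x v = 0" using v by blast
  qed
  then obtain y where y: "v = y ** x - x ** y" by blast
  \<comment> \<open>Being a commutator with \<open>x\<close> makes \<open>v\<close> orthogonal to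
    everything that commutes with \<open>x\<close>.\<close>
  ultimately show "v \<in> lie_bracket x ` Lie G"
  proof (intro trace_perp_centralizer_imp_bracket[OF red orbit_base(1)[OF x]])
    fix z assume z: "x ** z = z ** x"
    have "trace (v ** z) = trace (y ** (x ** z)) - trace (x ** y ** z)"
      by (simp add: y mat_distrib trace_sub matrix_mul_assoc)
    also have "trace (y ** (x ** z)) = trace (x ** y ** z)"
      unfolding z using trace_cyclic[of x y z] by (simp add: matrix_mul_assoc)
    finally show "trace (v ** z) = 0" by simp
  qed
qed

abbreviation orbit_span :: "(complex^'n^'n) set"
  where "orbit_span \<equiv> cs.span Orb"

text \<open>An equation of the cone vanishes on every line through 0 and a point of
  \<open>Orb\<close>, so its differential at 0 kills the orbit and hence its span. Conversely,
  linear forms that vanish on the span are themselves equations of the orbit.\<close>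

theorem cone_tangent:
  "(\<forall>f\<in>vanishing Orb. f 0 = 0 \<and> dir_deriv f 0 v = 0) \<longleftrightarrow> v \<in> orbit_span"
proof
  assume v: "\<forall>f\<in>vanishing Orb. f 0 = 0 \<and> dir_deriv f 0 v = 0"
  show "v \<in> orbit_span"
  proof (rule ccontr)
    assume "v \<notin> orbit_span"
    obtain z where z: "\<And>s. s \<in> orbit_span \<Longrightarrow> trace (z ** s) = 0" "trace (z ** v) \<noteq> 0"
      by (rule trace_separation[OF cs.subspace_span \<open>v \<notin> orbit_span\<close>], rule that, assumption+)
    have "(\<lambda>x. trace (z ** x)) \<in> vanishing Orb"
      by (rule vanishingI[OF poly_funs_trace z(1)[OF cs.span_base]])
    with v z(2) show False by (auto simp: dir_deriv_trace)
  qed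
next
  assume v: "v \<in> orbit_span"
  show "\<forall>f\<in>vanishing Orb. f 0 = 0 \<and> dir_deriv f 0 v = 0"
  proof
    fix f assume f: "f \<in> vanishing Orb"
    note poly = vanishing_poly[OF f]
    have line: "f (cscale t x) = 0" if x: "x \<in> Orb" for x t
    proof -
      obtain p where p: "\<And>t. f (0 + cscale t x) = poly p t"
        using poly_funs_line[OF poly] by blast
      have "poly p t = 0" if "t \<noteq> 0" for t
        using p[of t] vanishing_zero[OF f orbit_cone[OF x that]] by simp
      then have "p = 0" using poly_zero_if_zero_off_zero by blast
      then show ?thesis using p[of t] by simp
    qed
    have "dir_deriv f 0 v = 0" using v
    proof (induction rule: cs.span_induct)
      case base
      have "dir_deriv f 0 0 = 0" by (simp add: dir_deriv_def)
      then show ?case by (simp add: cs.subspace_def dir_deriv_add[OF poly] dir_deriv_cscale[OF poly])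
    next
      case (step x)
      then show ?case by (simp add: dir_deriv_def line)
    qed
    moreover have "f 0 = 0" using line[OF e_in_orbit, of 0] by simp
    ultimately show "f 0 = 0 \<and> dir_deriv f 0 v = 0" by simp
  qed
qed

lemma orbit_span_Lie: "orbit_span \<subseteq> Lie G"
  by (rule cs.span_minimal[OF _ Lie_subspace[OF G]]) (use orbit_base(1) in blast)

lemma orbit_span_Ad:
  assumes g: "g \<in> G" and x: "x \<in> orbit_span"
  shows "Ad g x \<in> orbit_span"
  using x
proof (induction rule: cs.span_induct)
  case base
  show ?case by (simp add: cs.subspace_def Ad_add Ad_cscale cs.span_zero cs.span_add cs.span_scale)
next
  case (step x)
  then show ?case by (intro cs.span_base orbit_base(3) g)
qed

lemma orbit_span_bracket: "y \<in> Lie G \<Longrightarrow> x \<in> orbit_span \<Longrightarrow> lie_bracket y x \<in> orbit_span"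
  by (rule Ad_stable_imp_ad_stable[OF G cs.subspace_span orbit_span_Ad])

text \<open>The radical of the restricted form is an ideal of \<open>Lie G\<close>; by invariance it
  is abelian, hence central. A central \<open>x\<close> satisfies
  \<open>trace (d x^k) = trace (h [d, x^k]) = 0\<close> for \<open>d = [h, d]\<close> in the orbit,
  so an \<open>x\<close> in the span is nilpotent. A nilpotent central element is orthogonal to all
  of \<open>Lie G\<close>.\<close>

lemma orbit_span_nondegenerate:
  assumes x: "x \<in> orbit_span" "\<And>t. t \<in> orbit_span \<Longrightarrow> trace (x ** t) = 0"
  shows "x = 0"
proof -
  define a where "a = {x \<in> orbit_span. \<forall>t\<in>orbit_span. trace (x ** t) = 0}"
  have sub: "cs.subspace a"
    by (auto simp: a_def cs.subspace_def cs.span_zero cs.span_add cs.span_scale matrix_add_distrib trace_add)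
  have ideal: "lie_bracket y x \<in> a" if y: "y \<in> Lie G" and x: "x \<in> a" for y x
  proof -
    have x': "x \<in> orbit_span" "\<And>t. t \<in> orbit_span \<Longrightarrow> trace (x ** t) = 0" using x by (auto simp: a_def)
    have "trace (lie_bracket y x ** t) = 0" if t: "t \<in> orbit_span" for t
    proof -
      have "trace (lie_bracket x y ** t) = 0"
        unfolding trace_bracket by (rule x'(2)[OF orbit_span_bracket[OF y t]])
      then show ?thesis unfolding lie_bracket_skew[of y x] by (simp add: trace_def sum_negf)
    qed
    then show ?thesis using orbit_span_bracket[OF y x'(1)] by (simp add: a_def)
  qed
  have a_Lie: "a \<subseteq> Lie G" using orbit_span_Lie by (auto simp: a_def)
  have abelian: "lie_bracket x x' = 0" if x: "x \<in> a" and x': "x' \<in> a" for x x'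
  proof (rule trace_form_nondegenerate[OF red])
    show "lie_bracket x x' \<in> Lie G" by (rule subsetD[OF a_Lie ideal[OF subsetD[OF a_Lie x] x']])
    fix Y assume Y: "Y \<in> Lie G"
    have "lie_bracket x' Y \<in> a"
      using cs.subspace_neg[OF sub ideal[OF Y x']] lie_bracket_skew[of x' Y] by simp
    then show "trace (lie_bracket x x' ** Y) = 0"
      unfolding trace_bracket using x by (auto simp: a_def)
  qed
  have "x \<in> a" using x by (simp add: a_def)
  have comm: "x ** y = y ** x" if y: "y \<in> Lie G" for y
  proof -
    have "lie_bracket x y = 0"
    proof (rule trace_form_nondegenerate[OF red])
      show "lie_bracket x y \<in> Lie G" by (rule Lie_bracket_closed[OF G subsetD[OF a_Lie \<open>x \<in> a\<close>] y])
      show "trace (lie_bracket x y ** Y) = 0" if "Y \<in> Lie G" for Y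
        by (rule abelian_ideal_trace[OF sub a_Lie ideal abelian \<open>x \<in> a\<close> y that])
    qed
    then show ?thesis by (simp add: lie_bracket_def)
  qed
  have "nilpotent_mat x"
  proof (rule nilpotent_if_traces_zero)
    have "trace (d ** mpow x k) = 0" if "d \<in> orbit_span" for d k
      using that
    proof (induction rule: cs.span_induct)
      case base
      show ?case by (simp add: cs.subspace_def matrix_add_distrib trace_add)
    next
      case (step d)
      obtain h where h: "h \<in> Lie G" "lie_bracket h d = d" by (rule orbit_bracket[OF step], rule that, assumption+)
      have "lie_bracket d (mpow x k) = 0"
        using mpow_commute[OF comm[OF orbit_base(1)[OF step]], of k] by (simp add: lie_bracket_def)
      then have "trace (lie_bracket h d ** mpow x k) = 0" by (simp add: trace_bracket)
      then show ?case by (simp add: h(2))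
    qed
    from this[OF x(1)] show "trace (mpow x k) = 0" if "k > 0" for k
      using that by (cases k) (simp_all add: mpow_Suc)
  qed
  show ?thesis
  proof (rule trace_form_nondegenerate[OF red])
    show "x \<in> Lie G" by (rule subsetD[OF orbit_span_Lie x(1)])
    show "trace (x ** Y) = 0" if "Y \<in> Lie G" for Y
      by (rule nilpotent_commuting_trace[OF \<open>nilpotent_mat x\<close> comm[OF that]])
  qed
qed

text \<open>The last nonzero term of the derived series of a solvable ideal is an abelian ideal,
  hence central in the span. A central element commutes with each nilpotent \<open>t\<close> in the
  orbit, so it is orthogonal to \<open>t\<close> and therefore zero.\<close>

lemma orbit_span_semisimple: "semisimple_lie orbit_span"
  unfolding semisimple_lie_def
proof (intro allI impI, rule ccontr)
  fix R assume R: "lie_ideal orbit_span R \<and> solvable_lie R" and "R \<noteq> {0}"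
  obtain k where k: "derived_series R k = {0}" "\<And>j. j < k \<Longrightarrow> derived_series R j \<noteq> {0}"
    using R exists_least_iff[of "\<lambda>k. derived_series R k = {0}"] by (auto simp: solvable_lie_def)
  have "k \<noteq> 0" using k(1) \<open>R \<noteq> {0}\<close> by (cases k) auto
  then obtain j where j: "k = Suc j" by (cases k) auto
  let ?a = "derived_series R j"
  have "lie_ideal orbit_span ?a" using R by (intro derived_series_ideal) simp
  then have a: "cs.subspace ?a" "?a \<subseteq> orbit_span" "\<And>y x. y \<in> orbit_span \<Longrightarrow> x \<in> ?a \<Longrightarrow> lie_bracket y x \<in> ?a"
    by (auto simp: lie_ideal_def)
  have abelian: "lie_bracket x x' = 0" if "x \<in> ?a" "x' \<in> ?a" for x x'
  proof -
    have "lie_bracket x x' \<in> derived_series R k"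
      unfolding j derived_series.simps by (rule cs.span_base) (use that in blast)
    then show ?thesis using k(1) by simp
  qed
  have "x = 0" if x: "x \<in> ?a" for x
  proof (rule orbit_span_nondegenerate)
    show x_span: "x \<in> orbit_span" by (rule subsetD[OF a(2) x])
    have comm: "x ** y = y ** x" if y: "y \<in> orbit_span" for y
    proof -
      have "lie_bracket x y = 0"
      proof (rule orbit_span_nondegenerate)
        show "lie_bracket x y \<in> orbit_span" by (rule orbit_span_bracket[OF subsetD[OF orbit_span_Lie x_span] y])
        show "trace (lie_bracket x y ** t) = 0" if "t \<in> orbit_span" for t
          by (rule abelian_ideal_trace[OF a abelian x y that])
      qed
      then show ?thesis by (simp add: lie_bracket_def)
    qed
    show "trace (x ** t) = 0" if "t \<in> orbit_span" for t
      using that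
    proof (induction rule: cs.span_induct)
      case base
      show ?case by (simp add: cs.subspace_def matrix_add_distrib trace_add)
    next
      case (step t)
      have "trace (t ** x) = 0"
        by (rule nilpotent_commuting_trace[OF orbit_base(2)[OF step] comm[OF cs.span_base[OF step], symmetric]])
      then show ?case using trace_mul_sym[of x t] by simp
    qed
  qed
  then have "?a = {0}" using cs.subspace_0[OF a(1)] by auto
  then show False using k(2)[of j] j by simp
qed

theorem smallest_semisimple_ideal_eq: "smallest_semisimple_ideal (Lie G) Orb = orbit_span"
  unfolding smallest_semisimple_ideal_def
proof (rule Least_equality)
  show "lie_ideal (Lie G) orbit_span \<and> semisimple_lie orbit_span \<and> Orb \<subseteq> orbit_span"
    using orbit_span_Lie orbit_span_bracket orbit_span_semisimple cs.span_superset[of Orb]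
    by (simp add: lie_ideal_def)
  show "orbit_span \<subseteq> I" if "lie_ideal (Lie G) I \<and> semisimple_lie I \<and> Orb \<subseteq> I" for I
    using that by (intro cs.span_minimal) (auto simp: lie_ideal_def)
qed

text \<open>The union of the tangent spaces at all points of the orbit, as subspaces through the
  origin.\<close>

definition bracket_cone :: "(complex^'n^'n) set"
  where "bracket_cone = {y. \<exists>x\<in>Orb. y \<in> lie_bracket x ` Lie G}"

lemma eta_image: "eta ` (G \<times> lie_bracket e ` Lie G) = bracket_cone"
proof
  show "eta ` (G \<times> lie_bracket e ` Lie G) \<subseteq> bracket_cone"
  proof
    fix z assume "z \<in> eta ` (G \<times> lie_bracket e ` Lie G)"
    then obtain g y where g: "g \<in> G" "y \<in> Lie G" "z = Ad g (lie_bracket e y)" by (auto simp: eta_def)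
    then have "z = lie_bracket (Ad g e) (Ad g y)"
      by (simp add: Ad_bracket algebraic_group_invertible[OF G])
    moreover have "Ad g e \<in> Orb" using g(1) by (auto simp: Orb)
    ultimately show "z \<in> bracket_cone" using Lie_Ad[OF G g(1,2)] by (auto simp: bracket_cone_def)
  qed
  show "bracket_cone \<subseteq> eta ` (G \<times> lie_bracket e ` Lie G)"
  proof
    fix z assume "z \<in> bracket_cone"
    then obtain x y where x: "x \<in> Orb" and xy: "y \<in> Lie G" "z = lie_bracket x y"
      by (auto simp: bracket_cone_def)
    then obtain g where g: "g \<in> G" and y: "y \<in> Lie G" "z = lie_bracket (Ad g e) y"
      by (auto simp: Orb)
    note inv = algebraic_group_invertible[OF G g]
    have "z = Ad g (lie_bracket e (Ad (matrix_inv g) y))"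
      by (simp add: y(2) Ad_bracket[OF inv] Ad_inv_cancel[OF inv])
    moreover have "Ad (matrix_inv g) y \<in> Lie G" by (rule Lie_Ad[OF G algebraic_group_inv[OF G g] y(1)])
    ultimately show "z \<in> eta ` (G \<times> lie_bracket e ` Lie G)"
      using g by (intro image_eqI[of _ _ "(g, lie_bracket e (Ad (matrix_inv g) y))"]) (auto simp: eta_def)
  qed
qed

lemma bracket_cone_span: "bracket_cone \<subseteq> orbit_span"
proof
  fix z assume "z \<in> bracket_cone"
  then obtain x y where x: "x \<in> Orb" and y: "y \<in> Lie G" and z: "z = lie_bracket x y"
    by (auto simp: bracket_cone_def)
  show "z \<in> orbit_span"
    using cs.span_neg[OF orbit_span_bracket[OF y cs.span_base[OF x]]] lie_bracket_skew[of x y] z by simp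
qed

lemma closure_bracket_cone_span: "zariski_mat closure_of bracket_cone \<subseteq> orbit_span"
proof
  fix v assume v: "v \<in> zariski_mat closure_of bracket_cone"
  show "v \<in> orbit_span"
  proof (rule ccontr)
    assume "v \<notin> orbit_span"
    obtain z where z: "\<And>s. s \<in> orbit_span \<Longrightarrow> trace (z ** s) = 0" "trace (z ** v) \<noteq> 0"
      by (rule trace_separation[OF cs.subspace_span \<open>v \<notin> orbit_span\<close>], rule that, assumption+)
    have "(\<lambda>x. trace (z ** x)) \<in> vanishing bracket_cone"
      by (rule vanishingI[OF poly_funs_trace z(1)[OF subsetD[OF bracket_cone_span]]])
    with v z(2) show False by (auto simp: closure_of_zariski)
  qed
qed

section \<open>Jets of the orbit closure over the orbit and over the origin\<close>

definition tangent_jet :: "complex^'n^'n \<Rightarrow> complex^'n^'n \<Rightarrow> nat \<Rightarrow> complex^'n^'n"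
  where "tangent_jet x v = (\<lambda>_. 0)(0 := x, 1 := v)"

lemma tangent_jet_nth [simp]:
  "tangent_jet x v 0 = x" "tangent_jet x v (Suc 0) = v" "k > Suc 0 \<Longrightarrow> tangent_jet x v k = 0"
  by (simp_all add: tangent_jet_def)

lemma vanishing_closure: "vanishing (zariski_mat closure_of Orb) = vanishing Orb"
proof -
  have "Orb \<subseteq> zariski_mat closure_of Orb" by (simp add: closure_of_subset)
  then show ?thesis unfolding closure_of_zariski by (auto simp: vanishing_ideal_def)
qed

lemma jets_closure:
  "\<gamma> \<in> jets 1 (vanishing Orb) \<longleftrightarrow> \<gamma> = tangent_jet (\<gamma> 0) (\<gamma> 1) \<and>
    (\<forall>f\<in>vanishing Orb. f (\<gamma> 0) = 0 \<and> dir_deriv f (\<gamma> 0) (\<gamma> 1) = 0)"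
proof -
  have "(\<forall>k>1. \<gamma> k = 0) \<longleftrightarrow> \<gamma> = tangent_jet (\<gamma> 0) (\<gamma> 1)"
  proof
    assume "\<forall>k>1. \<gamma> k = 0"
    then have "\<gamma> k = tangent_jet (\<gamma> 0) (\<gamma> 1) k" for k
      by (cases "k = 0"; cases "k = 1") (auto simp: tangent_jet_def)
    then show "\<gamma> = tangent_jet (\<gamma> 0) (\<gamma> 1)" by (rule ext)
  next
    assume eq: "\<gamma> = tangent_jet (\<gamma> 0) (\<gamma> 1)"
    show "\<forall>k>1. \<gamma> k = 0"
    proof (intro allI impI)
      fix k :: nat assume "k > 1"
      then show "\<gamma> k = 0" by (subst eq) simp
    qed
  qed
  moreover have "vanishing Orb \<subseteq> poly_funs mat_coords" by (auto simp: vanishing_ideal_def)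
  ultimately show ?thesis by (simp only: jets_1)
qed

lemma jets_over_origin: "jets_over 1 (vanishing Orb) {0} = tangent_jet 0 ` orbit_span"
proof (intro equalityI subsetI)
  fix \<gamma> assume "\<gamma> \<in> jets_over 1 (vanishing Orb) {0}"
  then have "\<gamma> \<in> jets 1 (vanishing Orb)" and 0: "\<gamma> 0 = 0" by (simp_all add: jets_over_def)
  then have *: "\<gamma> = tangent_jet 0 (\<gamma> 1)" "\<forall>f\<in>vanishing Orb. f 0 = 0 \<and> dir_deriv f 0 (\<gamma> 1) = 0"
    unfolding jets_closure by simp_all
  then show "\<gamma> \<in> tangent_jet 0 ` orbit_span" unfolding cone_tangent by (rule image_eqI)
next
  fix \<gamma> assume "\<gamma> \<in> tangent_jet 0 ` orbit_span"
  then obtain v where v: "v \<in> orbit_span" and \<gamma>: "\<gamma> = tangent_jet 0 v" by auto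
  have "\<gamma> 0 = 0" "\<gamma> 1 = v" by (simp_all add: \<gamma>)
  moreover from this v have "\<gamma> \<in> jets 1 (vanishing Orb)"
    unfolding jets_closure using cone_tangent[of v] \<gamma> by simp
  ultimately show "\<gamma> \<in> jets_over 1 (vanishing Orb) {0}" by (simp add: jets_over_def)
qed

lemma jets_over_orbit:
  "\<gamma> \<in> jets_over 1 (vanishing Orb) Orb \<longleftrightarrow>
    (\<exists>x\<in>Orb. \<exists>v\<in>lie_bracket x ` Lie G. \<gamma> = tangent_jet x v)"
proof
  assume "\<gamma> \<in> jets_over 1 (vanishing Orb) Orb"
  then have "\<gamma> \<in> jets 1 (vanishing Orb)" and 0: "\<gamma> 0 \<in> Orb" by (simp_all add: jets_over_def)
  then have *: "\<gamma> = tangent_jet (\<gamma> 0) (\<gamma> 1)" "\<forall>f\<in>vanishing Orb. dir_deriv f (\<gamma> 0) (\<gamma> 1) = 0"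
    unfolding jets_closure by simp_all
  have "\<gamma> 1 \<in> lie_bracket (\<gamma> 0) ` Lie G" using *(2) unfolding orbit_tangent[OF 0] .
  with 0 *(1) show "\<exists>x\<in>Orb. \<exists>v\<in>lie_bracket x ` Lie G. \<gamma> = tangent_jet x v"
    by (intro bexI[of _ "\<gamma> 0"] bexI[of _ "\<gamma> 1"])
next
  assume "\<exists>x\<in>Orb. \<exists>v\<in>lie_bracket x ` Lie G. \<gamma> = tangent_jet x v"
  then obtain x v where x: "x \<in> Orb" and v: "v \<in> lie_bracket x ` Lie G" and \<gamma>: "\<gamma> = tangent_jet x v"
    by (elim bexE) (rule that)
  have \<gamma>01: "\<gamma> 0 = x" "\<gamma> 1 = v" by (simp_all add: \<gamma>)
  have "\<forall>f\<in>vanishing Orb. dir_deriv f x v = 0" using v unfolding orbit_tangent[OF x] .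
  then have "\<gamma> \<in> jets 1 (vanishing Orb)"
    unfolding jets_closure \<gamma>01 using \<gamma> vanishing_zero[OF _ x] by simp
  then show "\<gamma> \<in> jets_over 1 (vanishing Orb) Orb" using x \<gamma>01 by (simp add: jets_over_def)
qed

text \<open>\<open>jet_coords\<close> has coordinates for every order \<open>k\<close>; those with
  \<open>k > 1\<close> vanish on first-order jets, which is the third case.\<close>

lemma tangent_jet_coords:
  assumes "c \<in> jet_coords"
  obtains (base) i j where "\<And>x v. c (tangent_jet x v) = x $ i $ j"
    | (fibre) i j where "\<And>x v. c (tangent_jet x v) = v $ i $ j"
    | (zero) "\<And>x v. c (tangent_jet x v) = 0"
proof -
  obtain k i j where c: "c = (\<lambda>\<gamma>. \<gamma> k $ i $ j)" using assms by (auto simp: jet_coords_def)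
  consider "k = 0" | "k = 1" | "k > 1" by linarith
  then show thesis
  proof cases
    case 1
    then show thesis using base by (simp add: c)
  next
    case 2
    then show thesis using fibre by (simp add: c)
  next
    case 3
    then show thesis using zero by (simp add: c)
  qed
qed

text \<open>
  The cone structure lets the base point of a tangent vector \<open>y\<close> at \<open>x\<close> be contracted along
  \<open>t x\<close> to the origin while \<open>y\<close> stays fixed.
\<close>

lemma closure_over_origin:
  "tangent_jet 0 v \<in> zariski jet_coords closure_of jets_over 1 (vanishing Orb) Orb \<longleftrightarrow>
    v \<in> zariski_mat closure_of bracket_cone" (is "?l \<longleftrightarrow> ?r")
proof
  assume l: ?l
  show ?r unfolding closure_of_zariski
  proof (intro CollectI ballI)
    fix f assume f: "f \<in> vanishing bracket_cone"
    let ?F = "\<lambda>\<gamma>. f (\<gamma> 1)"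
    have "?F \<in> poly_funs jet_coords"
    proof (rule poly_map_compose[OF vanishing_poly[OF f]])
      show "poly_map jet_coords (\<lambda>\<gamma> :: nat \<Rightarrow> complex^'n^'n. \<gamma> 1)"
        unfolding poly_map_def by (intro allI poly_funs.coord) (auto simp: jet_coords_def)
    qed
    moreover have "?F \<gamma> = 0" if \<gamma>: "\<gamma> \<in> jets_over 1 (vanishing Orb) Orb" for \<gamma>
    proof -
      obtain x v where "x \<in> Orb" "v \<in> lie_bracket x ` Lie G" "\<gamma> = tangent_jet x v"
        using \<gamma> unfolding jets_over_orbit by (elim bexE) (rule that)
      then show ?thesis by (intro vanishing_zero[OF f]) (auto simp: bracket_cone_def)
    qed
    ultimately have "?F \<in> vanishing_ideal jet_coords (jets_over 1 (vanishing Orb) Orb)"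
      by (simp add: vanishing_ideal_def)
    then have "?F (tangent_jet 0 v) = 0"
      by (rule bspec[OF l[unfolded closure_of_zariski mem_Collect_eq]])
    then show "f v = 0" by simp
  qed
next
  assume r: ?r
  show ?l unfolding closure_of_zariski
  proof (intro CollectI ballI)
    fix F assume F: "F \<in> vanishing_ideal jet_coords (jets_over 1 (vanishing Orb) Orb)"
    then have F_poly: "F \<in> poly_funs jet_coords"
      and F_zero: "\<And>\<gamma>. \<gamma> \<in> jets_over 1 (vanishing Orb) Orb \<Longrightarrow> F \<gamma> = 0"
      by (auto simp: vanishing_ideal_def)
    have "F (tangent_jet 0 y) = 0" if y: "y \<in> bracket_cone" for y
    proof -
      obtain x z where x: "x \<in> Orb" and z: "z \<in> Lie G" "y = lie_bracket x z"
        using y by (auto simp: bracket_cone_def)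
      have "\<exists>p. \<forall>t. F (tangent_jet (cscale t x) y) = poly p t"
      proof (rule poly_funs_compose_poly[OF F_poly, where \<phi> = "\<lambda>t. tangent_jet (cscale t x) y"])
        fix c :: "(nat \<Rightarrow> complex^'n^'n) \<Rightarrow> complex" assume "c \<in> jet_coords"
        then show "\<exists>p. \<forall>t. c (tangent_jet (cscale t x) y) = poly p t"
        proof (cases rule: tangent_jet_coords)
          case (base i j)
          then show ?thesis by (intro exI[of _ "[:0, x $ i $ j:]"]) simp
        next
          case (fibre i j)
          then show ?thesis by (intro exI[of _ "[:y $ i $ j:]"]) simp
        next
          case zero
          then show ?thesis by (intro exI[of _ 0]) simp
        qed
      qed
      then obtain p where p: "\<And>t. F (tangent_jet (cscale t x) y) = poly p t" by blast
      have "poly p t = 0" if t: "t \<noteq> 0" for t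
      proof -
        \<comment> \<open>Rescaling \<open>z\<close> by the inverse of \<open>t\<close> compensates
          the scaling of the base point, so \<open>y\<close> stays tangent at
          \<open>cscale t x\<close>.\<close>
        have "y = lie_bracket (cscale t x) (cscale (inverse t) z)"
          using t by (simp add: z(2) lie_bracket_linear)
        moreover have "cscale (inverse t) z \<in> Lie G" by (rule cs.subspace_scale[OF Lie_subspace[OF G] z(1)])
        ultimately have "y \<in> lie_bracket (cscale t x) ` Lie G" by (rule image_eqI)
        with orbit_cone[OF x t] have "tangent_jet (cscale t x) y \<in> jets_over 1 (vanishing Orb) Orb"
          unfolding jets_over_orbit by (intro bexI[of _ "cscale t x"] bexI[of _ y] refl)
        then show ?thesis unfolding p[symmetric] by (rule F_zero)
      qed
      then have "p = 0" by (rule poly_zero_if_zero_off_zero)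
      then show ?thesis using p[of 0] by simp
    qed
    moreover have "(\<lambda>y. F (tangent_jet 0 y)) \<in> poly_funs mat_coords"
    proof (rule poly_funs_compose[OF F_poly])
      fix c :: "(nat \<Rightarrow> complex^'n^'n) \<Rightarrow> complex" assume "c \<in> jet_coords"
      then show "(\<lambda>y. c (tangent_jet 0 y)) \<in> poly_funs mat_coords"
      proof (cases rule: tangent_jet_coords)
        case (base i j)
        then show ?thesis by (simp add: poly_funs.const)
      next
        case (fibre i j)
        then show ?thesis by (simp add: poly_map_id[unfolded poly_map_def, rule_format])
      next
        case zero
        then show ?thesis by (simp add: poly_funs.const)
      qed
    qed
    ultimately have "(\<lambda>y. F (tangent_jet 0 y)) \<in> vanishing bracket_cone" by (intro vanishingI)
    then show "F (tangent_jet 0 v) = 0"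
      by (rule bspec[OF r[unfolded closure_of_zariski mem_Collect_eq]])
  qed
qed

theorem RC1_iff: "RC1 Orb \<longleftrightarrow> \<not> orbit_span \<subseteq> zariski_mat closure_of bracket_cone"
proof -
  let ?I = "vanishing Orb"
  have sub: "jets_over 1 ?I S \<subseteq> jets 1 ?I" for S by (auto simp: jets_over_def)
  have "jet_space 1 ?I closure_of jets_over 1 ?I Orb =
      jets 1 ?I \<inter> zariski jet_coords closure_of jets_over 1 ?I Orb"
    unfolding jet_space_def closure_of_subtopology using sub[of Orb] by (simp add: Int_absorb1)
  then have "RC1 Orb \<longleftrightarrow>
      \<not> jets_over 1 ?I {0} \<subseteq> zariski jet_coords closure_of jets_over 1 ?I Orb"
    unfolding RC1_def Let_def vanishing_closure using sub[of "{0}"] by simp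
  also have "\<dots> \<longleftrightarrow> \<not> orbit_span \<subseteq> zariski_mat closure_of bracket_cone"
    unfolding jets_over_origin image_subset_iff closure_over_origin by (simp add: subset_iff Bex_def Ball_def)
  finally show ?thesis .
qed

text \<open>The closure among all matrices stays in the orbit span, hence in \<open>Lie G\<close>,
  so both closures agree.\<close>

lemma closure_eta:
  "subtopology zariski_mat (Lie G) closure_of (eta ` (G \<times> lie_bracket e ` Lie G)) =
    zariski_mat closure_of bracket_cone"
proof -
  have "Lie G \<inter> bracket_cone = bracket_cone" using bracket_cone_span orbit_span_Lie by blast
  then show ?thesis
    unfolding closure_of_subtopology eta_image
    using closure_bracket_cone_span orbit_span_Lie by (simp add: Int_absorb1)
qed

end

theorem proposition3p6:
  fixes G Orb :: "(complex^'n^'n) set" and e :: "complex^'n^'n"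
  assumes "connected_reductive_group G"
    and "nilpotent_orbit G Orb" and "Orb \<noteq> {0}" and "e \<in> Orb"
  shows "RC1 Orb \<longleftrightarrow>
    subtopology zariski_mat (Lie G) closure_of (eta ` (G \<times> lie_bracket e ` Lie G))
      \<subset> smallest_semisimple_ideal (Lie G) Orb"
proof -
  have red: "reductive_group G" using assms(1) by (simp add: connected_reductive_group_def)
  obtain x where x: "x \<in> Lie G" "nilpotent_mat x" "Orb = {Ad g x | g. g \<in> G}"
    using assms(2) by (auto simp: nilpotent_orbit_def)
  \<comment> \<open>The definition of a nilpotent orbit yields some base point \<open>x\<close>;
    from it \<open>e\<close> is seen to be a nilpotent element of \<open>Lie G\<close>, and the
    locale is entered again at \<open>e\<close>.\<close>
  interpret base: reductive_nilpotent_orbit G Orb x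
    by unfold_locales (rule red x)+
  note G = base.G
  obtain h where h: "h \<in> G" "e = Ad h x" using assms(4) x(3) by auto
  note inv = algebraic_group_invertible[OF G]
  have "Orb = {Ad g e | g. g \<in> G}"
  proof (intro equalityI subsetI)
    fix y assume "y \<in> {Ad g e | g. g \<in> G}"
    then show "y \<in> Orb" using base.orbit_base(3)[OF assms(4)] by auto
  next
    fix y assume "y \<in> Orb"
    then obtain g where g: "g \<in> G" "y = Ad g x" using x(3) by auto
    have "y = Ad (g ** matrix_inv h) e"
      unfolding Ad_Ad[OF inv[OF g(1)] inv[OF algebraic_group_inv[OF G h(1)]], symmetric]
      by (simp add: h(2) g(2) Ad_inv_cancel(1)[OF inv[OF h(1)]])
    moreover have "g ** matrix_inv h \<in> G"
      by (intro algebraic_group_mult[OF G] algebraic_group_inv[OF G] g h)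
    ultimately show "y \<in> {Ad g e | g. g \<in> G}" by auto
  qed
  then interpret reductive_nilpotent_orbit G Orb e
    by unfold_locales (rule red base.orbit_base(1,2)[OF assms(4)])+
  \<comment> \<open>The closure always lies in the ideal, so strict inclusion means that the ideal
    is not contained in the closure.\<close>
  show ?thesis
    unfolding RC1_iff closure_eta smallest_semisimple_ideal_eq
    using closure_bracket_cone_span by auto
qed

end
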